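(* Let $R$ be a commutative ring, $M$ a finitely generated flat $R$-module, and $X\subseteq\operatorname{Spec}(R)$ a subset. Put $S:=\prod_{\mathfrak{p}\in X}\kappa(\mathfrak{p})$ and $S':=\prod_{\mathfrak{p}\in X_{g}}\kappa(\mathfrak{p})$, where $X_g$ is the generalization cone of $X$. Then $M\otimes_{R}S$ is a projective $S$-module if and only if $M\otimes_{R}S'$ is a projective $S'$-module.
   Context: All rings are commutative (with identity). For a prime ideal $\mathfrak{p}$ of $R$, $\kappa(\mathfrak{p})=R_{\mathfrak p}/\mathfrak{p}R_{\mathfrak p}$ denotes the residue field of $R$ at $\mathfrak{p}$; products of residue fields are $R$-algebras via the canonical maps. For a subset $X\subseteq\operatorname{Spec}(R)$, the generalization cone of $X$ is $X_{g}:=\bigcup_{\mathfrak{p}\in X}\Lambda(\mathfrak{p})$, where $\Lambda(\mathfrak{p})=\{\mathfrak{q}\in\operatorname{Spec}(R):\mathfrak{q}\subseteq\mathfrak{p}\}$. *)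

theory Defs
  imports "HOL-Algebra.Module" "HOL-Algebra.QuotRing"
begin

section \<open>Modules: homomorphisms, finite generation, quotients, free modules\<close>

definition lin_hom ::
  "('a, 'r) ring_scheme \<Rightarrow> ('a, 'b, 'm) module_scheme \<Rightarrow> ('a, 'c, 'n) module_scheme \<Rightarrow> ('b \<Rightarrow> 'c) set"
  where "lin_hom R M N =
    {f \<in> carrier M \<rightarrow> carrier N.
       (\<forall>x\<in>carrier M. \<forall>y\<in>carrier M. f (x \<oplus>\<^bsub>M\<^esub> y) = f x \<oplus>\<^bsub>N\<^esub> f y) \<and>
       (\<forall>r\<in>carrier R. \<forall>x\<in>carrier M. f (r \<odot>\<^bsub>M\<^esub> x) = r \<odot>\<^bsub>N\<^esub> f x)}"

definition module_span ::
  "('a, 'r) ring_scheme \<Rightarrow> ('a, 'b, 'm) module_scheme \<Rightarrow> 'b set \<Rightarrow> 'b set"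
  where "module_span R M A = \<Inter>{H. submodule H R M \<and> A \<subseteq> H}"

definition finitely_generated ::
  "('a, 'r) ring_scheme \<Rightarrow> ('a, 'b, 'm) module_scheme \<Rightarrow> bool"
  where "finitely_generated R M \<longleftrightarrow>
    (\<exists>A. finite A \<and> A \<subseteq> carrier M \<and> module_span R M A = carrier M)"

text \<open>The record type of modules extends that of rings; the fields \<open>mult\<close> and \<open>one\<close> play no
  role in the locale \<^locale>\<open>module\<close> and are left unspecified below.\<close>

definition quot_module ::
  "('a, 'r) ring_scheme \<Rightarrow> ('a, 'b, 'm) module_scheme \<Rightarrow> 'b set \<Rightarrow> ('a, 'b set) module"
  where "quot_module R M H =
    \<lparr>carrier = a_rcosets\<^bsub>M\<^esub> H, mult = undefined, one = undefined, zero = H, add = set_add M,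
     smult = (\<lambda>r C. \<Union>x\<in>C. H +>\<^bsub>M\<^esub> (r \<odot>\<^bsub>M\<^esub> x))\<rparr>"

definition free_module :: "('a, 'r) ring_scheme \<Rightarrow> 'i set \<Rightarrow> ('a, 'i \<Rightarrow> 'a) module"
  where "free_module R I =
    \<lparr>carrier = {x. (\<forall>i. x i \<in> carrier R) \<and> (\<forall>i. i \<notin> I \<longrightarrow> x i = \<zero>\<^bsub>R\<^esub>) \<and> finite {i. x i \<noteq> \<zero>\<^bsub>R\<^esub>}},
     mult = undefined, one = undefined, zero = (\<lambda>i. \<zero>\<^bsub>R\<^esub>), add = (\<lambda>x y i. x i \<oplus>\<^bsub>R\<^esub> y i),
     smult = (\<lambda>r x i. r \<otimes>\<^bsub>R\<^esub> x i)\<rparr>"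

definition free_gen :: "('a, 'r) ring_scheme \<Rightarrow> 'i \<Rightarrow> ('i \<Rightarrow> 'a)"
  where "free_gen R i = (\<lambda>j. if j = i then \<one>\<^bsub>R\<^esub> else \<zero>\<^bsub>R\<^esub>)"

text \<open>The linear map from a free module to \<open>N\<close> which is \<open>u\<close> on the basis elements.\<close>

definition free_extend ::
  "('a, 'r) ring_scheme \<Rightarrow> ('a, 'c, 'n) module_scheme \<Rightarrow> ('i \<Rightarrow> 'c) \<Rightarrow> ('i \<Rightarrow> 'a) \<Rightarrow> 'c"
  where "free_extend R N u x = (\<Oplus>\<^bsub>N\<^esub>i\<in>{i. x i \<noteq> \<zero>\<^bsub>R\<^esub>}. x i \<odot>\<^bsub>N\<^esub> u i)"


section \<open>Tensor products and flatness\<close>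

definition tensor_rels ::
  "('a, 'r) ring_scheme \<Rightarrow> ('a, 'b, 'm) module_scheme \<Rightarrow> ('a, 'c, 'n) module_scheme \<Rightarrow> ('b \<times> 'c \<Rightarrow> 'a) set"
  where "tensor_rels R M N = (let F = free_module R (carrier M \<times> carrier N); e = free_gen R in
      {e (x \<oplus>\<^bsub>M\<^esub> x', y) \<ominus>\<^bsub>F\<^esub> (e (x, y) \<oplus>\<^bsub>F\<^esub> e (x', y)) | x x' y.
         x \<in> carrier M \<and> x' \<in> carrier M \<and> y \<in> carrier N}
    \<union> {e (x, y \<oplus>\<^bsub>N\<^esub> y') \<ominus>\<^bsub>F\<^esub> (e (x, y) \<oplus>\<^bsub>F\<^esub> e (x, y')) | x y y'.
         x \<in> carrier M \<and> y \<in> carrier N \<and> y' \<in> carrier N}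
    \<union> {e (r \<odot>\<^bsub>M\<^esub> x, y) \<ominus>\<^bsub>F\<^esub> r \<odot>\<^bsub>F\<^esub> e (x, y) | r x y.
         r \<in> carrier R \<and> x \<in> carrier M \<and> y \<in> carrier N}
    \<union> {e (x, r \<odot>\<^bsub>N\<^esub> y) \<ominus>\<^bsub>F\<^esub> r \<odot>\<^bsub>F\<^esub> e (x, y) | r x y.
         r \<in> carrier R \<and> x \<in> carrier M \<and> y \<in> carrier N})"

definition tensor_ker ::
  "('a, 'r) ring_scheme \<Rightarrow> ('a, 'b, 'm) module_scheme \<Rightarrow> ('a, 'c, 'n) module_scheme \<Rightarrow> ('b \<times> 'c \<Rightarrow> 'a) set"
  where "tensor_ker R M N =
    module_span R (free_module R (carrier M \<times> carrier N)) (tensor_rels R M N)"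

definition tensor ::
  "('a, 'r) ring_scheme \<Rightarrow> ('a, 'b, 'm) module_scheme \<Rightarrow> ('a, 'c, 'n) module_scheme \<Rightarrow> ('a, ('b \<times> 'c \<Rightarrow> 'a) set) module"
  where "tensor R M N =
    quot_module R (free_module R (carrier M \<times> carrier N)) (tensor_ker R M N)"

definition tensor_elem ::
  "('a, 'r) ring_scheme \<Rightarrow> ('a, 'b, 'm) module_scheme \<Rightarrow> ('a, 'c, 'n) module_scheme \<Rightarrow>
    'b \<Rightarrow> 'c \<Rightarrow> ('b \<times> 'c \<Rightarrow> 'a) set"
  where "tensor_elem R M N x y =
    tensor_ker R M N +>\<^bsub>free_module R (carrier M \<times> carrier N)\<^esub> free_gen R (x, y)"

text \<open>The map \<open>f \<otimes> g\<close> from a tensor product \<open>M \<otimes> N\<close> to \<open>M' \<otimes> N'\<close>; the source modules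
  are not needed as arguments.\<close>

definition tensor_map ::
  "('a, 'r) ring_scheme \<Rightarrow> ('a, 'd, 'm) module_scheme \<Rightarrow> ('a, 'e, 'n) module_scheme \<Rightarrow>
    ('b \<Rightarrow> 'd) \<Rightarrow> ('c \<Rightarrow> 'e) \<Rightarrow> ('b \<times> 'c \<Rightarrow> 'a) set \<Rightarrow> ('d \<times> 'e \<Rightarrow> 'a) set"
  where "tensor_map R M' N' f g C = (let F' = free_module R (carrier M' \<times> carrier N') in
    \<Union>z\<in>C. tensor_ker R M' N' +>\<^bsub>F'\<^esub>
            free_extend R F' (\<lambda>(x, y). free_gen R (f x, g y)) z)"

text \<open>A definition in HOL cannot quantify over modules of all types. The test modules here have
  their carriers in the type of elements of \<open>R\<close>. These include the ideals of \<open>R\<close>, so by the ideal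
  criterion this is equivalent to exactness of \<open>M \<otimes> -\<close> on all modules.\<close>

definition flat :: "('a, 'r) ring_scheme \<Rightarrow> ('a, 'b, 'm) module_scheme \<Rightarrow> bool"
  where "flat R M \<longleftrightarrow> module R M \<and>
    (\<forall>(N :: ('a, 'a) module) (N' :: ('a, 'a) module) f.
       module R N \<longrightarrow> module R N' \<longrightarrow> f \<in> lin_hom R N N' \<longrightarrow> inj_on f (carrier N) \<longrightarrow>
       inj_on (tensor_map R M N' (\<lambda>x. x) f) (carrier (tensor R M N)))"


section \<open>Projective modules\<close>

text \<open>The lifting property is stated for test modules \<open>N\<close>, \<open>N'\<close> whose types accommodate the free
  module on \<open>carrier P\<close> and \<open>P\<close> itself; \<open>projective_lift\<close> below shows that it then holds for test
  modules of arbitrary types.\<close>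

definition projective :: "('s, 'r) ring_scheme \<Rightarrow> ('s, 'p, 'm) module_scheme \<Rightarrow> bool"
  where "projective S P \<longleftrightarrow> module S P \<and>
    (\<forall>(N :: ('s, 'p \<Rightarrow> 's) module) (N' :: ('s, 'p) module) g f.
       module S N \<longrightarrow> module S N' \<longrightarrow>
       g \<in> lin_hom S N N' \<longrightarrow> g ` carrier N = carrier N' \<longrightarrow> f \<in> lin_hom S P N' \<longrightarrow>
       (\<exists>h\<in>lin_hom S P N. \<forall>x\<in>carrier P. g (h x) = f x))"


section \<open>Base change\<close>

text \<open>An \<open>R\<close>-algebra is given by a ring \<open>S\<close> and its structure homomorphism \<open>\<phi>\<close> from \<open>R\<close> to \<open>S\<close>.
  On \<open>M \<otimes> S\<close> the ring \<open>S\<close> acts through the second factor.\<close>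

definition algebra_module ::
  "('s, 'q) ring_scheme \<Rightarrow> ('a \<Rightarrow> 's) \<Rightarrow> ('a, 's) module"
  where "algebra_module S \<phi> =
    \<lparr>carrier = carrier S, mult = mult S, one = one S, zero = zero S, add = add S,
     smult = (\<lambda>r s. \<phi> r \<otimes>\<^bsub>S\<^esub> s)\<rparr>"

definition base_change ::
  "('a, 'r) ring_scheme \<Rightarrow> ('s, 'q) ring_scheme \<Rightarrow> ('a \<Rightarrow> 's) \<Rightarrow> ('a, 'b, 'm) module_scheme \<Rightarrow>
    ('s, ('b \<times> 's \<Rightarrow> 'a) set) module"
  where "base_change R S \<phi> M = (let T = tensor R M (algebra_module S \<phi>) in
    \<lparr>carrier = carrier T, mult = undefined, one = undefined, zero = \<zero>\<^bsub>T\<^esub>, add = add T,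
     smult = (\<lambda>s. tensor_map R M (algebra_module S \<phi>) (\<lambda>x. x) (\<lambda>t. s \<otimes>\<^bsub>S\<^esub> t))\<rparr>)"


section \<open>Spectrum, residue fields and their products\<close>

definition Spec :: "('a, 'r) ring_scheme \<Rightarrow> 'a set set"
  where "Spec R = {p. primeideal p R}"

definition generalization_cone :: "('a, 'r) ring_scheme \<Rightarrow> 'a set set \<Rightarrow> 'a set set"
  where "generalization_cone R Y = (\<Union>p\<in>Y. {q \<in> Spec R. q \<subseteq> p})"

text \<open>The fraction \<open>a / s\<close>, as the class of \<open>(a, s)\<close> in \<open>R \<times> T\<close>. The operations of
  the localization are independent of representatives, so the unions below are over equal classes.\<close>

definition frac :: "('a, 'r) ring_scheme \<Rightarrow> 'a set \<Rightarrow> 'a \<Rightarrow> 'a \<Rightarrow> ('a \<times> 'a) set"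
  where "frac R T a s =
    {(b, t). b \<in> carrier R \<and> t \<in> T \<and> (\<exists>u\<in>T. u \<otimes>\<^bsub>R\<^esub> (a \<otimes>\<^bsub>R\<^esub> t) = u \<otimes>\<^bsub>R\<^esub> (b \<otimes>\<^bsub>R\<^esub> s))}"

definition localization :: "('a, 'r) ring_scheme \<Rightarrow> 'a set \<Rightarrow> ('a \<times> 'a) set ring"
  where "localization R T =
    \<lparr>carrier = {frac R T a s | a s. a \<in> carrier R \<and> s \<in> T},
     mult = (\<lambda>U V. \<Union>(a, s)\<in>U. \<Union>(b, t)\<in>V. frac R T (a \<otimes>\<^bsub>R\<^esub> b) (s \<otimes>\<^bsub>R\<^esub> t)),
     one = frac R T \<one>\<^bsub>R\<^esub> \<one>\<^bsub>R\<^esub>,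
     zero = frac R T \<zero>\<^bsub>R\<^esub> \<one>\<^bsub>R\<^esub>,
     add = (\<lambda>U V. \<Union>(a, s)\<in>U. \<Union>(b, t)\<in>V.
              frac R T (a \<otimes>\<^bsub>R\<^esub> t \<oplus>\<^bsub>R\<^esub> b \<otimes>\<^bsub>R\<^esub> s) (s \<otimes>\<^bsub>R\<^esub> t))\<rparr>"

definition local_ring_at :: "('a, 'r) ring_scheme \<Rightarrow> 'a set \<Rightarrow> ('a \<times> 'a) set ring"
  where "local_ring_at R p = localization R (carrier R - p)"

definition local_map :: "('a, 'r) ring_scheme \<Rightarrow> 'a set \<Rightarrow> 'a \<Rightarrow> ('a \<times> 'a) set"
  where "local_map R p a = frac R (carrier R - p) a \<one>\<^bsub>R\<^esub>"

text \<open>The extension \<open>p R\<^sub>p\<close> of \<open>p\<close> to the local ring.\<close>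

definition local_ideal :: "('a, 'r) ring_scheme \<Rightarrow> 'a set \<Rightarrow> ('a \<times> 'a) set set"
  where "local_ideal R p = genideal (local_ring_at R p) (local_map R p ` p)"

definition residue_field :: "('a, 'r) ring_scheme \<Rightarrow> 'a set \<Rightarrow> ('a \<times> 'a) set set ring"
  where "residue_field R p = local_ring_at R p Quot local_ideal R p"

definition residue_map :: "('a, 'r) ring_scheme \<Rightarrow> 'a set \<Rightarrow> 'a \<Rightarrow> ('a \<times> 'a) set set"
  where "residue_map R p a = local_ideal R p +>\<^bsub>local_ring_at R p\<^esub> local_map R p a"

definition product_ring :: "'i set \<Rightarrow> ('i \<Rightarrow> ('k, 'r) ring_scheme) \<Rightarrow> ('i \<Rightarrow> 'k) ring"
  where "product_ring I K =
    \<lparr>carrier = (\<Pi>\<^sub>E i\<in>I. carrier (K i)),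
     mult = (\<lambda>x y. \<lambda>i\<in>I. x i \<otimes>\<^bsub>K i\<^esub> y i),
     one = (\<lambda>i\<in>I. \<one>\<^bsub>K i\<^esub>),
     zero = (\<lambda>i\<in>I. \<zero>\<^bsub>K i\<^esub>),
     add = (\<lambda>x y. \<lambda>i\<in>I. x i \<oplus>\<^bsub>K i\<^esub> y i)\<rparr>"

definition residue_product :: "('a, 'r) ring_scheme \<Rightarrow> 'a set set \<Rightarrow> ('a set \<Rightarrow> ('a \<times> 'a) set set) ring"
  where "residue_product R Y = product_ring Y (residue_field R)"

definition residue_product_map ::
  "('a, 'r) ring_scheme \<Rightarrow> 'a set set \<Rightarrow> 'a \<Rightarrow> ('a set \<Rightarrow> ('a \<times> 'a) set set)"
  where "residue_product_map R Y a = (\<lambda>p\<in>Y. residue_map R p a)"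


section \<open>Free modules and lifting for test modules of arbitrary types\<close>

lemma free_module_supp: "x \<in> carrier (free_module R I) \<Longrightarrow> x i \<noteq> \<zero>\<^bsub>R\<^esub> \<Longrightarrow> i \<in> I"
  by (auto simp: free_module_def)

lemma free_module_coeff: "x \<in> carrier (free_module R I) \<Longrightarrow> x i \<in> carrier R"
  by (auto simp: free_module_def)

lemma free_gen_in: assumes "cring R" "i \<in> I"
  shows "free_gen R i \<in> carrier (free_module R I)"
proof -
  interpret cring R by fact
  have "finite {j. free_gen R i j \<noteq> \<zero>\<^bsub>R\<^esub>}"
    by (rule finite_subset[of _ "{i}"]) (auto simp: free_gen_def)
  then show ?thesis using assms(2) by (auto simp: free_module_def free_gen_def)
qed

lemma free_module_module: assumes "cring R" shows "module R (free_module R I)"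
proof -
  interpret cring R by fact
  show ?thesis
  proof (rule moduleI[OF assms])
    have fin: "finite {i. x i \<oplus>\<^bsub>R\<^esub> y i \<noteq> \<zero>\<^bsub>R\<^esub>}"
      if "finite {i. x i \<noteq> \<zero>\<^bsub>R\<^esub>}" "finite {i. y i \<noteq> \<zero>\<^bsub>R\<^esub>}" for x y
      by (rule finite_subset[OF _ finite_UnI[OF that]]) auto
    show "abelian_group (free_module R I)"
    proof (rule abelian_groupI)
      fix x assume x: "x \<in> carrier (free_module R I)"
      have "(\<lambda>i. \<ominus>\<^bsub>R\<^esub> x i) \<in> carrier (free_module R I)"
        using x by (auto simp: free_module_def elim!: rev_finite_subset)
      moreover have "(\<lambda>i. \<ominus>\<^bsub>R\<^esub> x i) \<oplus>\<^bsub>free_module R I\<^esub> x = \<zero>\<^bsub>free_module R I\<^esub>"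
        using x by (auto simp: free_module_def l_neg)
      ultimately show "\<exists>y\<in>carrier (free_module R I).
          y \<oplus>\<^bsub>free_module R I\<^esub> x = \<zero>\<^bsub>free_module R I\<^esub>" by blast
    qed (auto simp: free_module_def a_ac fin)
  next
    fix r x assume r: "r \<in> carrier R" "x \<in> carrier (free_module R I)"
    then have "finite {i. r \<otimes>\<^bsub>R\<^esub> x i \<noteq> \<zero>\<^bsub>R\<^esub>}"
      by (auto simp: free_module_def elim!: rev_finite_subset)
    with r show "r \<odot>\<^bsub>free_module R I\<^esub> x \<in> carrier (free_module R I)"
      by (auto simp: free_module_def)
  qed (auto simp: free_module_def l_distr r_distr m_assoc)
qed

lemma free_extend_superset:
  assumes M: "module R N" and u: "u \<in> I \<rightarrow> carrier N" and x: "x \<in> carrier (free_module R I)"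
    and A: "finite A" "{i. x i \<noteq> \<zero>\<^bsub>R\<^esub>} \<subseteq> A" "A \<subseteq> I"
  shows "free_extend R N u x = (\<Oplus>\<^bsub>N\<^esub>i\<in>A. x i \<odot>\<^bsub>N\<^esub> u i)"
proof -
  interpret module R N by fact
  show ?thesis unfolding free_extend_def
    by (rule M.add.finprod_mono_neutral_cong_left)
      (use A u x in \<open>auto simp: free_module_def Pi_def\<close>)
qed

lemma free_extend_linear:
  assumes M: "module R N" and u: "u \<in> I \<rightarrow> carrier N"
  shows "free_extend R N u \<in> lin_hom R (free_module R I) N"
proof -
  interpret module R N by fact
  have sup: "finite {i. x i \<noteq> \<zero>\<^bsub>R\<^esub>}" "{i. x i \<noteq> \<zero>\<^bsub>R\<^esub>} \<subseteq> I" "\<And>i. x i \<in> carrier R"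
    if "x \<in> carrier (free_module R I)" for x using that by (auto simp: free_module_def)
  show ?thesis unfolding lin_hom_def
  proof (safe)
    fix x assume x: "x \<in> carrier (free_module R I)"
    show "free_extend R N u x \<in> carrier N"
      unfolding free_extend_def using sup[OF x] u by (intro M.add.finprod_closed) auto
  next
    fix x y assume x: "x \<in> carrier (free_module R I)" and y: "y \<in> carrier (free_module R I)"
    let ?A = "{i. x i \<noteq> \<zero>\<^bsub>R\<^esub>} \<union> {i. y i \<noteq> \<zero>\<^bsub>R\<^esub>}"
    interpret F: module R "free_module R I" by (rule free_module_module[OF R.is_cring])
    have A: "finite ?A" "?A \<subseteq> I" using sup[OF x] sup[OF y] by auto
    have xy: "x \<oplus>\<^bsub>free_module R I\<^esub> y \<in> carrier (free_module R I)" using x y by simp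
    have xyv: "(x \<oplus>\<^bsub>free_module R I\<^esub> y) i = x i \<oplus>\<^bsub>R\<^esub> y i" for i
      by (simp add: free_module_def)
    have "free_extend R N u (x \<oplus>\<^bsub>free_module R I\<^esub> y)
       = (\<Oplus>\<^bsub>N\<^esub>i\<in>?A. (x i \<oplus>\<^bsub>R\<^esub> y i) \<odot>\<^bsub>N\<^esub> u i)"
      by (subst free_extend_superset[OF M u xy A(1) _ A(2)]) (auto simp: xyv)
    also have "\<dots> = (\<Oplus>\<^bsub>N\<^esub>i\<in>?A. x i \<odot>\<^bsub>N\<^esub> u i \<oplus>\<^bsub>N\<^esub> y i \<odot>\<^bsub>N\<^esub> u i)"
      by (rule M.add.finprod_cong') (use u A sup[OF x] sup[OF y] in \<open>auto simp: smult_l_distr Pi_def subset_iff\<close>)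
    also have "\<dots> = (\<Oplus>\<^bsub>N\<^esub>i\<in>?A. x i \<odot>\<^bsub>N\<^esub> u i) \<oplus>\<^bsub>N\<^esub> (\<Oplus>\<^bsub>N\<^esub>i\<in>?A. y i \<odot>\<^bsub>N\<^esub> u i)"
      by (rule M.add.finprod_multf) (use u A sup[OF x] sup[OF y] in \<open>auto simp: Pi_def subset_iff\<close>)
    also have "(\<Oplus>\<^bsub>N\<^esub>i\<in>?A. x i \<odot>\<^bsub>N\<^esub> u i) = free_extend R N u x"
      by (rule free_extend_superset[OF M u x A(1) _ A(2), symmetric]) auto
    also have "(\<Oplus>\<^bsub>N\<^esub>i\<in>?A. y i \<odot>\<^bsub>N\<^esub> u i) = free_extend R N u y"
      by (rule free_extend_superset[OF M u y A(1) _ A(2), symmetric]) auto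
    finally show "free_extend R N u (x \<oplus>\<^bsub>free_module R I\<^esub> y)
       = free_extend R N u x \<oplus>\<^bsub>N\<^esub> free_extend R N u y" .
  next
    fix r x assume r: "r \<in> carrier R" and x: "x \<in> carrier (free_module R I)"
    let ?A = "{i. x i \<noteq> \<zero>\<^bsub>R\<^esub>}"
    interpret F: module R "free_module R I" by (rule free_module_module[OF R.is_cring])
    have rx: "r \<odot>\<^bsub>free_module R I\<^esub> x \<in> carrier (free_module R I)" using r x by simp
    have v: "(r \<odot>\<^bsub>free_module R I\<^esub> x) i = r \<otimes>\<^bsub>R\<^esub> x i" for i
      by (simp add: free_module_def)
    have "free_extend R N u (r \<odot>\<^bsub>free_module R I\<^esub> x) = (\<Oplus>\<^bsub>N\<^esub>i\<in>?A. (r \<otimes>\<^bsub>R\<^esub> x i) \<odot>\<^bsub>N\<^esub> u i)"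
      by (subst free_extend_superset[OF M u rx sup(1)[OF x] _ sup(2)[OF x]]) (use r in \<open>auto simp: v\<close>)
    also have "\<dots> = (\<Oplus>\<^bsub>N\<^esub>i\<in>?A. r \<odot>\<^bsub>N\<^esub> (x i \<odot>\<^bsub>N\<^esub> u i))"
      by (rule M.add.finprod_cong') (use u r sup[OF x] in \<open>auto simp: smult_assoc1 Pi_def subset_iff\<close>)
    also have "\<dots> = r \<odot>\<^bsub>N\<^esub> free_extend R N u x"
      unfolding free_extend_def
      by (rule finsum_smult_ldistr[symmetric]) (use u r sup[OF x] in \<open>auto simp: Pi_def subset_iff\<close>)
    finally show "free_extend R N u (r \<odot>\<^bsub>free_module R I\<^esub> x) = r \<odot>\<^bsub>N\<^esub> free_extend R N u x" .
  qed
qed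

lemma free_extend_gen:
  assumes M: "module R N" and u: "u \<in> I \<rightarrow> carrier N" and i: "i \<in> I"
  shows "free_extend R N u (free_gen R i) = u i"
proof -
  interpret module R N by fact
  have "free_extend R N u (free_gen R i) = (\<Oplus>\<^bsub>N\<^esub>j\<in>{i}. free_gen R i j \<odot>\<^bsub>N\<^esub> u j)"
    by (rule free_extend_superset[OF M u free_gen_in[OF R.is_cring i]])
      (use i in \<open>auto simp: free_gen_def\<close>)
  also have "\<dots> = u i" using u i by (auto simp: free_gen_def Pi_def)
  finally show ?thesis .
qed

lemma lin_hom_finsum:
  assumes "module R M" "module R N" "g \<in> lin_hom R M N" "finite A" "f \<in> A \<rightarrow> carrier M"
  shows "g (\<Oplus>\<^bsub>M\<^esub>i\<in>A. f i) = (\<Oplus>\<^bsub>N\<^esub>i\<in>A. g (f i))"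
proof -
  interpret M: module R M by fact
  interpret N: module R N by fact
  have g: "g \<in> carrier M \<rightarrow> carrier N"
    "\<And>x y. x \<in> carrier M \<Longrightarrow> y \<in> carrier M \<Longrightarrow> g (x \<oplus>\<^bsub>M\<^esub> y) = g x \<oplus>\<^bsub>N\<^esub> g y"
    "\<And>r x. r \<in> carrier R \<Longrightarrow> x \<in> carrier M \<Longrightarrow> g (r \<odot>\<^bsub>M\<^esub> x) = r \<odot>\<^bsub>N\<^esub> g x"
    using assms(3) by (auto simp: lin_hom_def)
  have g0: "g \<zero>\<^bsub>M\<^esub> = \<zero>\<^bsub>N\<^esub>"
    using g(3)[of "\<zero>\<^bsub>R\<^esub>" "\<zero>\<^bsub>M\<^esub>"] g(1) by (simp add: Pi_def)
  show ?thesis using assms(4,5)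
  proof (induction)
    case empty then show ?case by (simp add: g0)
  next
    case (insert a A)
    then show ?case using g by (simp add: Pi_def)
  qed
qed

lemma lin_hom_free_eq:
  assumes "module R N" "g \<in> lin_hom R (free_module R I) N" "x \<in> carrier (free_module R I)"
  shows "g x = free_extend R N (\<lambda>i. g (free_gen R i)) x"
proof -
  interpret N: module R N by fact
  interpret F: module R "free_module R I" by (rule free_module_module[OF N.R.is_cring])
  let ?F = "free_module R I"
  have sup: "finite {i. x i \<noteq> \<zero>\<^bsub>R\<^esub>}" "{i. x i \<noteq> \<zero>\<^bsub>R\<^esub>} \<subseteq> I" "\<And>i. x i \<in> carrier R"
    using assms(3) by (auto simp: free_module_def)
  have fg: "free_gen R i \<in> carrier ?F" if "i \<in> I" for i
    by (rule free_gen_in[OF N.R.is_cring that])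
  have eval: "(\<Oplus>\<^bsub>?F\<^esub>i\<in>A. x i \<odot>\<^bsub>?F\<^esub> free_gen R i) j = (if j \<in> A then x j else \<zero>\<^bsub>R\<^esub>)"
    if "finite A" "A \<subseteq> I" for A j using that
  proof (induction A)
    case empty show ?case by (subst F.M.finsum_empty) (simp add: free_module_def)
  next
    case (insert a A)
    have "(\<Oplus>\<^bsub>?F\<^esub>i\<in>insert a A. x i \<odot>\<^bsub>?F\<^esub> free_gen R i) =
      x a \<odot>\<^bsub>?F\<^esub> free_gen R a \<oplus>\<^bsub>?F\<^esub> (\<Oplus>\<^bsub>?F\<^esub>i\<in>A. x i \<odot>\<^bsub>?F\<^esub> free_gen R i)"
      by (rule F.M.add.finprod_insert)
        (use insert sup(3) fg in auto)
    moreover have "(u \<oplus>\<^bsub>?F\<^esub> v) j = u j \<oplus>\<^bsub>R\<^esub> v j" "(r \<odot>\<^bsub>?F\<^esub> u) j = r \<otimes>\<^bsub>R\<^esub> u j" for u v r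
      by (simp_all add: free_module_def)
    ultimately show ?case using insert sup(3)
      by (auto simp: free_gen_def)
  qed
  have "x = (\<Oplus>\<^bsub>?F\<^esub>i\<in>{i. x i \<noteq> \<zero>\<^bsub>R\<^esub>}. x i \<odot>\<^bsub>?F\<^esub> free_gen R i)"
    using eval[OF sup(1,2)] by auto
  then have "g x = g (\<Oplus>\<^bsub>?F\<^esub>i\<in>{i. x i \<noteq> \<zero>\<^bsub>R\<^esub>}. x i \<odot>\<^bsub>?F\<^esub> free_gen R i)" by simp
  also have "\<dots> = (\<Oplus>\<^bsub>N\<^esub>i\<in>{i. x i \<noteq> \<zero>\<^bsub>R\<^esub>}. g (x i \<odot>\<^bsub>?F\<^esub> free_gen R i))"
    by (rule lin_hom_finsum[OF F.module_axioms assms(1,2)])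
      (use sup fg in auto)
  also have "\<dots> = free_extend R N (\<lambda>i. g (free_gen R i)) x"
    unfolding free_extend_def
    by (rule N.M.add.finprod_cong')
      (use assms(2) sup fg in \<open>auto simp: lin_hom_def Pi_def subset_iff\<close>)
  finally show ?thesis .
qed

lemma lin_hom_comp:
  assumes "f \<in> lin_hom R M N" "g \<in> lin_hom R N L"
  shows "(\<lambda>x. g (f x)) \<in> lin_hom R M L"
  using assms by (auto simp: lin_hom_def Pi_def)

lemma projective_lift:
  fixes S :: "('s, 'r) ring_scheme" and P :: "('s, 'p, 'm) module_scheme"
    and N :: "('s, 'b, 'n) module_scheme" and N' :: "('s, 'c, 'l) module_scheme"
  assumes P: "projective S P" and N: "module S N" and N': "module S N'"
    and g: "g \<in> lin_hom S N N'" "g ` carrier N = carrier N'" and f: "f \<in> lin_hom S P N'"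
  shows "\<exists>h\<in>lin_hom S P N. \<forall>x\<in>carrier P. g (h x) = f x"
proof -
  interpret P: module S P using P by (simp add: projective_def)
  let ?F = "free_module S (carrier P)"
  let ?P = "\<lparr>carrier = carrier P, mult = mult P, one = one P, zero = zero P, add = add P,
     smult = smult P\<rparr>"
  have P'mod: "module S ?P"
  proof (rule moduleI[OF P.R.is_cring])
    show "abelian_group ?P"
    proof (rule abelian_groupI)
      fix x assume "x \<in> carrier ?P"
      then show "\<exists>y\<in>carrier ?P. y \<oplus>\<^bsub>?P\<^esub> x = \<zero>\<^bsub>?P\<^esub>"
        by (intro bexI[of _ "\<ominus>\<^bsub>P\<^esub> x"]) (auto simp: P.M.l_neg)
    qed (auto simp: P.M.a_ac)
  qed (auto simp: P.smult_l_distr P.smult_r_distr P.smult_assoc1)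
  have F: "module S ?F" by (rule free_module_module[OF P.R.is_cring])
  let ?\<pi> = "free_extend S ?P (\<lambda>x. x)"
  have pi: "?\<pi> \<in> lin_hom S ?F ?P" by (rule free_extend_linear[OF P'mod]) auto
  have pig: "?\<pi> (free_gen S x) = x" if "x \<in> carrier P" for x
    by (rule free_extend_gen[OF P'mod _ that]) auto
  have surj: "?\<pi> ` carrier ?F = carrier ?P"
  proof
    show "?\<pi> ` carrier ?F \<subseteq> carrier ?P" using pi by (auto simp: lin_hom_def)
    show "carrier ?P \<subseteq> ?\<pi> ` carrier ?F"
    proof
      fix x assume "x \<in> carrier ?P"
      then have x: "x \<in> carrier P" by simp
      show "x \<in> ?\<pi> ` carrier ?F"
        using pig[OF x, symmetric] free_gen_in[OF P.R.is_cring x] by (rule image_eqI)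
    qed
  qed
  have id: "(\<lambda>x. x) \<in> lin_hom S P ?P" by (auto simp: lin_hom_def)
  obtain i where i: "i \<in> lin_hom S P ?F" "\<And>x. x \<in> carrier P \<Longrightarrow> ?\<pi> (i x) = x"
  proof -
    have "\<exists>i\<in>lin_hom S P ?F. \<forall>x\<in>carrier P. ?\<pi> (i x) = x"
      using P[unfolded projective_def, THEN conjunct2, rule_format, OF F P'mod pi surj id] .
    then show ?thesis using that by blast
  qed
  have "\<exists>y\<in>carrier N. g y = f x" if "x \<in> carrier P" for x
  proof -
    have "f x \<in> carrier N'" using f that by (auto simp: lin_hom_def)
    then have "f x \<in> g ` carrier N" using g(2) by simp
    then show ?thesis by auto
  qed
  then obtain u where u: "\<And>x. x \<in> carrier P \<Longrightarrow> u x \<in> carrier N \<and> g (u x) = f x" by metis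
  let ?k = "free_extend S N u"
  have uPi: "u \<in> carrier P \<rightarrow> carrier N" using u by auto
  have k: "?k \<in> lin_hom S ?F N" by (rule free_extend_linear[OF N uPi])
  have f': "f \<in> lin_hom S ?P N'" using f by (auto simp: lin_hom_def)
  have gk: "(\<lambda>z. g (?k z)) \<in> lin_hom S ?F N'" by (rule lin_hom_comp[OF k g(1)])
  have fpi: "(\<lambda>z. f (?\<pi> z)) \<in> lin_hom S ?F N'" by (rule lin_hom_comp[OF pi f'])
  have eq: "g (?k z) = f (?\<pi> z)" if z: "z \<in> carrier ?F" for z
  proof -
    interpret N': module S N' by (rule N')
    have "g (?k z) = free_extend S N' (\<lambda>x. g (?k (free_gen S x))) z"
      by (rule lin_hom_free_eq[OF N' gk z])
    also have "\<dots> = free_extend S N' (\<lambda>x. f (?\<pi> (free_gen S x))) z"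
      unfolding free_extend_def[of S N']
    proof (rule N'.M.add.finprod_cong')
      have sup: "x \<in> carrier P" if "z x \<noteq> \<zero>\<^bsub>S\<^esub>" for x
        using z that by (auto simp: free_module_def)
      have zS: "z x \<in> carrier S" for x using z by (auto simp: free_module_def)
      show "(\<lambda>x. z x \<odot>\<^bsub>N'\<^esub> f (?\<pi> (free_gen S x))) \<in> {x. z x \<noteq> \<zero>\<^bsub>S\<^esub>} \<rightarrow> carrier N'"
        using sup zS f by (auto simp: pig lin_hom_def Pi_def)
      fix x assume "x \<in> {x. z x \<noteq> \<zero>\<^bsub>S\<^esub>}"
      then have x: "x \<in> carrier P" using sup by auto
      show "z x \<odot>\<^bsub>N'\<^esub> g (?k (free_gen S x)) = z x \<odot>\<^bsub>N'\<^esub> f (?\<pi> (free_gen S x))"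
        using u[OF x] by (simp add: free_extend_gen[OF N uPi x] pig[OF x])
    qed simp
    also have "\<dots> = f (?\<pi> z)" by (rule lin_hom_free_eq[OF N' fpi z, symmetric])
    finally show ?thesis .
  qed
  show ?thesis
  proof (intro bexI ballI)
    show "(\<lambda>x. ?k (i x)) \<in> lin_hom S P N" by (rule lin_hom_comp[OF i(1) k])
    fix x assume x: "x \<in> carrier P"
    then have "i x \<in> carrier ?F" using i(1) by (auto simp: lin_hom_def)
    then show "g (?k (i x)) = f x" using eq i(2)[OF x] by simp
  qed
qed


section \<open>Tensor products and base change are modules\<close>

lemma module_span_submodule:
  assumes "module R M" "A \<subseteq> carrier M"
  shows "submodule (module_span R M A) R M" "A \<subseteq> module_span R M A"
proof -
  interpret module R M by fact
  note E = submoduleE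
  have c: "submodule (carrier M) R M" by (rule carrier_is_submodule)
  show "submodule (module_span R M A) R M"
  proof (rule submoduleI)
    show "module_span R M A \<subseteq> carrier M" using c assms(2) by (auto simp: module_span_def)
    have "\<zero>\<^bsub>M\<^esub> \<in> H" if "submodule H R M" for H
      using subgroup.one_closed[OF submodule.axioms(1)[OF that]] by simp
    then show "\<zero>\<^bsub>M\<^esub> \<in> module_span R M A" by (auto simp: module_span_def)
  qed (auto simp: module_span_def E)
  show "A \<subseteq> module_span R M A" by (auto simp: module_span_def)
qed

lemma module_span_minimal: "submodule H R M \<Longrightarrow> A \<subseteq> H \<Longrightarrow> module_span R M A \<subseteq> H"
  by (auto simp: module_span_def)

locale module_quot = module +
  fixes H assumes H: "submodule H R M"
begin

lemma abelian_subgroup_H: "abelian_subgroup H M"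
  by (rule abelian_subgroupI3)
    (simp_all add: additive_subgroup_def submodule.axioms(1)[OF H] M.abelian_group_axioms)

sublocale H: abelian_subgroup H M by (rule abelian_subgroup_H)

lemma coset_eq_iff:
  assumes "x \<in> carrier M" "y \<in> carrier M"
  shows "H +>\<^bsub>M\<^esub> x = H +>\<^bsub>M\<^esub> y \<longleftrightarrow> x \<ominus>\<^bsub>M\<^esub> y \<in> H"
proof -
  have "H +>\<^bsub>M\<^esub> x = H +>\<^bsub>M\<^esub> y \<longleftrightarrow> x \<in> H +>\<^bsub>M\<^esub> y"
    using H.a_rcos_self[OF assms(1)] H.a_repr_independence'[of x y] assms by auto
  then show ?thesis using H.a_rcos_module[OF assms(2,1)] by (simp add: a_minus_def)
qed

lemma quot_smult:
  assumes "r \<in> carrier R" "x \<in> carrier M"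
  shows "r \<odot>\<^bsub>quot_module R M H\<^esub> (H +>\<^bsub>M\<^esub> x) = H +>\<^bsub>M\<^esub> (r \<odot>\<^bsub>M\<^esub> x)"
proof -
  have "H +>\<^bsub>M\<^esub> (r \<odot>\<^bsub>M\<^esub> y) = H +>\<^bsub>M\<^esub> (r \<odot>\<^bsub>M\<^esub> x)" if "y \<in> H +>\<^bsub>M\<^esub> x" for y
  proof -
    obtain h where h: "h \<in> H" "y = h \<oplus>\<^bsub>M\<^esub> x" using \<open>y \<in> _\<close> by (auto simp: a_r_coset_def')
    have hc: "h \<in> carrier M" using h(1) H.a_Hcarr by blast
    have rh: "r \<odot>\<^bsub>M\<^esub> h \<in> H" using submodule.smult_closed[OF H assms(1) h(1)] .
    have "r \<odot>\<^bsub>M\<^esub> y = r \<odot>\<^bsub>M\<^esub> h \<oplus>\<^bsub>M\<^esub> r \<odot>\<^bsub>M\<^esub> x"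
      using h hc assms by (simp add: smult_r_distr)
    then have "r \<odot>\<^bsub>M\<^esub> y \<in> H +>\<^bsub>M\<^esub> (r \<odot>\<^bsub>M\<^esub> x)"
      using rh by (auto simp: a_r_coset_def')
    then show ?thesis by (rule H.a_repr_independence'[symmetric]) (use assms in simp)
  qed
  moreover have "H +>\<^bsub>M\<^esub> x \<noteq> {}" using H.a_rcos_self[OF assms(2)] by blast
  ultimately show ?thesis unfolding quot_module_def module.simps by (intro SUP_eq_const)
qed

lemma quot_add:
  "x \<in> carrier M \<Longrightarrow> y \<in> carrier M \<Longrightarrow>
    (H +>\<^bsub>M\<^esub> x) \<oplus>\<^bsub>quot_module R M H\<^esub> (H +>\<^bsub>M\<^esub> y) = H +>\<^bsub>M\<^esub> (x \<oplus>\<^bsub>M\<^esub> y)"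
  by (simp add: quot_module_def H.a_rcos_sum)

lemma quot_carrier: "carrier (quot_module R M H) = (\<lambda>x. H +>\<^bsub>M\<^esub> x) ` carrier M"
  by (auto simp: quot_module_def A_RCOSETS_def')

lemma quot_zero: "\<zero>\<^bsub>quot_module R M H\<^esub> = H +>\<^bsub>M\<^esub> \<zero>\<^bsub>M\<^esub>"
  using H.a_rcos_const[OF H.zero_closed] by (simp add: quot_module_def)

lemma quot_module_module: "module R (quot_module R M H)"
proof (rule moduleI[OF R.is_cring])
  show "abelian_group (quot_module R M H)"
  proof (rule abelian_groupI)
    fix C assume "C \<in> carrier (quot_module R M H)"
    then obtain x where x: "x \<in> carrier M" "C = H +>\<^bsub>M\<^esub> x" by (auto simp: quot_carrier)
    then show "\<exists>D\<in>carrier (quot_module R M H).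
        D \<oplus>\<^bsub>quot_module R M H\<^esub> C = \<zero>\<^bsub>quot_module R M H\<^esub>"
      by (intro bexI[of _ "H +>\<^bsub>M\<^esub> (\<ominus>\<^bsub>M\<^esub> x)"]) (auto simp: quot_carrier quot_add quot_zero M.l_neg)
  qed (auto simp: quot_carrier quot_add quot_zero M.a_ac)
qed (auto simp: quot_carrier quot_smult quot_add smult_l_distr smult_r_distr smult_assoc1)

end

lemma tensor_rels_carrier:
  assumes "module R M" "module R N"
  shows "tensor_rels R M N \<subseteq> carrier (free_module R (carrier M \<times> carrier N))"
proof -
  interpret M: module R M by fact
  interpret N: module R N by fact
  interpret F: module R "free_module R (carrier M \<times> carrier N)"
    by (rule free_module_module[OF M.R.is_cring])
  have g: "free_gen R (x, y) \<in> carrier (free_module R (carrier M \<times> carrier N))"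
    if "x \<in> carrier M" "y \<in> carrier N" for x y
    by (rule free_gen_in[OF M.R.is_cring]) (use that in auto)
  show ?thesis
    by (auto simp: tensor_rels_def Let_def intro!: F.M.minus_closed F.M.add.m_closed F.smult_closed g)
qed

lemma tensor_module_quot:
  assumes "module R M" "module R N"
  shows "module_quot R (free_module R (carrier M \<times> carrier N)) (tensor_ker R M N)"
proof -
  have "cring R" using assms(1) by (simp add: module_def)
  then have F: "module R (free_module R (carrier M \<times> carrier N))" by (rule free_module_module)
  then show ?thesis unfolding tensor_ker_def module_quot_def module_quot_axioms_def
    using module_span_submodule(1)[OF F tensor_rels_carrier[OF assms]] by blast
qed

lemma tensor_module:
  assumes "module R M" "module R N" shows "module R (tensor R M N)"
  unfolding tensor_def by (rule module_quot.quot_module_module[OF tensor_module_quot[OF assms]])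

lemma tensor_elem_bilinear:
  assumes "module R M" "module R N"
  shows "x \<in> carrier M \<Longrightarrow> y \<in> carrier N \<Longrightarrow> tensor_elem R M N x y \<in> carrier (tensor R M N)"
    and "x \<in> carrier M \<Longrightarrow> x' \<in> carrier M \<Longrightarrow> y \<in> carrier N \<Longrightarrow>
      tensor_elem R M N (x \<oplus>\<^bsub>M\<^esub> x') y = tensor_elem R M N x y \<oplus>\<^bsub>tensor R M N\<^esub> tensor_elem R M N x' y"
    and "x \<in> carrier M \<Longrightarrow> y \<in> carrier N \<Longrightarrow> y' \<in> carrier N \<Longrightarrow>
      tensor_elem R M N x (y \<oplus>\<^bsub>N\<^esub> y') = tensor_elem R M N x y \<oplus>\<^bsub>tensor R M N\<^esub> tensor_elem R M N x y'"
    and "r \<in> carrier R \<Longrightarrow> x \<in> carrier M \<Longrightarrow> y \<in> carrier N \<Longrightarrow>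
      tensor_elem R M N (r \<odot>\<^bsub>M\<^esub> x) y = r \<odot>\<^bsub>tensor R M N\<^esub> tensor_elem R M N x y"
    and "r \<in> carrier R \<Longrightarrow> x \<in> carrier M \<Longrightarrow> y \<in> carrier N \<Longrightarrow>
      tensor_elem R M N x (r \<odot>\<^bsub>N\<^esub> y) = r \<odot>\<^bsub>tensor R M N\<^esub> tensor_elem R M N x y"
proof -
  interpret M: module R M by fact
  interpret N: module R N by fact
  let ?F = "free_module R (carrier M \<times> carrier N)"
  interpret Q: module_quot R ?F "tensor_ker R M N" by (rule tensor_module_quot[OF assms])
  have g: "free_gen R (x, y) \<in> carrier ?F"
    if "x \<in> carrier M" "y \<in> carrier N" for x y
    by (rule free_gen_in[OF M.R.is_cring]) (use that in auto)
  have rel: "tensor_rels R M N \<subseteq> tensor_ker R M N" unfolding tensor_ker_def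
    by (rule module_span_submodule(2)[OF Q.module_axioms tensor_rels_carrier[OF assms]])
  { assume "x \<in> carrier M" "y \<in> carrier N"
    then show "tensor_elem R M N x y \<in> carrier (tensor R M N)"
      using g by (auto simp: tensor_elem_def tensor_def Q.quot_carrier) }
  { assume a: "x \<in> carrier M" "x' \<in> carrier M" "y \<in> carrier N"
    have "free_gen R (x \<oplus>\<^bsub>M\<^esub> x', y) \<ominus>\<^bsub>?F\<^esub> (free_gen R (x, y) \<oplus>\<^bsub>?F\<^esub> free_gen R (x', y)) \<in> tensor_ker R M N"
      using a by (intro subsetD[OF rel]) (auto simp: tensor_rels_def Let_def)
    then show "tensor_elem R M N (x \<oplus>\<^bsub>M\<^esub> x') y = tensor_elem R M N x y \<oplus>\<^bsub>tensor R M N\<^esub> tensor_elem R M N x' y"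
      using a g unfolding tensor_elem_def tensor_def by (simp add: Q.quot_add Q.coset_eq_iff) }
  { assume a: "x \<in> carrier M" "y \<in> carrier N" "y' \<in> carrier N"
    have "free_gen R (x, y \<oplus>\<^bsub>N\<^esub> y') \<ominus>\<^bsub>?F\<^esub> (free_gen R (x, y) \<oplus>\<^bsub>?F\<^esub> free_gen R (x, y')) \<in> tensor_ker R M N"
      using a by (intro subsetD[OF rel]) (auto simp: tensor_rels_def Let_def)
    then show "tensor_elem R M N x (y \<oplus>\<^bsub>N\<^esub> y') = tensor_elem R M N x y \<oplus>\<^bsub>tensor R M N\<^esub> tensor_elem R M N x y'"
      using a g unfolding tensor_elem_def tensor_def by (simp add: Q.quot_add Q.coset_eq_iff) }
  { assume a: "r \<in> carrier R" "x \<in> carrier M" "y \<in> carrier N"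
    have "free_gen R (r \<odot>\<^bsub>M\<^esub> x, y) \<ominus>\<^bsub>?F\<^esub> r \<odot>\<^bsub>?F\<^esub> free_gen R (x, y) \<in> tensor_ker R M N"
      using a by (intro subsetD[OF rel]) (auto simp: tensor_rels_def Let_def)
    then show "tensor_elem R M N (r \<odot>\<^bsub>M\<^esub> x) y = r \<odot>\<^bsub>tensor R M N\<^esub> tensor_elem R M N x y"
      using a g unfolding tensor_elem_def tensor_def by (simp add: Q.quot_smult Q.coset_eq_iff)
    have "free_gen R (x, r \<odot>\<^bsub>N\<^esub> y) \<ominus>\<^bsub>?F\<^esub> r \<odot>\<^bsub>?F\<^esub> free_gen R (x, y) \<in> tensor_ker R M N"
      using a by (intro subsetD[OF rel]) (auto simp: tensor_rels_def Let_def)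
    then show "tensor_elem R M N x (r \<odot>\<^bsub>N\<^esub> y) = r \<odot>\<^bsub>tensor R M N\<^esub> tensor_elem R M N x y"
      using a g unfolding tensor_elem_def tensor_def by (simp add: Q.quot_smult Q.coset_eq_iff) }
qed

lemma kernel_submodule:
  assumes "module R M" "module R N" "h \<in> lin_hom R M N"
  shows "submodule {x \<in> carrier M. h x = \<zero>\<^bsub>N\<^esub>} R M"
proof -
  interpret M: module R M by fact
  interpret N: module R N by fact
  have h: "\<And>x. x \<in> carrier M \<Longrightarrow> h x \<in> carrier N"
    "\<And>x y. x \<in> carrier M \<Longrightarrow> y \<in> carrier M \<Longrightarrow> h (x \<oplus>\<^bsub>M\<^esub> y) = h x \<oplus>\<^bsub>N\<^esub> h y"
    "\<And>r x. r \<in> carrier R \<Longrightarrow> x \<in> carrier M \<Longrightarrow> h (r \<odot>\<^bsub>M\<^esub> x) = r \<odot>\<^bsub>N\<^esub> h x"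
    using assms(3) by (auto simp: lin_hom_def)
  have h0: "h \<zero>\<^bsub>M\<^esub> = \<zero>\<^bsub>N\<^esub>"
    using h(3)[of "\<zero>\<^bsub>R\<^esub>" "\<zero>\<^bsub>M\<^esub>"] h(1) by simp
  have "h (\<ominus>\<^bsub>M\<^esub> x) = \<zero>\<^bsub>N\<^esub>" if "x \<in> carrier M" "h x = \<zero>\<^bsub>N\<^esub>" for x
    using h(2)[of "\<ominus>\<^bsub>M\<^esub> x" x] h(1)[of "\<ominus>\<^bsub>M\<^esub> x"] h0 that by (simp add: M.M.l_neg)
  then show ?thesis by (intro M.submoduleI) (auto simp: h h0)
qed

lemma lin_hom_minus:
  assumes "module R M" "module R N" "h \<in> lin_hom R M N" "x \<in> carrier M" "y \<in> carrier M"
  shows "h (x \<ominus>\<^bsub>M\<^esub> y) = h x \<ominus>\<^bsub>N\<^esub> h y"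
proof -
  interpret M: module R M by fact
  interpret N: module R N by fact
  have h: "\<And>x. x \<in> carrier M \<Longrightarrow> h x \<in> carrier N"
    "\<And>x y. x \<in> carrier M \<Longrightarrow> y \<in> carrier M \<Longrightarrow> h (x \<oplus>\<^bsub>M\<^esub> y) = h x \<oplus>\<^bsub>N\<^esub> h y"
    using assms(3) by (auto simp: lin_hom_def)
  have "h x = h ((x \<ominus>\<^bsub>M\<^esub> y) \<oplus>\<^bsub>M\<^esub> y)" using assms by (simp add: a_minus_def M.M.a_assoc M.M.l_neg)
  also have "\<dots> = h (x \<ominus>\<^bsub>M\<^esub> y) \<oplus>\<^bsub>N\<^esub> h y" using assms by (intro h) auto
  finally have e: "h x = h (x \<ominus>\<^bsub>M\<^esub> y) \<oplus>\<^bsub>N\<^esub> h y" .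
  obtain d where d: "h (x \<ominus>\<^bsub>M\<^esub> y) = d" "d \<in> carrier N" using assms h(1) by auto
  show ?thesis unfolding e d(1)
    using d(2) h(1)[OF assms(5)] by (simp add: a_minus_def N.M.a_assoc N.M.r_neg)
qed

text \<open>The universal property of the tensor product.\<close>

lemma tensor_lift:
  assumes M: "module R M" and N: "module R N" and L: "module R L"
    and b: "\<And>x y. x \<in> carrier M \<Longrightarrow> y \<in> carrier N \<Longrightarrow> b x y \<in> carrier L"
      "\<And>x x' y. x \<in> carrier M \<Longrightarrow> x' \<in> carrier M \<Longrightarrow> y \<in> carrier N \<Longrightarrow>
        b (x \<oplus>\<^bsub>M\<^esub> x') y = b x y \<oplus>\<^bsub>L\<^esub> b x' y"
      "\<And>x y y'. x \<in> carrier M \<Longrightarrow> y \<in> carrier N \<Longrightarrow> y' \<in> carrier N \<Longrightarrow>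
        b x (y \<oplus>\<^bsub>N\<^esub> y') = b x y \<oplus>\<^bsub>L\<^esub> b x y'"
      "\<And>r x y. r \<in> carrier R \<Longrightarrow> x \<in> carrier M \<Longrightarrow> y \<in> carrier N \<Longrightarrow> b (r \<odot>\<^bsub>M\<^esub> x) y = r \<odot>\<^bsub>L\<^esub> b x y"
      "\<And>r x y. r \<in> carrier R \<Longrightarrow> x \<in> carrier M \<Longrightarrow> y \<in> carrier N \<Longrightarrow> b x (r \<odot>\<^bsub>N\<^esub> y) = r \<odot>\<^bsub>L\<^esub> b x y"
    and z: "z \<in> tensor_ker R M N"
  shows "free_extend R L (case_prod b) z = \<zero>\<^bsub>L\<^esub>"
proof -
  interpret M: module R M by fact
  interpret N: module R N by fact
  interpret L: module R L by fact
  let ?F = "free_module R (carrier M \<times> carrier N)"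
  let ?h = "free_extend R L (case_prod b)"
  have F: "module R ?F" by (rule free_module_module[OF M.R.is_cring])
  interpret F: module R ?F by fact
  have bPi: "case_prod b \<in> carrier M \<times> carrier N \<rightarrow> carrier L" using b(1) by auto
  have h: "?h \<in> lin_hom R ?F L" by (rule free_extend_linear[OF L bPi])
  have g: "free_gen R (x, y) \<in> carrier ?F" if "x \<in> carrier M" "y \<in> carrier N" for x y
    by (rule free_gen_in[OF M.R.is_cring]) (use that in auto)
  have hg: "?h (free_gen R (x, y)) = b x y" if "x \<in> carrier M" "y \<in> carrier N" for x y
    using free_extend_gen[OF L bPi, of "(x, y)"] that by simp
  have hadd: "?h (u \<oplus>\<^bsub>?F\<^esub> v) = ?h u \<oplus>\<^bsub>L\<^esub> ?h v" if "u \<in> carrier ?F" "v \<in> carrier ?F" for u v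
    using h that unfolding lin_hom_def by blast
  have hsm: "?h (r \<odot>\<^bsub>?F\<^esub> u) = r \<odot>\<^bsub>L\<^esub> ?h u" if "r \<in> carrier R" "u \<in> carrier ?F" for u r
    using h that unfolding lin_hom_def by blast
  have self: "u \<ominus>\<^bsub>L\<^esub> u = \<zero>\<^bsub>L\<^esub>" if "u \<in> carrier L" for u
    using that by (simp add: a_minus_def L.M.r_neg)
  have "?h w = \<zero>\<^bsub>L\<^esub>" if "w \<in> tensor_rels R M N" for w
    using that unfolding tensor_rels_def Let_def
    by (elim UnE CollectE exE conjE)
      (simp_all add: lin_hom_minus[OF F L h] g hg hadd hsm b self)
  then have "tensor_rels R M N \<subseteq> {w \<in> carrier ?F. ?h w = \<zero>\<^bsub>L\<^esub>}"
    using tensor_rels_carrier[OF M N] by blast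
  then have "tensor_ker R M N \<subseteq> {w \<in> carrier ?F. ?h w = \<zero>\<^bsub>L\<^esub>}"
    unfolding tensor_ker_def by (rule module_span_minimal[OF kernel_submodule[OF F L h]])
  then show ?thesis using z by blast
qed

lemma tensor_map_linear:
  assumes M: "module R M" and N: "module R N" and M': "module R M'" and N': "module R N'"
    and f: "f \<in> lin_hom R M M'" and g: "g \<in> lin_hom R N N'"
  shows "tensor_map R M' N' f g \<in> lin_hom R (tensor R M N) (tensor R M' N')"
    and "\<And>x y. x \<in> carrier M \<Longrightarrow> y \<in> carrier N \<Longrightarrow>
      tensor_map R M' N' f g (tensor_elem R M N x y) = tensor_elem R M' N' (f x) (g y)"
proof -
  let ?F = "free_module R (carrier M \<times> carrier N)"
  let ?F' = "free_module R (carrier M' \<times> carrier N')"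
  let ?K = "tensor_ker R M N" and ?K' = "tensor_ker R M' N'"
  interpret M: module R M by fact
  interpret Q: module_quot R ?F ?K by (rule tensor_module_quot[OF M N])
  interpret Q': module_quot R ?F' ?K' by (rule tensor_module_quot[OF M' N'])
  define e where "e = (\<lambda>(x, y). free_gen R (f x, g y))"
  have fc: "f x \<in> carrier M'" if "x \<in> carrier M" for x using f that by (auto simp: lin_hom_def)
  have gc: "g x \<in> carrier N'" if "x \<in> carrier N" for x using g that by (auto simp: lin_hom_def)
  have gen': "free_gen R (x, y) \<in> carrier ?F'" if "x \<in> carrier M'" "y \<in> carrier N'" for x y
    by (rule free_gen_in[OF M.R.is_cring]) (use that in auto)
  have e: "e \<in> carrier M \<times> carrier N \<rightarrow> carrier ?F'" using fc gc gen' by (auto simp: e_def)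
  let ?h = "free_extend R ?F' e"
  have h: "?h \<in> lin_hom R ?F ?F'" by (rule free_extend_linear[OF Q'.module_axioms e])
  have hc: "?h z \<in> carrier ?F'" if "z \<in> carrier ?F" for z using h that unfolding lin_hom_def by blast
  have hadd: "?h (u \<oplus>\<^bsub>?F\<^esub> v) = ?h u \<oplus>\<^bsub>?F'\<^esub> ?h v" if "u \<in> carrier ?F" "v \<in> carrier ?F" for u v
    using h that unfolding lin_hom_def by blast
  have hsm: "?h (r \<odot>\<^bsub>?F\<^esub> u) = r \<odot>\<^bsub>?F'\<^esub> ?h u" if "r \<in> carrier R" "u \<in> carrier ?F" for u r
    using h that unfolding lin_hom_def by blast
  let ?T' = "tensor R M' N'"
  have T': "module R ?T'" by (rule tensor_module[OF M' N'])
  interpret T': module R ?T' by fact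
  let ?q = "\<lambda>z. ?K' +>\<^bsub>?F'\<^esub> z"
  have q: "?q \<in> lin_hom R ?F' ?T'"
    unfolding lin_hom_def tensor_def
    by (auto simp: Q'.quot_carrier Q'.quot_add Q'.quot_smult)
  note bil = tensor_elem_bilinear[OF M' N']
  note qh = lin_hom_comp[OF h q]
  have ker: "?q (?h k) = ?K' +>\<^bsub>?F'\<^esub> \<zero>\<^bsub>?F'\<^esub>" if k: "k \<in> ?K" for k
  proof -
    have kc: "k \<in> carrier ?F" using k Q.H.a_Hcarr by blast
    have "free_extend R ?T' (\<lambda>(x, y). tensor_elem R M' N' (f x) (g y)) k = \<zero>\<^bsub>?T'\<^esub>"
      by (rule tensor_lift[OF M N T' _ _ _ _ _ k])
        (use f g in \<open>auto simp: lin_hom_def Pi_def bil\<close>)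
    moreover have "?q (?h k) = free_extend R ?T' (\<lambda>i. ?q (?h (free_gen R i))) k"
      by (rule lin_hom_free_eq[OF T' qh kc])
    moreover have "\<dots> = free_extend R ?T' (\<lambda>(x, y). tensor_elem R M' N' (f x) (g y)) k"
      unfolding free_extend_def[of R ?T']
    proof (rule T'.M.add.finprod_cong')
      have sup: "i \<in> carrier M \<times> carrier N" if "k i \<noteq> \<zero>\<^bsub>R\<^esub>" for i
        by (rule free_module_supp[OF kc that])
      have kR: "k i \<in> carrier R" for i by (rule free_module_coeff[OF kc])
      have te: "tensor_elem R M' N' (f x) (g y) \<in> carrier ?T'" if "x \<in> carrier M" "y \<in> carrier N" for x y
        by (rule bil(1)) (use fc gc that in auto)
      show "(\<lambda>i. k i \<odot>\<^bsub>?T'\<^esub> (case i of (x, y) \<Rightarrow> tensor_elem R M' N' (f x) (g y)))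
          \<in> {i. k i \<noteq> \<zero>\<^bsub>R\<^esub>} \<rightarrow> carrier ?T'"
      proof (rule Pi_I)
        fix i assume "i \<in> {i. k i \<noteq> \<zero>\<^bsub>R\<^esub>}"
        then obtain x y where "i = (x, y)" "x \<in> carrier M" "y \<in> carrier N" using sup by blast
        then show "k i \<odot>\<^bsub>?T'\<^esub> (case i of (x, y) \<Rightarrow> tensor_elem R M' N' (f x) (g y)) \<in> carrier ?T'"
          using te kR by simp
      qed
      fix i assume "i \<in> {i. k i \<noteq> \<zero>\<^bsub>R\<^esub>}"
      then have i: "i \<in> carrier M \<times> carrier N" using sup by blast
      have "?h (free_gen R i) = e i" by (rule free_extend_gen[OF Q'.module_axioms e i])
      then show "k i \<odot>\<^bsub>?T'\<^esub> ?q (?h (free_gen R i)) =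
          k i \<odot>\<^bsub>?T'\<^esub> (case i of (x, y) \<Rightarrow> tensor_elem R M' N' (f x) (g y))"
        by (cases i) (simp add: e_def tensor_elem_def)
    qed simp
    ultimately show ?thesis by (simp add: tensor_def Q'.quot_zero)
  qed
  have val: "tensor_map R M' N' f g (?K +>\<^bsub>?F\<^esub> z) = ?q (?h z)" if z: "z \<in> carrier ?F" for z
  proof -
    have "?q (?h w) = ?q (?h z)" if "w \<in> ?K +>\<^bsub>?F\<^esub> z" for w
    proof -
      obtain k where k: "k \<in> ?K" "w = k \<oplus>\<^bsub>?F\<^esub> z" using \<open>w \<in> _\<close> by (auto simp: a_r_coset_def')
      have kc: "k \<in> carrier ?F" using k(1) Q.H.a_Hcarr by blast
      have "?q (?h k) = ?K'"
        unfolding ker[OF k(1)] by (rule Q'.H.a_rcos_const[OF Q'.H.zero_closed])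
      then have "?h k \<in> ?K'" using Q'.H.a_rcos_self[OF hc[OF kc]] by simp
      then have "?h w \<in> ?K' +>\<^bsub>?F'\<^esub> ?h z"
        using k kc z by (auto simp: hadd a_r_coset_def')
      then show ?thesis by (rule Q'.H.a_repr_independence'[symmetric]) (rule hc[OF z])
    qed
    moreover have "?K +>\<^bsub>?F\<^esub> z \<noteq> {}" using Q.H.a_rcos_self[OF z] by blast
    ultimately show ?thesis unfolding tensor_map_def Let_def e_def[symmetric] by (intro SUP_eq_const)
  qed
  show "tensor_map R M' N' f g \<in> lin_hom R (tensor R M N) ?T'"
    unfolding lin_hom_def tensor_def
    by (auto simp: Q.quot_carrier Q'.quot_carrier Q.quot_add Q.quot_smult val hc
        hadd hsm Q'.quot_add Q'.quot_smult)
  fix x y assume xy: "x \<in> carrier M" "y \<in> carrier N"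
  have "free_gen R (x, y) \<in> carrier ?F"
    by (rule free_gen_in[OF M.R.is_cring]) (use xy in auto)
  then show "tensor_map R M' N' f g (tensor_elem R M N x y) = tensor_elem R M' N' (f x) (g y)"
    unfolding tensor_elem_def
    using val free_extend_gen[OF Q'.module_axioms e, of "(x, y)"] xy by (simp add: e_def)
qed

lemma tensor_hom_eqI:
  assumes M: "module R M" and N: "module R N" and L: "module R L"
    and h: "h \<in> lin_hom R (tensor R M N) L" and k: "k \<in> lin_hom R (tensor R M N) L"
    and eq: "\<And>x y. x \<in> carrier M \<Longrightarrow> y \<in> carrier N \<Longrightarrow>
      h (tensor_elem R M N x y) = k (tensor_elem R M N x y)"
    and C: "C \<in> carrier (tensor R M N)"
  shows "h C = k C"
proof -
  let ?F = "free_module R (carrier M \<times> carrier N)"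
  interpret L: module R L by fact
  interpret Q: module_quot R ?F "tensor_ker R M N" by (rule tensor_module_quot[OF M N])
  let ?q = "\<lambda>z. tensor_ker R M N +>\<^bsub>?F\<^esub> z"
  have q: "?q \<in> lin_hom R ?F (tensor R M N)"
    unfolding lin_hom_def tensor_def
    by (auto simp: Q.quot_carrier Q.quot_add Q.quot_smult)
  obtain z where z: "z \<in> carrier ?F" "C = ?q z"
    using C by (auto simp: tensor_def Q.quot_carrier)
  have "h (?q z) = free_extend R L (\<lambda>i. h (?q (free_gen R i))) z"
    by (rule lin_hom_free_eq[OF L lin_hom_comp[OF q h] z(1)])
  also have "\<dots> = free_extend R L (\<lambda>i. k (?q (free_gen R i))) z"
    unfolding free_extend_def
  proof (rule L.M.add.finprod_cong')
    have sup: "i \<in> carrier M \<times> carrier N" if "z i \<noteq> \<zero>\<^bsub>R\<^esub>" for i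
      by (rule free_module_supp[OF z(1) that])
    have zR: "z i \<in> carrier R" for i by (rule free_module_coeff[OF z(1)])
    have kq: "k (?q (free_gen R i)) \<in> carrier L" if "i \<in> carrier M \<times> carrier N" for i
      using lin_hom_comp[OF q k] free_gen_in[OF L.R.is_cring that] unfolding lin_hom_def by blast
    show "(\<lambda>i. z i \<odot>\<^bsub>L\<^esub> k (?q (free_gen R i))) \<in> {i. z i \<noteq> \<zero>\<^bsub>R\<^esub>} \<rightarrow> carrier L"
      using sup zR kq by (auto simp del: mem_Sigma_iff)
    fix i assume "i \<in> {i. z i \<noteq> \<zero>\<^bsub>R\<^esub>}"
    then obtain x y where "i = (x, y)" "x \<in> carrier M" "y \<in> carrier N" using sup by blast
    then show "z i \<odot>\<^bsub>L\<^esub> h (?q (free_gen R i)) = z i \<odot>\<^bsub>L\<^esub> k (?q (free_gen R i))"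
      using eq[unfolded tensor_elem_def] by simp
  qed simp
  also have "\<dots> = k (?q z)"
    by (rule lin_hom_free_eq[OF L lin_hom_comp[OF q k] z(1), symmetric])
  finally show ?thesis using z(2) by simp
qed

lemma algebra_module_module:
  assumes "cring R" "cring S" "\<phi> \<in> ring_hom R S" shows "module R (algebra_module S \<phi>)"
proof -
  interpret S: cring S by fact
  interpret \<phi>: ring_hom_cring R S \<phi>
    using assms by (simp add: ring_hom_cring_def ring_hom_cring_axioms_def)
  show ?thesis
  proof (rule moduleI[OF assms(1)])
    show "abelian_group (algebra_module S \<phi>)"
    proof (rule abelian_groupI)
      fix x assume "x \<in> carrier (algebra_module S \<phi>)"
      then show "\<exists>y\<in>carrier (algebra_module S \<phi>). y \<oplus>\<^bsub>algebra_module S \<phi>\<^esub> x = \<zero>\<^bsub>algebra_module S \<phi>\<^esub>"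
        by (intro bexI[of _ "\<ominus>\<^bsub>S\<^esub> x"]) (auto simp: algebra_module_def S.l_neg)
    qed (auto simp: algebra_module_def S.a_ac)
  qed (auto simp: algebra_module_def S.l_distr S.r_distr S.m_assoc)
qed

lemma base_change_module:
  assumes R: "cring R" and S: "cring S" and \<phi>: "\<phi> \<in> ring_hom R S" and M: "module R M"
  shows "module S (base_change R S \<phi> M)"
proof -
  interpret S: cring S by fact
  interpret \<phi>: ring_hom_cring R S \<phi>
    using assms by (simp add: ring_hom_cring_def ring_hom_cring_axioms_def)
  let ?A = "algebra_module S \<phi>"
  let ?T = "tensor R M ?A"
  have A: "module R ?A" by (rule algebra_module_module[OF R S \<phi>])
  have T: "module R ?T" by (rule tensor_module[OF M A])
  interpret T: module R ?T by fact
  note bil = tensor_elem_bilinear[OF M A]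
  have id: "(\<lambda>x. x) \<in> lin_hom R M M" by (auto simp: lin_hom_def)
  have mu: "(\<lambda>t. s \<otimes>\<^bsub>S\<^esub> t) \<in> lin_hom R ?A ?A" if "s \<in> carrier S" for s
    using that by (auto simp: lin_hom_def algebra_module_def S.r_distr S.m_lcomm)
  let ?m = "\<lambda>s. tensor_map R M ?A (\<lambda>x. x) (\<lambda>t. s \<otimes>\<^bsub>S\<^esub> t)"
  have m: "?m s \<in> lin_hom R ?T ?T" if "s \<in> carrier S" for s
    by (rule tensor_map_linear(1)[OF M A M A id mu[OF that]])
  have ms: "?m s (tensor_elem R M ?A x t) = tensor_elem R M ?A x (s \<otimes>\<^bsub>S\<^esub> t)"
    if "s \<in> carrier S" "x \<in> carrier M" "t \<in> carrier S" for s x t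
    using tensor_map_linear(2)[OF M A M A id mu[OF that(1)] that(2), of t] that(3)
    by (simp add: algebra_module_def)
  have cA: "carrier ?A = carrier S" "add ?A = add S" by (simp_all add: algebra_module_def)
  have mc: "?m s C \<in> carrier ?T" if "s \<in> carrier S" "C \<in> carrier ?T" for s C
    using m[OF that(1)] that(2) by (auto simp: lin_hom_def)
  have madd: "?m s (C \<oplus>\<^bsub>?T\<^esub> D) = ?m s C \<oplus>\<^bsub>?T\<^esub> ?m s D"
    if "s \<in> carrier S" "C \<in> carrier ?T" "D \<in> carrier ?T" for s C D
    using m[OF that(1)] that(2,3) by (auto simp: lin_hom_def)
  have msm: "?m s (r \<odot>\<^bsub>?T\<^esub> C) = r \<odot>\<^bsub>?T\<^esub> ?m s C"
    if "s \<in> carrier S" "r \<in> carrier R" "C \<in> carrier ?T" for s r C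
    using m[OF that(1)] that(2,3) by (auto simp: lin_hom_def)
  have distr: "?m (s \<oplus>\<^bsub>S\<^esub> t) C = ?m s C \<oplus>\<^bsub>?T\<^esub> ?m t C"
    if "s \<in> carrier S" "t \<in> carrier S" "C \<in> carrier ?T" for s t C
  proof (rule tensor_hom_eqI[OF M A T m _ _ that(3)])
    show "s \<oplus>\<^bsub>S\<^esub> t \<in> carrier S" using that by simp
    show "(\<lambda>C. ?m s C \<oplus>\<^bsub>?T\<^esub> ?m t C) \<in> lin_hom R ?T ?T"
      unfolding lin_hom_def using that
      by (simp add: mc madd msm T.smult_r_distr T.M.a_ac)
    fix x y assume "x \<in> carrier M" "y \<in> carrier ?A"
    then show "?m (s \<oplus>\<^bsub>S\<^esub> t) (tensor_elem R M ?A x y)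
        = ?m s (tensor_elem R M ?A x y) \<oplus>\<^bsub>?T\<^esub> ?m t (tensor_elem R M ?A x y)"
      using that bil(3)[of x "s \<otimes>\<^bsub>S\<^esub> y" "t \<otimes>\<^bsub>S\<^esub> y"] by (simp add: cA ms S.l_distr)
  qed
  have assoc: "?m (s \<otimes>\<^bsub>S\<^esub> t) C = ?m s (?m t C)"
    if "s \<in> carrier S" "t \<in> carrier S" "C \<in> carrier ?T" for s t C
  proof (rule tensor_hom_eqI[OF M A T m _ _ that(3)])
    show "s \<otimes>\<^bsub>S\<^esub> t \<in> carrier S" using that by simp
    show "(\<lambda>C. ?m s (?m t C)) \<in> lin_hom R ?T ?T"
      using lin_hom_comp[OF m[OF that(2)] m[OF that(1)]] .
    fix x y assume "x \<in> carrier M" "y \<in> carrier ?A"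
    then show "?m (s \<otimes>\<^bsub>S\<^esub> t) (tensor_elem R M ?A x y) = ?m s (?m t (tensor_elem R M ?A x y))"
      using that by (simp add: cA ms S.m_assoc)
  qed
  have one: "?m \<one>\<^bsub>S\<^esub> C = C" if "C \<in> carrier ?T" for C
  proof (rule tensor_hom_eqI[OF M A T m _ _ that])
    show "(\<lambda>C. C) \<in> lin_hom R ?T ?T" by (auto simp: lin_hom_def)
    fix x y assume "x \<in> carrier M" "y \<in> carrier ?A"
    then show "?m \<one>\<^bsub>S\<^esub> (tensor_elem R M ?A x y) = tensor_elem R M ?A x y" by (simp add: cA ms)
  qed simp
  show ?thesis
  proof (rule moduleI[OF S])
    show "abelian_group (base_change R S \<phi> M)"
    proof (rule abelian_groupI)
      fix C assume "C \<in> carrier (base_change R S \<phi> M)"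
      then show "\<exists>D\<in>carrier (base_change R S \<phi> M). D \<oplus>\<^bsub>base_change R S \<phi> M\<^esub> C = \<zero>\<^bsub>base_change R S \<phi> M\<^esub>"
        by (intro bexI[of _ "\<ominus>\<^bsub>?T\<^esub> C"]) (auto simp: base_change_def Let_def T.M.l_neg)
    qed (auto simp: base_change_def Let_def T.M.a_ac)
  qed (auto simp: base_change_def Let_def mc madd distr assoc one)
qed


section \<open>Residue fields are fields, and their products are algebras\<close>

lemma product_ring_cring:
  assumes "\<And>i. i \<in> I \<Longrightarrow> cring (K i)"
  shows "cring (product_ring I K)"
proof (rule cringI)
  have ab: "abelian_group (K i)" if "i \<in> I" for i
    using assms[OF that] by (simp add: cring_def ring_def)
  note K = cring.axioms(1)[OF assms]
  show "abelian_group (product_ring I K)"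
  proof (rule abelian_groupI)
    fix x assume x: "x \<in> carrier (product_ring I K)"
    let ?y = "\<lambda>i\<in>I. \<ominus>\<^bsub>K i\<^esub> x i"
    have "?y \<in> carrier (product_ring I K)" using x
      by (auto simp: product_ring_def intro!: abelian_group.a_inv_closed[OF ab])
    moreover have "?y \<oplus>\<^bsub>product_ring I K\<^esub> x = \<zero>\<^bsub>product_ring I K\<^esub>"
      using x by (auto simp: product_ring_def intro!: restrict_ext abelian_group.l_neg[OF ab])
    ultimately show "\<exists>y\<in>carrier (product_ring I K).
        y \<oplus>\<^bsub>product_ring I K\<^esub> x = \<zero>\<^bsub>product_ring I K\<^esub>" by blast
  qed (auto simp: product_ring_def PiE_iff extensional_def fun_eq_iff
      ring.ring_simprules[OF K] restrict_def)
  show "comm_monoid (product_ring I K)"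
    by (rule comm_monoidI) (auto simp: product_ring_def PiE_iff extensional_def fun_eq_iff
        cring.cring_simprules[OF assms] monoid.r_one[OF ring.axioms(2)[OF K]] restrict_def)
qed (auto simp: product_ring_def PiE_iff extensional_def fun_eq_iff
      ring.ring_simprules[OF cring.axioms(1)[OF assms]] restrict_def cring.cring_simprules[OF assms])

locale mult_subset = cring +
  fixes T assumes T: "T \<subseteq> carrier R" "\<one> \<in> T" "\<And>s t. s \<in> T \<Longrightarrow> t \<in> T \<Longrightarrow> s \<otimes> t \<in> T"
begin

lemma Tc[simp]: "t \<in> T \<Longrightarrow> t \<in> carrier R" using T(1) by auto

lemma fracD: "(b, t) \<in> frac R T a s \<Longrightarrow> b \<in> carrier R \<and> t \<in> T \<and> (\<exists>u\<in>T. u \<otimes> (a \<otimes> t) = u \<otimes> (b \<otimes> s))"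
  by (auto simp: frac_def)

lemma frac_self: "a \<in> carrier R \<Longrightarrow> s \<in> T \<Longrightarrow> (a, s) \<in> frac R T a s"
  by (auto simp: frac_def intro!: bexI[of _ \<one>] T(2))

lemma frac_trans:
  assumes "a \<in> carrier R" "s \<in> T" "b \<in> carrier R" "t \<in> T" "c \<in> carrier R" "v \<in> T"
    "u \<in> T" "u \<otimes> (a \<otimes> t) = u \<otimes> (b \<otimes> s)" "u' \<in> T" "u' \<otimes> (b \<otimes> v) = u' \<otimes> (c \<otimes> t)"
  shows "\<exists>w\<in>T. w \<otimes> (a \<otimes> v) = w \<otimes> (c \<otimes> s)"
proof (rule bexI)
  note [simp] = assms(1-7,9)
  have "(t \<otimes> u \<otimes> u') \<otimes> (a \<otimes> v) = (u' \<otimes> v) \<otimes> (u \<otimes> (a \<otimes> t))" by (simp add: m_ac)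
  also have "\<dots> = (u \<otimes> s) \<otimes> (u' \<otimes> (b \<otimes> v))" unfolding assms(8) by (simp add: m_ac)
  also have "\<dots> = (t \<otimes> u \<otimes> u') \<otimes> (c \<otimes> s)" unfolding assms(10) by (simp add: m_ac)
  finally show "(t \<otimes> u \<otimes> u') \<otimes> (a \<otimes> v) = (t \<otimes> u \<otimes> u') \<otimes> (c \<otimes> s)" .
  show "t \<otimes> u \<otimes> u' \<in> T" using T(3) by simp
qed

lemma frac_eqI:
  assumes "a \<in> carrier R" "s \<in> T" "b \<in> carrier R" "t \<in> T" "u \<in> T" "u \<otimes> (a \<otimes> t) = u \<otimes> (b \<otimes> s)"
  shows "frac R T a s = frac R T b t"
proof -
  note s = assms(6)[symmetric]
  have "(c, v) \<in> frac R T a s \<longleftrightarrow> (c, v) \<in> frac R T b t" for c v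
  proof
    assume "(c, v) \<in> frac R T a s"
    then obtain w where w: "c \<in> carrier R" "v \<in> T" "w \<in> T" "w \<otimes> (a \<otimes> v) = w \<otimes> (c \<otimes> s)"
      by (auto simp: frac_def)
    show "(c, v) \<in> frac R T b t"
      using frac_trans[OF assms(3,4,1,2) w(1,2) assms(5) s w(3,4)] w by (simp add: frac_def)
  next
    assume "(c, v) \<in> frac R T b t"
    then obtain w where w: "c \<in> carrier R" "v \<in> T" "w \<in> T" "w \<otimes> (b \<otimes> v) = w \<otimes> (c \<otimes> t)"
      by (auto simp: frac_def)
    show "(c, v) \<in> frac R T a s"
      using frac_trans[OF assms(1-4) w(1,2) assms(5,6) w(3,4)] w by (simp add: frac_def)
  qed
  then show ?thesis by (intro subset_antisym subrelI) simp_all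
qed

lemma frac_eq_iff:
  assumes "a \<in> carrier R" "s \<in> T" "b \<in> carrier R" "t \<in> T"
  shows "frac R T a s = frac R T b t \<longleftrightarrow> (\<exists>u\<in>T. u \<otimes> (a \<otimes> t) = u \<otimes> (b \<otimes> s))"
proof
  assume "frac R T a s = frac R T b t"
  then have "(b, t) \<in> frac R T a s" using frac_self assms by simp
  then show "\<exists>u\<in>T. u \<otimes> (a \<otimes> t) = u \<otimes> (b \<otimes> s)" by (auto simp: frac_def)
next
  assume "\<exists>u\<in>T. u \<otimes> (a \<otimes> t) = u \<otimes> (b \<otimes> s)"
  then obtain u where "u \<in> T" "u \<otimes> (a \<otimes> t) = u \<otimes> (b \<otimes> s)" by blast
  then show "frac R T a s = frac R T b t" by (rule frac_eqI[OF assms])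
qed

lemma UN_frac:
  assumes "a \<in> carrier R" "s \<in> T" "b \<in> carrier R" "t \<in> T"
    and "\<And>a' s' b' t'. (a', s') \<in> frac R T a s \<Longrightarrow> (b', t') \<in> frac R T b t \<Longrightarrow>
      F a' s' b' t' = F a s b t"
  shows "(\<Union>(a, s)\<in>frac R T a s. \<Union>(b, t)\<in>frac R T b t. F a s b t) = F a s b t"
proof (intro equalityI subsetI)
  fix z assume "z \<in> (\<Union>(a, s)\<in>frac R T a s. \<Union>(b, t)\<in>frac R T b t. F a s b t)"
  then obtain a' s' b' t' where "(a', s') \<in> frac R T a s" "(b', t') \<in> frac R T b t" "z \<in> F a' s' b' t'"
    by (elim UN_E) (simp only: split_paired_all prod.case, elim UN_E, simp only: split_paired_all prod.case)
  then show "z \<in> F a s b t" using assms(5) by simp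
next
  fix z assume "z \<in> F a s b t"
  then show "z \<in> (\<Union>(a, s)\<in>frac R T a s. \<Union>(b, t)\<in>frac R T b t. F a s b t)"
    using UN_I[OF frac_self[OF assms(1,2)]] UN_I[OF frac_self[OF assms(3,4)]] by (metis (no_types, lifting) prod.case)
qed

lemma mult_frac:
  assumes "a \<in> carrier R" "s \<in> T" "b \<in> carrier R" "t \<in> T"
  shows "frac R T a s \<otimes>\<^bsub>localization R T\<^esub> frac R T b t = frac R T (a \<otimes> b) (s \<otimes> t)"
  unfolding localization_def monoid.simps
proof (rule UN_frac[OF assms])
  fix a' s' b' t' assume "(a', s') \<in> frac R T a s" "(b', t') \<in> frac R T b t"
  then obtain u v where u: "a' \<in> carrier R" "s' \<in> T" "u \<in> T" "u \<otimes> (a \<otimes> s') = u \<otimes> (a' \<otimes> s)"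
    and v: "b' \<in> carrier R" "t' \<in> T" "v \<in> T" "v \<otimes> (b \<otimes> t') = v \<otimes> (b' \<otimes> t)"
    by (auto simp: frac_def)
  note [simp] = assms u(1-3) v(1-3)
  have "(u \<otimes> v) \<otimes> ((a' \<otimes> b') \<otimes> (s \<otimes> t)) = (u \<otimes> (a' \<otimes> s)) \<otimes> (v \<otimes> (b' \<otimes> t))" by (simp add: m_ac)
  also have "\<dots> = (u \<otimes> (a \<otimes> s')) \<otimes> (v \<otimes> (b \<otimes> t'))" by (simp only: u(4) v(4))
  also have "\<dots> = (u \<otimes> v) \<otimes> ((a \<otimes> b) \<otimes> (s' \<otimes> t'))" by (simp add: m_ac)
  finally show "frac R T (a' \<otimes> b') (s' \<otimes> t') = frac R T (a \<otimes> b) (s \<otimes> t)"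
    by (intro frac_eqI[of _ _ _ _ "u \<otimes> v"]) (auto simp: T)
qed

lemma add_frac:
  assumes "a \<in> carrier R" "s \<in> T" "b \<in> carrier R" "t \<in> T"
  shows "frac R T a s \<oplus>\<^bsub>localization R T\<^esub> frac R T b t = frac R T (a \<otimes> t \<oplus> b \<otimes> s) (s \<otimes> t)"
  unfolding localization_def ring_record_simps
proof (rule UN_frac[OF assms])
  fix a' s' b' t' assume "(a', s') \<in> frac R T a s" "(b', t') \<in> frac R T b t"
  then obtain u v where u: "a' \<in> carrier R" "s' \<in> T" "u \<in> T" "u \<otimes> (a \<otimes> s') = u \<otimes> (a' \<otimes> s)"
    and v: "b' \<in> carrier R" "t' \<in> T" "v \<in> T" "v \<otimes> (b \<otimes> t') = v \<otimes> (b' \<otimes> t)"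
    by (auto simp: frac_def)
  note [simp] = assms u(1-3) v(1-3)
  have "(u \<otimes> v) \<otimes> ((a' \<otimes> t' \<oplus> b' \<otimes> s') \<otimes> (s \<otimes> t))
      = (u \<otimes> (a' \<otimes> s)) \<otimes> (v \<otimes> t \<otimes> t') \<oplus> (v \<otimes> (b' \<otimes> t)) \<otimes> (u \<otimes> s \<otimes> s')" by (simp add: m_ac l_distr r_distr)
  also have "\<dots> = (u \<otimes> (a \<otimes> s')) \<otimes> (v \<otimes> t \<otimes> t') \<oplus> (v \<otimes> (b \<otimes> t')) \<otimes> (u \<otimes> s \<otimes> s')" by (simp only: u(4) v(4))
  also have "\<dots> = (u \<otimes> v) \<otimes> ((a \<otimes> t \<oplus> b \<otimes> s) \<otimes> (s' \<otimes> t'))" by (simp add: m_ac l_distr r_distr)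
  finally show "frac R T (a' \<otimes> t' \<oplus> b' \<otimes> s') (s' \<otimes> t') = frac R T (a \<otimes> t \<oplus> b \<otimes> s) (s \<otimes> t)"
    by (intro frac_eqI[of _ _ _ _ "u \<otimes> v"]) (auto simp: T)
qed

lemma loc_carrierE:
  assumes "x \<in> carrier (localization R T)"
  obtains a s where "a \<in> carrier R" "s \<in> T" "x = frac R T a s"
  using assms by (auto simp: localization_def)

lemma loc_carrierI: "a \<in> carrier R \<Longrightarrow> s \<in> T \<Longrightarrow> frac R T a s \<in> carrier (localization R T)"
  by (auto simp: localization_def)

lemma loc_one: "\<one>\<^bsub>localization R T\<^esub> = frac R T \<one> \<one>"
  and loc_zero: "\<zero>\<^bsub>localization R T\<^esub> = frac R T \<zero> \<one>"
  by (auto simp: localization_def)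

lemma frac_eqI': "a \<in> carrier R \<Longrightarrow> s \<in> T \<Longrightarrow> b \<in> carrier R \<Longrightarrow> t \<in> T \<Longrightarrow> a \<otimes> t = b \<otimes> s \<Longrightarrow>
   frac R T a s = frac R T b t"
  by (rule frac_eqI[of _ _ _ _ \<one>]) (auto simp: T)

lemma localization_cring: "cring (localization R T)"
proof (rule cringI)
  let ?L = "localization R T"
  have TT: "s \<otimes> t \<in> T" if "s \<in> T" "t \<in> T" for s t using T(3) that .
  show "abelian_group ?L"
  proof (rule abelian_groupI)
    fix x assume "x \<in> carrier ?L"
    then obtain a s where x: "a \<in> carrier R" "s \<in> T" "x = frac R T a s" by (rule loc_carrierE)
    have "frac R T (\<ominus> a \<otimes> s \<oplus> a \<otimes> s) (s \<otimes> s) = frac R T \<zero> \<one>"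
      by (rule frac_eqI') (use x(1,2) T(2) TT in \<open>auto simp: l_minus l_neg\<close>)
    then have "frac R T (\<ominus> a) s \<oplus>\<^bsub>?L\<^esub> x = \<zero>\<^bsub>?L\<^esub>"
      unfolding x(3) loc_zero using x(1,2) by (simp add: add_frac)
    with x show "\<exists>y\<in>carrier ?L. y \<oplus>\<^bsub>?L\<^esub> x = \<zero>\<^bsub>?L\<^esub>"
      by (intro bexI[of _ "frac R T (\<ominus> a) s"]) (auto intro: loc_carrierI)
    show "\<zero>\<^bsub>?L\<^esub> \<oplus>\<^bsub>?L\<^esub> x = x"
      unfolding x(3) loc_zero using x(1,2) T(2) by (simp add: add_frac)
    fix y assume "y \<in> carrier ?L"
    then obtain b t where y: "b \<in> carrier R" "t \<in> T" "y = frac R T b t" by (rule loc_carrierE)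
    show "x \<oplus>\<^bsub>?L\<^esub> y \<in> carrier ?L"
      using x y TT by (simp add: add_frac loc_carrierI)
    show "x \<oplus>\<^bsub>?L\<^esub> y = y \<oplus>\<^bsub>?L\<^esub> x"
      using x y TT by (simp add: add_frac a_comm m_comm)
    fix z assume "z \<in> carrier ?L"
    then obtain c v where z: "c \<in> carrier R" "v \<in> T" "z = frac R T c v" by (rule loc_carrierE)
    show "x \<oplus>\<^bsub>?L\<^esub> y \<oplus>\<^bsub>?L\<^esub> z = x \<oplus>\<^bsub>?L\<^esub> (y \<oplus>\<^bsub>?L\<^esub> z)"
      using x y z TT by (simp add: add_frac l_distr r_distr a_ac m_ac)
  next
    show "\<zero>\<^bsub>?L\<^esub> \<in> carrier ?L" unfolding loc_zero using T(2) by (simp add: loc_carrierI)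
  qed
  show "comm_monoid ?L"
  proof (rule comm_monoidI)
    fix x assume "x \<in> carrier ?L"
    then obtain a s where x: "a \<in> carrier R" "s \<in> T" "x = frac R T a s" by (rule loc_carrierE)
    show "\<one>\<^bsub>?L\<^esub> \<otimes>\<^bsub>?L\<^esub> x = x"
      unfolding x(3) loc_one using x(1,2) T(2) by (simp add: mult_frac)
    fix y assume "y \<in> carrier ?L"
    then obtain b t where y: "b \<in> carrier R" "t \<in> T" "y = frac R T b t" by (rule loc_carrierE)
    show "x \<otimes>\<^bsub>?L\<^esub> y \<in> carrier ?L"
      using x y TT by (simp add: mult_frac loc_carrierI)
    show "x \<otimes>\<^bsub>?L\<^esub> y = y \<otimes>\<^bsub>?L\<^esub> x"
      using x y TT by (simp add: mult_frac m_comm)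
    fix z assume "z \<in> carrier ?L"
    then obtain c v where z: "c \<in> carrier R" "v \<in> T" "z = frac R T c v" by (rule loc_carrierE)
    show "x \<otimes>\<^bsub>?L\<^esub> y \<otimes>\<^bsub>?L\<^esub> z = x \<otimes>\<^bsub>?L\<^esub> (y \<otimes>\<^bsub>?L\<^esub> z)"
      using x y z TT by (simp add: mult_frac m_ac)
  next
    show "\<one>\<^bsub>?L\<^esub> \<in> carrier ?L" unfolding loc_one using T(2) by (simp add: loc_carrierI)
  qed
  fix x y z assume "x \<in> carrier ?L" "y \<in> carrier ?L" "z \<in> carrier ?L"
  then obtain a s b t c v where x: "a \<in> carrier R" "s \<in> T" "x = frac R T a s"
    and y: "b \<in> carrier R" "t \<in> T" "y = frac R T b t"
    and z: "c \<in> carrier R" "v \<in> T" "z = frac R T c v"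
    by (metis loc_carrierE)
  have "frac R T ((a \<otimes> t \<oplus> b \<otimes> s) \<otimes> c) (s \<otimes> t \<otimes> v)
      = frac R T (a \<otimes> c \<otimes> (t \<otimes> v) \<oplus> b \<otimes> c \<otimes> (s \<otimes> v)) (s \<otimes> v \<otimes> (t \<otimes> v))"
    by (rule frac_eqI') (use x y z TT in \<open>simp_all add: l_distr r_distr a_ac m_ac\<close>)
  then show "(x \<oplus>\<^bsub>?L\<^esub> y) \<otimes>\<^bsub>?L\<^esub> z = x \<otimes>\<^bsub>?L\<^esub> z \<oplus>\<^bsub>?L\<^esub> y \<otimes>\<^bsub>?L\<^esub> z"
    using x y z TT by (simp add: add_frac mult_frac)
qed

end

lemma prime_mult_subset:
  assumes "primeideal p R" shows "mult_subset R (carrier R - p)"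
proof -
  interpret primeideal p R by fact
  show ?thesis
    by unfold_locales (use I_notcarr one_imp_carrier I_prime in auto)
qed

lemma residue_field_field:
  assumes "primeideal p R" shows "field (residue_field R p)"
proof -
  interpret p: primeideal p R by fact
  interpret mult_subset R "carrier R - p" by (rule prime_mult_subset[OF assms])
  let ?T = "carrier R - p" and ?L = "local_ring_at R p"
  let ?m = "{frac R ?T a s | a s. a \<in> p \<and> s \<in> ?T}"
  have L: "cring ?L" using localization_cring by (simp add: local_ring_at_def)
  interpret L: cring ?L by fact
  note Lr = local_ring_at_def
  have one: "\<one>\<^bsub>R\<^esub> \<in> ?T" by (rule T(2))
  have TT: "s \<otimes>\<^bsub>R\<^esub> t \<in> ?T" if "s \<in> ?T" "t \<in> ?T" for s t using T(3) that .
  have pc: "a \<in> carrier R" if "a \<in> p" for a using p.a_Hcarr that .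
  have z: "\<zero>\<^bsub>R\<^esub> \<in> p" by (rule additive_subgroup.zero_closed[OF p.is_additive_subgroup])
  have fc: "frac R ?T a s \<in> carrier ?L" if "a \<in> carrier R" "s \<in> ?T" for a s
    unfolding Lr using that by (rule loc_carrierI)
  have sub: "?m \<subseteq> carrier ?L" using pc fc by blast
  have mid: "ideal ?m ?L"
  proof (rule idealI[OF L.ring_axioms])
    show "subgroup ?m (add_monoid ?L)"
    proof (rule L.add.subgroupI)
      show "?m \<subseteq> carrier ?L" by (rule sub)
      have "frac R ?T \<zero>\<^bsub>R\<^esub> \<one>\<^bsub>R\<^esub> \<in> ?m" using z one by blast
      then show "?m \<noteq> {}" by blast
      fix x assume x: "x \<in> ?m"
      then obtain a s where a: "x = frac R ?T a s" "a \<in> p" "s \<in> ?T" by auto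
      have "frac R ?T (\<ominus>\<^bsub>R\<^esub> a) s \<oplus>\<^bsub>?L\<^esub> x = \<zero>\<^bsub>?L\<^esub>"
      proof -
        have "frac R ?T (\<ominus>\<^bsub>R\<^esub> a \<otimes>\<^bsub>R\<^esub> s \<oplus>\<^bsub>R\<^esub> a \<otimes>\<^bsub>R\<^esub> s) (s \<otimes>\<^bsub>R\<^esub> s) = frac R ?T \<zero>\<^bsub>R\<^esub> \<one>\<^bsub>R\<^esub>"
          by (rule frac_eqI') (use a(2,3) one TT[OF a(3) a(3)] pc[OF a(2)] in \<open>simp_all add: p.l_minus p.l_neg\<close>)
        then show ?thesis
          unfolding a(1) Lr loc_zero using pc[OF a(2)] a(3) by (simp add: add_frac)
      qed
      then have "\<ominus>\<^bsub>?L\<^esub> x = frac R ?T (\<ominus>\<^bsub>R\<^esub> a) s"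
        using a(3) pc[OF a(2)] sub x by (intro L.minus_equality) (auto intro!: fc)
      then show "\<ominus>\<^bsub>?L\<^esub> x \<in> ?m" using a additive_subgroup.a_inv_closed[OF p.is_additive_subgroup] p.abelian_group_axioms by auto
      fix y assume y: "y \<in> ?m"
      then obtain b t where b: "y = frac R ?T b t" "b \<in> p" "t \<in> ?T" by auto
      have "x \<oplus>\<^bsub>?L\<^esub> y = frac R ?T (a \<otimes>\<^bsub>R\<^esub> t \<oplus>\<^bsub>R\<^esub> b \<otimes>\<^bsub>R\<^esub> s) (s \<otimes>\<^bsub>R\<^esub> t)"
        using a b pc by (simp add: Lr add_frac)
      moreover have "a \<otimes>\<^bsub>R\<^esub> t \<oplus>\<^bsub>R\<^esub> b \<otimes>\<^bsub>R\<^esub> s \<in> p" "s \<otimes>\<^bsub>R\<^esub> t \<in> ?T"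
        using TT[OF a(3) b(3)] additive_subgroup.a_closed[OF p.is_additive_subgroup p.I_r_closed[OF a(2), of t] p.I_r_closed[OF b(2), of s]] a(3) b(3) by auto
      ultimately show "x \<oplus>\<^bsub>?L\<^esub> y \<in> ?m" by blast
    qed
    fix x y assume x: "x \<in> ?m" and y: "y \<in> carrier ?L"
    then obtain a s b t where a: "x = frac R ?T a s" "a \<in> p" "s \<in> ?T"
      and b: "y = frac R ?T b t" "b \<in> carrier R" "t \<in> ?T"
      by (auto simp: Lr elim!: loc_carrierE)
    have "x \<otimes>\<^bsub>?L\<^esub> y = frac R ?T (a \<otimes>\<^bsub>R\<^esub> b) (s \<otimes>\<^bsub>R\<^esub> t)" using a b pc by (simp add: Lr mult_frac)
    moreover have "a \<otimes>\<^bsub>R\<^esub> b \<in> p" "s \<otimes>\<^bsub>R\<^esub> t \<in> ?T" using TT[OF a(3) b(3)] p.I_r_closed[OF a(2) b(2)] by auto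
    ultimately show "x \<otimes>\<^bsub>?L\<^esub> y \<in> ?m" by blast
    moreover have "y \<otimes>\<^bsub>?L\<^esub> x = x \<otimes>\<^bsub>?L\<^esub> y" using x y sub by (intro L.m_comm) auto
    ultimately show "y \<otimes>\<^bsub>?L\<^esub> x \<in> ?m" by simp
  qed
  have sub': "local_map R p ` p \<subseteq> carrier ?L"
    unfolding local_map_def using fc one pc by blast
  have eq: "local_ideal R p = ?m"
  proof
    show "local_ideal R p \<subseteq> ?m" unfolding local_ideal_def
      by (rule L.genideal_minimal[OF mid]) (use one in \<open>auto simp: local_map_def\<close>)
    have I: "ideal (local_ideal R p) ?L" unfolding local_ideal_def by (rule L.genideal_ideal[OF sub'])
    show "?m \<subseteq> local_ideal R p"
    proof
      fix x assume "x \<in> ?m"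
      then obtain a s where a: "x = frac R ?T a s" "a \<in> p" "s \<in> ?T" by auto
      have "x = frac R ?T a \<one>\<^bsub>R\<^esub> \<otimes>\<^bsub>?L\<^esub> frac R ?T \<one>\<^bsub>R\<^esub> s"
        using a one pc by (simp add: Lr mult_frac)
      moreover have "frac R ?T a \<one>\<^bsub>R\<^esub> \<in> local_ideal R p"
        unfolding local_ideal_def using L.genideal_self[OF sub'] a(2) by (auto simp: local_map_def)
      moreover have "frac R ?T \<one>\<^bsub>R\<^esub> s \<in> carrier ?L" using a by (intro fc) auto
      ultimately show "x \<in> local_ideal R p" using ideal.I_r_closed[OF I] by simp
    qed
  qed
  have "maximalideal ?m ?L"
  proof (rule maximalidealI[OF mid])
    have "\<one>\<^bsub>?L\<^esub> \<notin> ?m"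
    proof
      assume "\<one>\<^bsub>?L\<^esub> \<in> ?m"
      then obtain a s where a: "frac R ?T \<one>\<^bsub>R\<^esub> \<one>\<^bsub>R\<^esub> = frac R ?T a s" "a \<in> p" "s \<in> ?T"
        by (auto simp: Lr loc_one)
      then obtain u where u: "u \<in> ?T" "u \<otimes>\<^bsub>R\<^esub> (\<one>\<^bsub>R\<^esub> \<otimes>\<^bsub>R\<^esub> s) = u \<otimes>\<^bsub>R\<^esub> (a \<otimes>\<^bsub>R\<^esub> \<one>\<^bsub>R\<^esub>)"
        using frac_eq_iff[of "\<one>\<^bsub>R\<^esub>" "\<one>\<^bsub>R\<^esub>" a s] one pc by auto
      then have "u \<otimes>\<^bsub>R\<^esub> s \<in> p" using a pc p.I_l_closed[OF a(2), of u] by auto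
      moreover have "u \<otimes>\<^bsub>R\<^esub> s \<in> ?T" using TT u(1) a(3) .
      ultimately show False by simp
    qed
    then show "carrier ?L \<noteq> ?m" using L.one_closed by (metis (lifting))
    fix J assume J: "ideal J ?L" "?m \<subseteq> J" "J \<subseteq> carrier ?L"
    interpret J: ideal J ?L by fact
    show "J = ?m \<or> J = carrier ?L"
    proof (cases "J \<subseteq> ?m")
      case False
      then obtain x where x: "x \<in> J" "x \<notin> ?m" by blast
      then obtain a s where a: "x = frac R ?T a s" "a \<in> carrier R" "s \<in> ?T"
      proof -
        have "x \<in> carrier (localization R ?T)" using x(1) J(3) by (auto simp: Lr)
        then show ?thesis using that by (rule loc_carrierE)
      qed
      have ap: "a \<in> ?T"
      proof (rule ccontr)
        assume "a \<notin> ?T"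
        then have "a \<in> p" using a(2) by simp
        then have "x \<in> ?m" using a(1,3) by blast
        with x(2) show False by contradiction
      qed
      have "frac R ?T s a \<otimes>\<^bsub>?L\<^esub> x = \<one>\<^bsub>?L\<^esub>"
      proof -
        have "frac R ?T (s \<otimes>\<^bsub>R\<^esub> a) (a \<otimes>\<^bsub>R\<^esub> s) = frac R ?T \<one>\<^bsub>R\<^esub> \<one>\<^bsub>R\<^esub>"
          by (rule frac_eqI') (use a(2,3) one TT[OF ap a(3)] in \<open>simp_all add: p.m_comm\<close>)
        then show ?thesis
          unfolding a(1) Lr loc_one using a(2,3) ap by (simp add: mult_frac)
      qed
      moreover have "frac R ?T s a \<otimes>\<^bsub>?L\<^esub> x \<in> J"
        by (rule J.I_l_closed[OF x(1)]) (use a ap in \<open>auto intro!: fc\<close>)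
      ultimately show ?thesis using J.one_imp_carrier by simp
    next
      case True
      then show ?thesis using J(2) by simp
    qed
  qed
  then show ?thesis unfolding residue_field_def eq
    using maximalideal.quotient_is_field[OF _ L] by blast
qed

lemma residue_product_cring:
  assumes "Y \<subseteq> Spec R" shows "cring (residue_product R Y)"
  unfolding residue_product_def
proof (rule product_ring_cring)
  fix p assume "p \<in> Y"
  then have "primeideal p R" using assms by (auto simp: Spec_def)
  from residue_field_field[OF this] show "cring (residue_field R p)"
    by (rule domain.axioms(1)[OF field.axioms(1)])
qed

lemma residue_product_map_hom:
  assumes "Y \<subseteq> Spec R"
  shows "residue_product_map R Y \<in> ring_hom R (residue_product R Y)"
proof -
  have h: "residue_map R p \<in> ring_hom R (residue_field R p)" if "p \<in> Y" for p
  proof -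
    have p: "primeideal p R" using that assms unfolding Spec_def by blast
    interpret p: primeideal p R by fact
    interpret mult_subset R "carrier R - p" by (rule prime_mult_subset[OF p])
    have L: "cring (local_ring_at R p)" using localization_cring by (simp add: local_ring_at_def)
    interpret L: cring "local_ring_at R p" by fact
    have l: "local_map R p \<in> ring_hom R (local_ring_at R p)"
      unfolding local_map_def local_ring_at_def
      by (rule ring_hom_memI) (use T(2) in \<open>simp_all add: mult_frac add_frac loc_one loc_carrierI\<close>)
    have "local_map R p ` p \<subseteq> carrier (local_ring_at R p)"
      using l p.a_subset by (auto simp: ring_hom_def)
    then have I: "ideal (local_ideal R p) (local_ring_at R p)"
      unfolding local_ideal_def by (rule L.genideal_ideal)
    show ?thesis
      using ring_hom_trans[OF l ideal.rcos_ring_hom[OF I]]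
      by (simp add: residue_map_def[abs_def] residue_field_def comp_def)
  qed
  show ?thesis
    by (rule ring_hom_memI)
      (auto simp: residue_product_map_def residue_product_def product_ring_def
        ring_hom_closed[OF h] ring_hom_mult[OF h] ring_hom_add[OF h] ring_hom_one[OF h] intro!: restrict_ext)
qed

end

(*
  Let A be a finite generating set of M and K the kernel of R^A -> M. Flatness says that every
  finite subset of K is fixed by some linear E : R^A -> K. Since M (x) S is the quotient of S^A by the
  span of K, it is projective over S iff a single E fixes
  all of K after applying R -> S. For S a product of residue fields over X this
  reads: r - E r has entries in p for all r in K and p in X. Such an E generates K locally at each p in X
  (a Nakayama argument that needs no finiteness of K because K is pure in R^A). An E' that
  fixes the image of E therefore fixes K locally at p, hence at every q contained in p.
*)
theory Submission
  imports Defs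
begin

text \<open>The difficulty lies in the order of quantifiers: flatness gives an \<open>E\<close> for
  each finite set of relations, projectivity over the product asks for one \<open>E\<close> for all
  of \<open>K\<close>, and \<open>K\<close> is finitely generated only if \<open>M\<close> is
  finitely presented. In passing from \<open>p\<close> to a smaller prime \<open>q\<close>, the
  congruence \<open>E r - r\<close> in \<open>p\<close> says nothing modulo \<open>q\<close>. An
  equation does descend: if \<open>s r = E v\<close> with \<open>s\<close> outside \<open>p\<close>,
  then any \<open>E'\<close> fixing the image of \<open>E\<close> satisfies
  \<open>s (E' r - r) = 0\<close>, and zero lies in \<open>q\<close> while \<open>s\<close> does
  not. So congruences have to become equations up to a factor outside \<open>p\<close>. That factor
  depends on \<open>r\<close> and \<open>p\<close>, but \<open>E'\<close> does not: the image of
  \<open>E\<close> is generated by the finitely many \<open>E e_a\<close>. The Nakayama argument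
  uses purity in the form \<open>r = r G\<close>, where the rows of the matrix \<open>G\<close> lie
  in \<open>K\<close>. If all of \<open>K\<close> has entries in \<open>p\<close>, then
  \<open>1 - G\<close> is the identity modulo \<open>p\<close>, so its determinant is outside
  \<open>p\<close> and kills \<open>r\<close>; eliminating coordinates reduces the general case to
  this one.\<close>

section \<open>Relations over a local ring\<close>

text \<open>Modulo \<open>I\<close> the determinant of \<open>C\<close> is the product of its
  diagonal, hence outside \<open>I\<close>, and the adjugate shows that it kills \<open>r\<close>.
  Fraction-free elimination replaces the determinant here by a product of pivots, each outside the
  prime.\<close>

lemma (in primeideal) kernel_of_diagonal_mod_prime:
  assumes "finite J"
    and "r \<in> J \<rightarrow> carrier R"
    and "\<And>i j. i \<in> J \<Longrightarrow> j \<in> J \<Longrightarrow> C i j \<in> carrier R"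
    and "\<And>i. i \<in> J \<Longrightarrow> C i i \<notin> I"
    and "\<And>i j. i \<in> J \<Longrightarrow> j \<in> J \<Longrightarrow> i \<noteq> j \<Longrightarrow> C i j \<in> I"
    and "\<And>j. j \<in> J \<Longrightarrow> (\<Oplus>i\<in>J. r i \<otimes> C i j) = \<zero>"
  shows "\<exists>s\<in>carrier R - I. \<forall>i\<in>J. s \<otimes> r i = \<zero>"
  using assms
proof (induction J arbitrary: C)
  case empty
  show ?case using I_notcarr one_imp_carrier by auto
next
  case (insert n J)
  note C = insert.prems(2)
  have r: "r i \<in> carrier R" if "i \<in> insert n J" for i using insert.prems(1) that by auto
  have sm: "(\<lambda>i. r i \<otimes> C i j) \<in> J \<rightarrow> carrier R" if "j \<in> insert n J" for j
    using C r that by auto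
  let ?S = "\<lambda>j. \<Oplus>i\<in>J. r i \<otimes> C i j"
  have S: "?S j \<in> carrier R" if "j \<in> insert n J" for j
    using sm[OF that] by (rule finsum_closed)
  have rn: "r n \<otimes> C n j \<oplus> ?S j = \<zero>" if "j \<in> insert n J" for j
    using insert.prems(5)[OF that] insert.hyps sm[OF that] C r that by (simp add: finsum_insert)
  have Sneg: "?S j = \<ominus> (r n \<otimes> C n j)" if "j \<in> insert n J" for j
  proof (rule minus_equality[symmetric])
    show "?S j \<oplus> r n \<otimes> C n j = \<zero>"
      using rn[OF that] a_comm[of "?S j" "r n \<otimes> C n j"] S[OF that] r C that by simp
  qed (use S[OF that] r C that in auto)
  \<comment> \<open>The Schur complement of the pivot \<open>C n n\<close>, cleared of denominators:
    \<open>C n n\<close> times column \<open>j\<close> minus \<open>C n j\<close> times column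
    \<open>n\<close>. Row \<open>n\<close> cancels, and the correction lies in \<open>I\<close>
    because \<open>C i n\<close> does, so \<open>?C\<close> is again diagonal modulo
    \<open>I\<close>.\<close>
  let ?C = "\<lambda>i j. C n n \<otimes> C i j \<ominus> C i n \<otimes> C n j"
  have "\<exists>s\<in>carrier R - I. \<forall>i\<in>J. s \<otimes> r i = \<zero>"
  proof (rule insert.IH[of ?C])
    show "r \<in> J \<rightarrow> carrier R" using insert.prems(1) by auto
    show "?C i j \<in> carrier R" if "i \<in> J" "j \<in> J" for i j using C that by auto
    show "?C i i \<notin> I" if "i \<in> J" for i
    proof
      have i: "C i n \<otimes> C n i \<in> I"
        using insert.prems(4)[of i n] C[of n i] insert.hyps that by (auto intro: I_r_closed)
      assume "?C i i \<in> I"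
      then have "?C i i \<oplus> C i n \<otimes> C n i \<in> I" using i by (rule additive_subgroup.a_closed[OF is_additive_subgroup])
      moreover have "?C i i \<oplus> C i n \<otimes> C n i = C n n \<otimes> C i i"
        using C that by (simp add: minus_eq a_assoc l_neg)
      ultimately show False
        using I_prime[of "C n n" "C i i"] insert.prems(3) C that by auto
    qed
    show "?C i j \<in> I" if "i \<in> J" "j \<in> J" "i \<noteq> j" for i j
    proof -
      have "C n n \<otimes> C i j \<in> I" "C i n \<otimes> C n j \<in> I"
        using insert.prems(4)[of i j] insert.prems(4)[of i n] C insert.hyps that
        by (auto intro: I_r_closed I_l_closed)
      then show ?thesis by (simp add: minus_eq a_closed a_inv_closed)
    qed
    fix j assume j: "j \<in> J"
    have "(\<Oplus>i\<in>J. r i \<otimes> ?C i j) = (\<Oplus>i\<in>J. C n n \<otimes> (r i \<otimes> C i j) \<oplus> \<ominus> C n j \<otimes> (r i \<otimes> C i n))"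
      using C r j by (intro finsum_cong') (auto simp: minus_eq r_distr l_minus r_minus m_ac)
    also have "\<dots> = (\<Oplus>i\<in>J. C n n \<otimes> (r i \<otimes> C i j)) \<oplus> (\<Oplus>i\<in>J. \<ominus> C n j \<otimes> (r i \<otimes> C i n))"
      using C r j by (intro finsum_addf) auto
    also have "\<dots> = C n n \<otimes> ?S j \<oplus> \<ominus> C n j \<otimes> ?S n"
      using C sm j insert.hyps(1) by (simp add: finsum_rdistr)
    also have "?S n = \<ominus> (r n \<otimes> C n n)" by (rule Sneg) simp
    also have "?S j = \<ominus> (r n \<otimes> C n j)" by (rule Sneg) (simp add: j)
    also have "C n n \<otimes> \<ominus> (r n \<otimes> C n j) \<oplus> \<ominus> C n j \<otimes> \<ominus> (r n \<otimes> C n n) = \<zero>"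
      using C r j by (simp add: l_minus r_minus m_ac l_neg)
    finally show "(\<Oplus>i\<in>J. r i \<otimes> ?C i j) = \<zero>" .
  qed
  then obtain s where s: "s \<in> carrier R" "s \<notin> I" "\<And>i. i \<in> J \<Longrightarrow> s \<otimes> r i = \<zero>" by auto
  \<comment> \<open>Since \<open>s\<close> kills every \<open>r i\<close> with \<open>i\<close> in
    \<open>J\<close>, equation \<open>n\<close> multiplied by \<open>s\<close> reduces to
    \<open>s * r n * C n n = 0\<close>. The extra factor \<open>C n n\<close> thus takes care of
    \<open>r n\<close>.\<close>
  have sC: "s \<otimes> C n n \<in> carrier R - I"
    using s C insert.prems(3)[of n] I_prime[of s "C n n"] by auto
  have "s \<otimes> ?S n = (\<Oplus>i\<in>J. s \<otimes> (r i \<otimes> C i n))"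
    using s sm insert.hyps(1) by (simp add: finsum_rdistr)
  also have "\<dots> = (\<Oplus>i\<in>J. \<zero>)"
    using s C r by (intro finsum_cong') (auto simp: m_assoc[symmetric])
  finally have "s \<otimes> ?S n = \<zero>" by simp
  then have "s \<otimes> \<ominus> (r n \<otimes> C n n) = \<zero>" using Sneg[of n] by simp
  moreover have "s \<otimes> C n n \<otimes> r n = \<ominus> (s \<otimes> \<ominus> (r n \<otimes> C n n))"
    using s(1) C[of n n] r[of n] by (simp add: r_minus m_assoc m_comm[of "C n n"])
  ultimately have "s \<otimes> C n n \<otimes> r n = \<zero>" by simp
  moreover have "s \<otimes> C n n \<otimes> r i = \<zero>" if "i \<in> J" for i
  proof -
    have "s \<otimes> C n n \<otimes> r i = C n n \<otimes> (s \<otimes> r i)" using s(1) C r that by (simp add: m_ac)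
    then show ?thesis using s(3)[OF that] C by simp
  qed
  ultimately show ?case using sC by blast
qed

section \<open>Elimination of coordinates modulo a prime\<close>

text \<open>The combination \<open>c k - d l\<close> is the elimination step itself, and closure
  under it passes to the elements vanishing at a given coordinate. A nonempty such set of
  \<open>R\<close>-valued functions is a submodule; the pointwise form spares fixing a free module
  while the support shrinks.\<close>

definition comb_closed :: "('a, 'r) ring_scheme \<Rightarrow> ('i \<Rightarrow> 'a) set \<Rightarrow> bool"
  where "comb_closed R K \<longleftrightarrow> (\<forall>k\<in>K. \<forall>l\<in>K. \<forall>c\<in>carrier R. \<forall>d\<in>carrier R.
    (\<lambda>b. c \<otimes>\<^bsub>R\<^esub> k b \<ominus>\<^bsub>R\<^esub> d \<otimes>\<^bsub>R\<^esub> l b) \<in> K)"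

lemma comb_closedD:
  "comb_closed R K \<Longrightarrow> k \<in> K \<Longrightarrow> l \<in> K \<Longrightarrow> c \<in> carrier R \<Longrightarrow> d \<in> carrier R \<Longrightarrow>
    (\<lambda>b. c \<otimes>\<^bsub>R\<^esub> k b \<ominus>\<^bsub>R\<^esub> d \<otimes>\<^bsub>R\<^esub> l b) \<in> K"
  by (simp add: comb_closed_def)

text \<open>If some element of \<open>L\<close> has a coordinate outside the prime, use it to eliminate that coordinate:
  both generation hypotheses survive. Otherwise \<open>E\<close> vanishes modulo the prime, so the equation
  \<open>r(s - E) = 0\<close> kills \<open>r\<close> locally.\<close>

lemma (in primeideal) local_generation:
  assumes "finite J"
    and "\<And>k b. k \<in> K \<Longrightarrow> k b \<in> carrier R" "\<And>k b. k \<in> K \<Longrightarrow> b \<notin> J \<Longrightarrow> k b = \<zero>"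
    and "comb_closed R K" "comb_closed R L" "L \<subseteq> K" "L \<noteq> {}"
    and "\<And>r. r \<in> K \<Longrightarrow> \<exists>s\<in>carrier R - I. \<exists>l\<in>L. \<forall>b. s \<otimes> r b \<ominus> l b \<in> I"
    and "\<And>r. r \<in> K \<Longrightarrow> \<exists>s\<in>carrier R - I. \<exists>E. (\<forall>j\<in>J. E j \<in> K) \<and> (\<forall>b. s \<otimes> r b = (\<Oplus>j\<in>J. r j \<otimes> E j b))"
    and "r \<in> K"
  shows "\<exists>s\<in>carrier R - I. (\<lambda>b. s \<otimes> r b) \<in> L"
  using assms
proof (induction J arbitrary: K L r rule: finite_psubset_induct)
  case (psubset J)
  note Kc = psubset.prems(1) and K0 = psubset.prems(2) and Kcl = psubset.prems(3)
    and Lcl = psubset.prems(4) and LK = psubset.prems(5) and L0 = psubset.prems(6)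
    and gen = psubset.prems(7) and fl = psubset.prems(8) and r = psubset.prems(9)
  have Lc: "l b \<in> carrier R" if "l \<in> L" for l b using Kc LK that by auto
  have zz: "u \<ominus> \<zero> \<otimes> v = u" if "u \<in> carrier R" "v \<in> carrier R" for u v
    using that by (simp add: minus_eq)
  show ?case
  proof (cases "\<exists>f\<in>L. \<exists>i. f i \<notin> I")
    case False
    \<comment> \<open>Modulo \<open>I\<close> each element of \<open>K\<close> is, up to a factor
      outside \<open>I\<close>, an element of \<open>L\<close>. As \<open>L\<close> vanishes there,
      so does \<open>K\<close>.\<close>
    have Ksub: "k b \<in> I" if k: "k \<in> K" for k b
    proof -
      obtain s l where s: "s \<in> carrier R" "s \<notin> I" "l \<in> L" "s \<otimes> k b \<ominus> l b \<in> I"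
        using gen[OF k] by blast
      have "l b \<in> I" using False s(3) by blast
      with s(4) have "s \<otimes> k b \<ominus> l b \<oplus> l b \<in> I" by (rule additive_subgroup.a_closed[OF is_additive_subgroup])
      moreover have "s \<otimes> k b \<ominus> l b \<oplus> l b = s \<otimes> k b"
        using s Kc[OF k] Lc[OF s(3)] by (simp add: minus_eq a_assoc l_neg)
      ultimately show ?thesis using I_prime[of s "k b"] s Kc[OF k] by auto
    qed
    obtain s E where s: "s \<in> carrier R" "s \<notin> I" and E: "\<And>j. j \<in> J \<Longrightarrow> E j \<in> K"
      "\<And>b. s \<otimes> r b = (\<Oplus>j\<in>J. r j \<otimes> E j b)" using fl[OF r] by blast
    \<comment> \<open>The matrix \<open>s - E\<close>. The rows \<open>E i\<close> lie in
      \<open>K\<close> and so have entries in \<open>I\<close>; modulo \<open>I\<close> only the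
      diagonal entries \<open>s\<close> remain.\<close>
    let ?C = "\<lambda>i j. (if i = j then s else \<zero>) \<ominus> E i j"
    have Ec: "E i j \<in> carrier R" if "i \<in> J" for i j using E that Kc by auto
    have "\<exists>t\<in>carrier R - I. \<forall>i\<in>J. t \<otimes> r i = \<zero>"
    proof (rule kernel_of_diagonal_mod_prime[where C = ?C])
      show "finite J" by fact
      show "r \<in> J \<rightarrow> carrier R" using Kc[OF r] by auto
      show "?C i j \<in> carrier R" if "i \<in> J" "j \<in> J" for i j using Ec that s by auto
      show "?C i i \<notin> I" if "i \<in> J" for i
      proof
        assume "?C i i \<in> I"
        then have "?C i i \<oplus> E i i \<in> I" using Ksub[OF E(1)[OF that]] by (rule additive_subgroup.a_closed[OF is_additive_subgroup])
        then show False using s Ec[OF that] by (simp add: minus_eq a_assoc l_neg)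
      qed
      show "?C i j \<in> I" if "i \<in> J" "j \<in> J" "i \<noteq> j" for i j
        using Ksub[OF E(1)[OF that(1)], of j] that Ec by (simp add: minus_eq a_inv_closed)
      fix j assume j: "j \<in> J"
      have "(\<Oplus>i\<in>J. r i \<otimes> ?C i j) = (\<Oplus>i\<in>J. (if j = i then s \<otimes> r i else \<zero>) \<oplus> (\<ominus> \<one>) \<otimes> (r i \<otimes> E i j))"
        using Ec s Kc[OF r] by (intro finsum_cong') (auto simp: minus_eq r_distr r_minus l_minus m_comm)
      also have "\<dots> = (\<Oplus>i\<in>J. if j = i then s \<otimes> r i else \<zero>) \<oplus> (\<Oplus>i\<in>J. (\<ominus> \<one>) \<otimes> (r i \<otimes> E i j))"
        using Ec s Kc[OF r] by (intro finsum_addf) auto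
      also have "(\<Oplus>i\<in>J. if j = i then s \<otimes> r i else \<zero>) = s \<otimes> r j"
        using j psubset.hyps s Kc[OF r] by (intro finsum_singleton) auto
      also have "(\<Oplus>i\<in>J. (\<ominus> \<one>) \<otimes> (r i \<otimes> E i j)) = (\<ominus> \<one>) \<otimes> (\<Oplus>i\<in>J. r i \<otimes> E i j)"
        using Ec s Kc[OF r] psubset.hyps by (intro finsum_rdistr[symmetric]) auto
      also have "\<dots> = \<ominus> (s \<otimes> r j)" using s Kc[OF r] by (simp add: E(2)[symmetric] l_minus)
      also have "s \<otimes> r j \<oplus> \<ominus> (s \<otimes> r j) = \<zero>" using s Kc[OF r] by (simp add: r_neg)
      finally show "(\<Oplus>i\<in>J. r i \<otimes> ?C i j) = \<zero>" .
    qed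
    then obtain t where t: "t \<in> carrier R - I" "\<And>i. i \<in> J \<Longrightarrow> t \<otimes> r i = \<zero>" by blast
    obtain l where l: "l \<in> L" using L0 by blast
    \<comment> \<open>The zero function equals \<open>t * r\<close>; nonemptiness and closure put it
      into \<open>L\<close> as a combination with zero coefficients.\<close>
    have "(\<lambda>b. \<zero> \<otimes> l b \<ominus> \<zero> \<otimes> l b) \<in> L" by (rule comb_closedD[OF Lcl l l]) auto
    moreover have "(\<lambda>b. \<zero> \<otimes> l b \<ominus> \<zero> \<otimes> l b) = (\<lambda>b. t \<otimes> r b)"
    proof
      fix b show "\<zero> \<otimes> l b \<ominus> \<zero> \<otimes> l b = t \<otimes> r b"
        using t K0[OF r, of b] Lc[OF l, of b] by (cases "b \<in> J") (auto simp: minus_eq)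
    qed
    ultimately show ?thesis using t(1) by auto
  next
    case True
    then obtain f i where f: "f \<in> L" "f i \<notin> I" by blast
    have fK: "f \<in> K" using f LK by blast
    have fc: "f b \<in> carrier R" for b using Lc[OF f(1)] .
    have iJ: "i \<in> J" using K0[OF fK, of i] f(2) additive_subgroup.zero_closed[OF is_additive_subgroup] by metis
    let ?K = "{k \<in> K. k i = \<zero>}" and ?L = "{l \<in> L. l i = \<zero>}"
    \<comment> \<open>Subtracting \<open>k i\<close> times \<open>f\<close> from \<open>f i\<close>
      times \<open>k\<close> clears coordinate \<open>i\<close>. Nothing is lost locally since
      \<open>f i\<close> is outside \<open>I\<close>, and the step stays inside both
      \<open>K\<close> and \<open>L\<close> since \<open>f\<close> belongs to both.\<close>
    have elim: "(\<lambda>b. f i \<otimes> k b \<ominus> k i \<otimes> f b) \<in> H \<and> f i \<otimes> k i \<ominus> k i \<otimes> f i = \<zero>"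
      if "k \<in> H" "comb_closed R H" "f \<in> H" "k i \<in> carrier R" for k H
      using comb_closedD[OF that(2,1,3) fc that(4)] that(4) fc by (auto simp: m_comm minus_eq r_neg)
    have closed: "comb_closed R {k \<in> H. k i = \<zero>}" if "comb_closed R H" for H
      using that by (auto simp: comb_closed_def minus_eq)
    have step: "\<exists>s\<in>carrier R - I. (\<lambda>b. s \<otimes> k b) \<in> ?L" if k: "k \<in> ?K" for k
    proof (rule psubset.IH[where B = "J - {i}" and K = ?K and L = ?L])
      show "J - {i} \<subset> J" using iJ by auto
      show "k \<in> ?K" by (rule k)
      show "comb_closed R ?K" "comb_closed R ?L" using closed Kcl Lcl by auto
      show "?L \<subseteq> ?K" using LK by auto
      have "(\<lambda>b. f i \<otimes> f b \<ominus> f i \<otimes> f b) \<in> ?L"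
        using elim[OF f(1) Lcl f(1) fc] by auto
      then show "?L \<noteq> {}" by blast
      fix k assume k: "k \<in> ?K"
      then have kK: "k \<in> K" and ki: "k i = \<zero>" by auto
      show "k b \<in> carrier R" for b using Kc[OF kK] .
      show "k b = \<zero>" if "b \<notin> J - {i}" for b using K0[OF kK] ki that by auto
      show "\<exists>s\<in>carrier R - I. \<exists>l\<in>?L. \<forall>b. s \<otimes> k b \<ominus> l b \<in> I"
      proof -
        obtain s l where s: "s \<in> carrier R" "s \<notin> I" "l \<in> L" "\<And>b. s \<otimes> k b \<ominus> l b \<in> I"
          using gen[OF kK] by blast
        have lc: "l b \<in> carrier R" for b using Lc[OF s(3)] .
        have "\<ominus> (s \<otimes> k i \<ominus> l i) \<in> I" using s(4)[of i] additive_subgroup.a_inv_closed[OF is_additive_subgroup] abelian_group_axioms by blast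
        then have li: "l i \<in> I" using s(1) lc by (simp add: ki minus_eq)
        have "f i \<otimes> s \<in> carrier R - I" using I_prime[of "f i" s] s f(2) fc by auto
        \<comment> \<open>Clearing coordinate \<open>i\<close> of \<open>l\<close> subtracts
          \<open>l i\<close> times \<open>f\<close>, which has entries in \<open>I\<close> because
          \<open>l i\<close> is in \<open>I\<close>. The congruence therefore survives, with factor
          \<open>f i * s\<close>.\<close>
        moreover have "(\<lambda>b. f i \<otimes> l b \<ominus> l i \<otimes> f b) \<in> ?L"
          using elim[OF s(3) Lcl f(1) lc] by auto
        moreover have "f i \<otimes> s \<otimes> k b \<ominus> (f i \<otimes> l b \<ominus> l i \<otimes> f b) \<in> I" for b
        proof -
          have "f i \<otimes> (s \<otimes> k b \<ominus> l b) \<oplus> l i \<otimes> f b \<in> I"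
            using s(4) li fc by (intro additive_subgroup.a_closed[OF is_additive_subgroup] I_l_closed I_r_closed)
          moreover have "f i \<otimes> (s \<otimes> k b \<ominus> l b) \<oplus> l i \<otimes> f b
              = f i \<otimes> s \<otimes> k b \<ominus> (f i \<otimes> l b \<ominus> l i \<otimes> f b)"
            using s(1) lc fc Kc[OF kK]
            by (simp add: minus_eq r_distr r_minus minus_add m_assoc a_ac)
          ultimately show ?thesis by simp
        qed
        ultimately show ?thesis
          by (intro bexI[of _ "f i \<otimes> s"] bexI[of _ "\<lambda>b. f i \<otimes> l b \<ominus> l i \<otimes> f b"] allI)
      qed
      show "\<exists>s\<in>carrier R - I. \<exists>E. (\<forall>j\<in>J - {i}. E j \<in> ?K) \<and> (\<forall>b. s \<otimes> k b = (\<Oplus>j\<in>J - {i}. k j \<otimes> E j b))"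
      proof -
        obtain s E where s: "s \<in> carrier R" "s \<notin> I" and E: "\<And>j. j \<in> J \<Longrightarrow> E j \<in> K"
          "\<And>b. s \<otimes> k b = (\<Oplus>j\<in>J. k j \<otimes> E j b)" using fl[OF kK] by blast
        have Ec: "E j b \<in> carrier R" if "j \<in> J" for j b using E that Kc by auto
        have kc: "k b \<in> carrier R" for b using Kc[OF kK] .
        \<comment> \<open>Clearing coordinate \<open>i\<close> of every \<open>E j\<close> changes
          the sum by \<open>f b\<close> times the \<open>i\<close>-th coordinate of the original
          sum, which is \<open>s * k i = 0\<close>. The summand \<open>j = i\<close> drops out
          because \<open>k i = 0\<close>.\<close>
        let ?E = "\<lambda>j b. f i \<otimes> E j b \<ominus> E j i \<otimes> f b"
        have sum: "s \<otimes> k b = (\<Oplus>j\<in>J - {i}. k j \<otimes> E j b)" for b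
          unfolding E(2) using psubset.hyps iJ Ec kc ki
          by (intro add.finprod_mono_neutral_cong_right) auto
        have "f i \<otimes> s \<otimes> k b = (\<Oplus>j\<in>J - {i}. k j \<otimes> ?E j b)" for b
        proof -
          have "(\<Oplus>j\<in>J - {i}. k j \<otimes> ?E j b)
              = (\<Oplus>j\<in>J - {i}. f i \<otimes> (k j \<otimes> E j b) \<oplus> \<ominus> f b \<otimes> (k j \<otimes> E j i))"
            using Ec kc fc by (intro finsum_cong') (auto simp: minus_eq r_distr r_minus l_minus m_ac)
          also have "\<dots> = (\<Oplus>j\<in>J - {i}. f i \<otimes> (k j \<otimes> E j b)) \<oplus> (\<Oplus>j\<in>J - {i}. \<ominus> f b \<otimes> (k j \<otimes> E j i))"
            using Ec kc fc by (intro finsum_addf) auto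
          also have "\<dots> = f i \<otimes> (s \<otimes> k b) \<oplus> \<ominus> f b \<otimes> (s \<otimes> k i)"
            unfolding sum using Ec kc fc psubset.hyps
            by (intro arg_cong2[where f = "(\<oplus>)"] finsum_rdistr[symmetric]) auto
          finally show ?thesis using s fc kc by (simp add: ki m_assoc)
        qed
        moreover have "?E j \<in> ?K" if "j \<in> J - {i}" for j
          using elim[OF E(1) Kcl fK Ec, of j] that by auto
        moreover have "f i \<otimes> s \<in> carrier R - I" using I_prime[of "f i" s] s f(2) fc by auto
        ultimately show ?thesis by (intro bexI[of _ "f i \<otimes> s"] exI[of _ ?E] conjI ballI allI)
      qed
    qed
    let ?k = "\<lambda>b. f i \<otimes> r b \<ominus> r i \<otimes> f b"
    have rc: "r b \<in> carrier R" for b using Kc[OF r] .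
    have "?k \<in> ?K" using elim[OF r Kcl fK rc] by auto
    from step[OF this] obtain s where s: "s \<in> carrier R" "s \<notin> I" "(\<lambda>b. s \<otimes> ?k b) \<in> L" by auto
    \<comment> \<open>The coefficient \<open>- (s * r i)\<close> restores the multiple of
      \<open>f\<close> removed in \<open>?k\<close> and leaves \<open>s * f i * r\<close>.\<close>
    have "(\<lambda>b. \<one> \<otimes> (s \<otimes> ?k b) \<ominus> (\<ominus> (s \<otimes> r i)) \<otimes> f b) \<in> L"
      by (rule comb_closedD[OF Lcl s(3) f(1)]) (use s rc in auto)
    moreover have "\<one> \<otimes> (s \<otimes> ?k b) \<ominus> (\<ominus> (s \<otimes> r i)) \<otimes> f b = s \<otimes> f i \<otimes> r b" for b
      using s(1) rc fc by (simp add: minus_eq r_distr l_minus r_minus m_assoc a_assoc l_neg)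
    moreover have "s \<otimes> f i \<in> carrier R - I" using I_prime[of s "f i"] s f(2) fc by auto
    ultimately show ?thesis by auto
  qed
qed

section \<open>Linear maps and tensor products\<close>

lemma (in abelian_group) minus_zero_right: "x \<in> carrier G \<Longrightarrow> x \<ominus> \<zero> = x"
  using minus_equality[of \<zero> \<zero>] by (simp add: minus_eq)

lemma (in abelian_group) minus_eq_zero_iff:
  assumes "x \<in> carrier G" "y \<in> carrier G"
  shows "x \<ominus> y = \<zero> \<longleftrightarrow> x = y"
proof
  assume "x \<ominus> y = \<zero>"
  then have "x \<ominus> y \<oplus> y = y" using assms by simp
  then show "x = y" using assms by (simp add: minus_eq a_assoc l_neg)
qed (use assms in \<open>simp add: minus_eq r_neg\<close>)

section \<open>Linear maps, their kernels, images and equalizers\<close>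

lemma lin_homD:
  assumes "f \<in> lin_hom R M N"
  shows "x \<in> carrier M \<Longrightarrow> f x \<in> carrier N"
    and "x \<in> carrier M \<Longrightarrow> y \<in> carrier M \<Longrightarrow> f (x \<oplus>\<^bsub>M\<^esub> y) = f x \<oplus>\<^bsub>N\<^esub> f y"
    and "r \<in> carrier R \<Longrightarrow> x \<in> carrier M \<Longrightarrow> f (r \<odot>\<^bsub>M\<^esub> x) = r \<odot>\<^bsub>N\<^esub> f x"
  using assms by (auto simp: lin_hom_def)

lemma lin_homI:
  assumes "\<And>x. x \<in> carrier M \<Longrightarrow> f x \<in> carrier N"
    and "\<And>x y. x \<in> carrier M \<Longrightarrow> y \<in> carrier M \<Longrightarrow> f (x \<oplus>\<^bsub>M\<^esub> y) = f x \<oplus>\<^bsub>N\<^esub> f y"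
    and "\<And>r x. r \<in> carrier R \<Longrightarrow> x \<in> carrier M \<Longrightarrow> f (r \<odot>\<^bsub>M\<^esub> x) = r \<odot>\<^bsub>N\<^esub> f x"
  shows "f \<in> lin_hom R M N"
  using assms by (auto simp: lin_hom_def)

lemma lin_hom_zero:
  assumes "module R M" "module R N" "f \<in> lin_hom R M N"
  shows "f \<zero>\<^bsub>M\<^esub> = \<zero>\<^bsub>N\<^esub>"
proof -
  interpret M: module R M by fact
  interpret N: module R N by fact
  show ?thesis
    using lin_homD(3)[OF assms(3), of "\<zero>\<^bsub>R\<^esub>" "\<zero>\<^bsub>M\<^esub>"] lin_homD(1)[OF assms(3), of "\<zero>\<^bsub>M\<^esub>"] by simp
qed

lemma lin_hom_add:
  assumes "module R N" "f \<in> lin_hom R M N" "g \<in> lin_hom R M N"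
  shows "(\<lambda>x. f x \<oplus>\<^bsub>N\<^esub> g x) \<in> lin_hom R M N"
proof -
  interpret N: module R N by fact
  show ?thesis
    by (rule lin_homI) (simp_all add: lin_homD[OF assms(2)] lin_homD[OF assms(3)] N.smult_r_distr N.M.a_ac)
qed

lemma lin_hom_diff:
  assumes "module R N" "f \<in> lin_hom R M N" "g \<in> lin_hom R M N"
  shows "(\<lambda>x. f x \<ominus>\<^bsub>N\<^esub> g x) \<in> lin_hom R M N"
proof -
  interpret N: module R N by fact
  show ?thesis
    by (rule lin_homI)
      (simp_all add: lin_homD[OF assms(2)] lin_homD[OF assms(3)] N.smult_r_distr N.smult_r_minus
        N.M.minus_add N.M.minus_eq N.M.a_ac)
qed

lemma submodule_finsum:
  assumes M: "module R M" and H: "submodule H R M" and f: "f \<in> A \<rightarrow> H"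
  shows "(\<Oplus>\<^bsub>M\<^esub>i\<in>A. f i) \<in> H"
proof -
  interpret M: module R M by fact
  note E = M.submoduleE[OF H]
  have z: "\<zero>\<^bsub>M\<^esub> \<in> H" using subgroup.one_closed[OF submodule.axioms(1)[OF H]] by simp
  show ?thesis using f
  proof (induction A rule: infinite_finite_induct)
    case (insert a A)
    then have "(\<Oplus>\<^bsub>M\<^esub>i\<in>insert a A. f i) = f a \<oplus>\<^bsub>M\<^esub> (\<Oplus>\<^bsub>M\<^esub>i\<in>A. f i)"
      using E(1) by (intro M.M.finsum_insert) auto
    then show ?case using insert E(5) by auto
  qed (simp_all add: z)
qed

lemma module_span_mono: "A \<subseteq> B \<Longrightarrow> module_span R M A \<subseteq> module_span R M B"
  by (auto simp: module_span_def)

lemma image_submodule: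
  assumes "module R M" "module R N" "h \<in> lin_hom R M N"
  shows "submodule (h ` carrier M) R N"
proof -
  interpret M: module R M by fact
  interpret N: module R N by fact
  note h = lin_homD[OF assms(3)]
  have neg: "\<ominus>\<^bsub>N\<^esub> h x = h (\<ominus>\<^bsub>M\<^esub> x)" if x: "x \<in> carrier M" for x
    using lin_hom_minus[OF assms, of "\<zero>\<^bsub>M\<^esub>" x] lin_hom_zero[OF assms] x h(1)[OF x]
    by (simp add: M.M.minus_eq N.M.minus_eq)
  show ?thesis
  proof (rule N.submoduleI)
    show "\<zero>\<^bsub>N\<^esub> \<in> h ` carrier M" using lin_hom_zero[OF assms] by (metis M.M.zero_closed imageI)
    fix a assume "a \<in> h ` carrier M"
    then obtain x where x: "x \<in> carrier M" "a = h x" by blast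
    show "\<ominus>\<^bsub>N\<^esub> a \<in> h ` carrier M" using x neg by auto
    fix b assume "b \<in> h ` carrier M"
    then obtain y where y: "y \<in> carrier M" "b = h y" by blast
    show "a \<oplus>\<^bsub>N\<^esub> b \<in> h ` carrier M" using x y h(2)[OF x(1) y(1)] by (metis M.M.a_closed imageI)
  next
    fix r a assume r: "r \<in> carrier R" and "a \<in> h ` carrier M"
    then obtain x where x: "x \<in> carrier M" "a = h x" by blast
    show "r \<odot>\<^bsub>N\<^esub> a \<in> h ` carrier M" using x r h(3)[OF r x(1)] by (metis M.smult_closed imageI)
  qed (use h(1) in auto)
qed

lemma equalizer_submodule:
  assumes M: "module R M" and N: "module R N" and f: "f \<in> lin_hom R M N" and g: "g \<in> lin_hom R M N"
  shows "submodule {x \<in> carrier M. f x = g x} R M"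
proof -
  interpret N: module R N by fact
  have "f x \<ominus>\<^bsub>N\<^esub> g x = \<zero>\<^bsub>N\<^esub> \<longleftrightarrow> f x = g x" if "x \<in> carrier M" for x
    using lin_homD(1)[OF f that] lin_homD(1)[OF g that] by (rule N.M.minus_eq_zero_iff)
  then have "{x \<in> carrier M. f x = g x} = {x \<in> carrier M. f x \<ominus>\<^bsub>N\<^esub> g x = \<zero>\<^bsub>N\<^esub>}" by blast
  then show ?thesis using kernel_submodule[OF M N lin_hom_diff[OF N f g]] by simp
qed

text \<open>\<open>N\<^sup>I\<close> as functions vanishing outside \<open>I\<close>, so that all operations are pointwise.\<close>

definition pow_module :: "('a, 'c, 'n) module_scheme \<Rightarrow> 'i set \<Rightarrow> ('a, 'i \<Rightarrow> 'c) module"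
  where "pow_module N I =
    \<lparr>carrier = {x. (\<forall>i. x i \<in> carrier N) \<and> (\<forall>i. i \<notin> I \<longrightarrow> x i = \<zero>\<^bsub>N\<^esub>)},
     mult = undefined, one = undefined, zero = (\<lambda>i. \<zero>\<^bsub>N\<^esub>), add = (\<lambda>x y i. x i \<oplus>\<^bsub>N\<^esub> y i),
     smult = (\<lambda>r x i. r \<odot>\<^bsub>N\<^esub> x i)\<rparr>"

lemma pow_module_simps:
  "x \<in> carrier (pow_module N I) \<longleftrightarrow> (\<forall>i. x i \<in> carrier N) \<and> (\<forall>i. i \<notin> I \<longrightarrow> x i = \<zero>\<^bsub>N\<^esub>)"
  "(x \<oplus>\<^bsub>pow_module N I\<^esub> y) i = x i \<oplus>\<^bsub>N\<^esub> y i"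
  "(r \<odot>\<^bsub>pow_module N I\<^esub> x) i = r \<odot>\<^bsub>N\<^esub> x i"
  "\<zero>\<^bsub>pow_module N I\<^esub> i = \<zero>\<^bsub>N\<^esub>"
  by (auto simp: pow_module_def)

lemma pow_module_module:
  assumes "module R N" shows "module R (pow_module N I)"
proof -
  interpret module R N by fact
  show ?thesis
  proof (rule moduleI[OF R.is_cring])
    show "abelian_group (pow_module N I)"
    proof (rule abelian_groupI)
      fix x assume "x \<in> carrier (pow_module N I)"
      then show "\<exists>y\<in>carrier (pow_module N I). y \<oplus>\<^bsub>pow_module N I\<^esub> x = \<zero>\<^bsub>pow_module N I\<^esub>"
        by (intro bexI[of _ "\<lambda>i. \<ominus>\<^bsub>N\<^esub> x i"]) (auto simp: pow_module_simps M.l_neg fun_eq_iff)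
    qed (auto simp: pow_module_simps M.a_ac fun_eq_iff)
  qed (auto simp: pow_module_simps smult_l_distr smult_r_distr smult_assoc1 fun_eq_iff)
qed

lemma pow_module_minus:
  assumes "module R N" "x \<in> carrier (pow_module N I)" "y \<in> carrier (pow_module N I)"
  shows "(x \<ominus>\<^bsub>pow_module N I\<^esub> y) i = x i \<ominus>\<^bsub>N\<^esub> y i"
proof -
  interpret module R N by fact
  have "(\<lambda>x. x i) \<in> lin_hom R (pow_module N I) N"
    by (rule lin_homI) (auto simp: pow_module_simps)
  then show ?thesis using lin_hom_minus[OF pow_module_module[OF assms(1)] assms(1) _ assms(2,3)] by blast
qed

section \<open>Finite free modules and matrices\<close>

lemma free_module_simps:
  "(x \<oplus>\<^bsub>free_module R I\<^esub> y) i = x i \<oplus>\<^bsub>R\<^esub> y i"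
  "(r \<odot>\<^bsub>free_module R I\<^esub> x) i = r \<otimes>\<^bsub>R\<^esub> x i"
  "\<zero>\<^bsub>free_module R I\<^esub> i = \<zero>\<^bsub>R\<^esub>"
  by (auto simp: free_module_def)

lemma free_module_finite_iff:
  assumes "finite I"
  shows "x \<in> carrier (free_module R I) \<longleftrightarrow> (\<forall>i. x i \<in> carrier R) \<and> (\<forall>i. i \<notin> I \<longrightarrow> x i = \<zero>\<^bsub>R\<^esub>)"
proof -
  have "finite {i. x i \<noteq> \<zero>\<^bsub>R\<^esub>}" if "\<forall>i. i \<notin> I \<longrightarrow> x i = \<zero>\<^bsub>R\<^esub>"
    by (rule finite_subset[OF _ assms]) (use that in auto)
  then show ?thesis by (auto simp: free_module_def)
qed

lemma free_module_minus:
  assumes "cring R" "x \<in> carrier (free_module R I)" "y \<in> carrier (free_module R I)"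
  shows "(x \<ominus>\<^bsub>free_module R I\<^esub> y) i = x i \<ominus>\<^bsub>R\<^esub> y i"
proof -
  interpret cring R by fact
  interpret F: module R "free_module R I" by (rule free_module_module[OF assms(1)])
  have y: "\<ominus>\<^bsub>free_module R I\<^esub> y \<in> carrier (free_module R I)" using assms(3) by simp
  have "(\<ominus>\<^bsub>free_module R I\<^esub> y \<oplus>\<^bsub>free_module R I\<^esub> y) i = \<zero>\<^bsub>R\<^esub>"
    using assms(3) by (simp add: F.M.l_neg free_module_simps)
  then have "(\<ominus>\<^bsub>free_module R I\<^esub> y) i = \<ominus>\<^bsub>R\<^esub> y i"
    using free_module_coeff[OF assms(3)] free_module_coeff[OF y]
    by (intro minus_equality[symmetric]) (auto simp: free_module_simps)
  then show ?thesis by (simp add: a_minus_def free_module_simps)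
qed

lemma free_extend_finite:
  assumes "module R N" "finite I" "u \<in> I \<rightarrow> carrier N" "x \<in> carrier (free_module R I)"
  shows "free_extend R N u x = (\<Oplus>\<^bsub>N\<^esub>i\<in>I. x i \<odot>\<^bsub>N\<^esub> u i)"
  using assms free_module_supp[OF assms(4)] by (intro free_extend_superset) auto

lemma lin_hom_free_finite:
  assumes "module R N" "g \<in> lin_hom R (free_module R I) N" "finite I" "x \<in> carrier (free_module R I)"
  shows "g x = (\<Oplus>\<^bsub>N\<^esub>i\<in>I. x i \<odot>\<^bsub>N\<^esub> g (free_gen R i))"
proof -
  have "cring R" using assms(1) by (simp add: module_def)
  then have "(\<lambda>i. g (free_gen R i)) \<in> I \<rightarrow> carrier N"
    by (intro Pi_I lin_homD(1)[OF assms(2)] free_gen_in)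
  from free_extend_finite[OF assms(1,3) this assms(4)] show ?thesis
    unfolding lin_hom_free_eq[OF assms(1,2,4)] .
qed

lemma lin_hom_free_eqI:
  assumes "module R N" "f \<in> lin_hom R (free_module R I) N" "g \<in> lin_hom R (free_module R I) N"
    and "finite I" "x \<in> carrier (free_module R I)"
    and "\<And>i. i \<in> I \<Longrightarrow> f (free_gen R i) = g (free_gen R i)"
  shows "f x = g x"
proof -
  interpret module R N by fact
  have "g (free_gen R i) \<in> carrier N" if "i \<in> I" for i
    by (intro lin_homD(1)[OF assms(3)] free_gen_in[OF R.is_cring that])
  then show ?thesis
    unfolding lin_hom_free_finite[OF assms(1,2,4,5)] lin_hom_free_finite[OF assms(1,3,4,5)]
    using assms(6) free_module_coeff[OF assms(5)] by (intro M.finsum_cong') auto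
qed

lemma lin_hom_free_matrix:
  assumes "cring R" "T \<in> lin_hom R (free_module R I) (free_module R J)" "finite I"
    "x \<in> carrier (free_module R I)"
  shows "T x j = (\<Oplus>\<^bsub>R\<^esub>i\<in>I. x i \<otimes>\<^bsub>R\<^esub> T (free_gen R i) j)"
proof -
  interpret cring R by fact
  \<comment> \<open>\<open>R\<close> as a module over itself: a coordinate becomes a linear map, to
    which the expansion along the basis applies.\<close>
  let ?R = "algebra_module R (\<lambda>x. x)"
  have R: "module R ?R" by (rule algebra_module_module) (auto simp: assms(1) ring_hom_def)
  interpret R: module R ?R by fact
  have c: "carrier ?R = carrier R" by (simp add: algebra_module_def)
  have "(\<lambda>x. x j) \<in> lin_hom R (free_module R J) ?R"
    by (rule lin_homI) (auto simp: free_module_simps algebra_module_def free_module_coeff)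
  from lin_hom_free_finite[OF R lin_hom_comp[OF assms(2) this] assms(3,4)]
  have "T x j = (\<Oplus>\<^bsub>?R\<^esub>i\<in>I. x i \<odot>\<^bsub>?R\<^esub> T (free_gen R i) j)" .
  also have "\<dots> = (\<Oplus>\<^bsub>R\<^esub>i\<in>I. x i \<otimes>\<^bsub>R\<^esub> T (free_gen R i) j)"
    by (simp add: finsum_def finprod_def algebra_module_def)
  finally show ?thesis .
qed

section \<open>Maps out of tensor products\<close>

text \<open>\<open>tensor_lift\<close> stops at the free module, where the extension of
  \<open>b\<close> kills \<open>tensor_ker\<close>. Testing whether a tensor vanishes and building
  sections require the induced map on the quotient.\<close>

lemma tensor_universal:
  assumes M: "module R M" and N: "module R N" and L: "module R L"
    and b: "\<And>x y. x \<in> carrier M \<Longrightarrow> y \<in> carrier N \<Longrightarrow> b x y \<in> carrier L"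
      "\<And>x x' y. x \<in> carrier M \<Longrightarrow> x' \<in> carrier M \<Longrightarrow> y \<in> carrier N \<Longrightarrow>
        b (x \<oplus>\<^bsub>M\<^esub> x') y = b x y \<oplus>\<^bsub>L\<^esub> b x' y"
      "\<And>x y y'. x \<in> carrier M \<Longrightarrow> y \<in> carrier N \<Longrightarrow> y' \<in> carrier N \<Longrightarrow>
        b x (y \<oplus>\<^bsub>N\<^esub> y') = b x y \<oplus>\<^bsub>L\<^esub> b x y'"
      "\<And>r x y. r \<in> carrier R \<Longrightarrow> x \<in> carrier M \<Longrightarrow> y \<in> carrier N \<Longrightarrow> b (r \<odot>\<^bsub>M\<^esub> x) y = r \<odot>\<^bsub>L\<^esub> b x y"
      "\<And>r x y. r \<in> carrier R \<Longrightarrow> x \<in> carrier M \<Longrightarrow> y \<in> carrier N \<Longrightarrow> b x (r \<odot>\<^bsub>N\<^esub> y) = r \<odot>\<^bsub>L\<^esub> b x y"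
  shows "\<exists>h\<in>lin_hom R (tensor R M N) L. \<forall>x\<in>carrier M. \<forall>y\<in>carrier N. h (tensor_elem R M N x y) = b x y"
proof -
  let ?F = "free_module R (carrier M \<times> carrier N)"
  let ?K = "tensor_ker R M N"
  interpret L: module R L by fact
  interpret Q: module_quot R ?F ?K by (rule tensor_module_quot[OF M N])
  have bPi: "case_prod b \<in> carrier M \<times> carrier N \<rightarrow> carrier L" using b(1) by auto
  let ?f = "free_extend R L (case_prod b)"
  have f: "?f \<in> lin_hom R ?F L" by (rule free_extend_linear[OF L bPi])
  note fD = lin_homD[OF f]
  \<comment> \<open>The value is taken at a chosen representative of the coset. Two representatives
    differ by an element of \<open>tensor_ker\<close>, which \<open>?f\<close> sends to
    zero.\<close>
  define h where "h C = ?f (SOME z. z \<in> carrier ?F \<and> C = ?K +>\<^bsub>?F\<^esub> z)" for C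
  have h: "h (?K +>\<^bsub>?F\<^esub> z) = ?f z" if z: "z \<in> carrier ?F" for z
  proof -
    define w where "w = (SOME w. w \<in> carrier ?F \<and> ?K +>\<^bsub>?F\<^esub> z = ?K +>\<^bsub>?F\<^esub> w)"
    have w: "w \<in> carrier ?F \<and> ?K +>\<^bsub>?F\<^esub> z = ?K +>\<^bsub>?F\<^esub> w"
      unfolding w_def by (rule someI[of _ z]) (use z in simp)
    then have "z \<ominus>\<^bsub>?F\<^esub> w \<in> ?K" using z Q.coset_eq_iff by blast
    then have "?f (z \<ominus>\<^bsub>?F\<^esub> w) = \<zero>\<^bsub>L\<^esub>" using tensor_lift[OF M N L b] by blast
    then have "?f z \<ominus>\<^bsub>L\<^esub> ?f w = \<zero>\<^bsub>L\<^esub>"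
      using lin_hom_minus[OF Q.module_axioms L f z] w by simp
    then have "?f z = ?f w" using L.M.minus_eq_zero_iff fD(1) z w by blast
    then show ?thesis unfolding h_def w_def by simp
  qed
  show ?thesis
  proof (intro bexI ballI)
    show "h \<in> lin_hom R (tensor R M N) L" unfolding tensor_def
      by (rule lin_homI) (auto simp: Q.quot_carrier Q.quot_add Q.quot_smult h fD)
    fix x y assume xy: "x \<in> carrier M" "y \<in> carrier N"
    then have "free_gen R (x, y) \<in> carrier ?F" by (intro free_gen_in[OF L.R.is_cring]) auto
    then show "h (tensor_elem R M N x y) = b x y"
      using h free_extend_gen[OF L bPi, of "(x, y)"] xy by (simp add: tensor_elem_def)
  qed
qed

text \<open>Induction on tensors in the language of submodules; it reduces surjectivity onto a
  tensor product to pure tensors.\<close>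

lemma tensor_subset_submodule:
  assumes M: "module R M" and N: "module R N" and H: "submodule H R (tensor R M N)"
    and e: "\<And>x y. x \<in> carrier M \<Longrightarrow> y \<in> carrier N \<Longrightarrow> tensor_elem R M N x y \<in> H"
  shows "carrier (tensor R M N) \<subseteq> H"
proof
  fix C assume C: "C \<in> carrier (tensor R M N)"
  let ?T = "tensor R M N"
  have T: "module R ?T" by (rule tensor_module[OF M N])
  interpret module_quot R ?T H using T H by (simp add: module_quot_def module_quot_axioms_def)
  let ?Q = "quot_module R ?T H"
  interpret Q: module R ?Q by (rule quot_module_module)
  have mem: "H +>\<^bsub>?T\<^esub> D = H +>\<^bsub>?T\<^esub> \<zero>\<^bsub>?T\<^esub> \<longleftrightarrow> D \<in> H" if "D \<in> carrier ?T" for D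
    using that coset_eq_iff[of D "\<zero>\<^bsub>?T\<^esub>"] by (simp add: M.minus_zero_right)
  \<comment> \<open>The quotient map by \<open>H\<close> agrees with the zero map on elementary tensors.\<close>
  have "H +>\<^bsub>?T\<^esub> C = \<zero>\<^bsub>?Q\<^esub>"
  proof (rule tensor_hom_eqI[OF M N Q.module_axioms _ _ _ C])
    show "(\<lambda>D. H +>\<^bsub>?T\<^esub> D) \<in> lin_hom R ?T ?Q"
      by (rule lin_homI) (auto simp: quot_carrier quot_add quot_smult)
    show "(\<lambda>D. \<zero>\<^bsub>?Q\<^esub>) \<in> lin_hom R ?T ?Q" by (rule lin_homI) auto
    fix x y assume "x \<in> carrier M" "y \<in> carrier N"
    then show "H +>\<^bsub>?T\<^esub> tensor_elem R M N x y = \<zero>\<^bsub>?Q\<^esub>"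
      using e mem tensor_elem_bilinear(1)[OF M N] by (simp add: quot_zero)
  qed
  then show "C \<in> H" using mem[OF C] by (simp add: quot_zero)
qed

section \<open>Relations of a flat module\<close>

locale generated_module = module R M
  for R :: "('a, 'r) ring_scheme" (structure) and M :: "('a, 'b, 'm) module_scheme" (structure) +
  fixes A :: "'b set"
  assumes finite_gens: "finite A" and gens_carrier: "A \<subseteq> carrier M"
    and span_gens: "module_span R M A = carrier M"
begin

abbreviation V where "V \<equiv> free_module R A"

abbreviation combine where "combine \<equiv> free_extend R M (\<lambda>a. a)"

definition relations where "relations = {r \<in> carrier V. combine r = \<zero>\<^bsub>M\<^esub>}"

sublocale V: module R V by (rule free_module_module[OF R.is_cring])

lemma gens_Pi: "(\<lambda>a. a) \<in> A \<rightarrow> carrier M" using gens_carrier by auto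

lemma combine_hom: "combine \<in> lin_hom R V M"
  by (rule free_extend_linear[OF module_axioms gens_Pi])

lemmas combine_simps = lin_homD[OF combine_hom]

lemma combine_gen: "a \<in> A \<Longrightarrow> combine (free_gen R a) = a"
  by (rule free_extend_gen[OF module_axioms gens_Pi])

lemma combine_surj: "combine ` carrier V = carrier M"
proof
  show "combine ` carrier V \<subseteq> carrier M" using combine_simps(1) by auto
  have "a \<in> combine ` carrier V" if "a \<in> A" for a
    using combine_gen[OF that] free_gen_in[OF R.is_cring that] by (metis imageI)
  then have "module_span R M A \<subseteq> combine ` carrier V"
    by (intro module_span_minimal image_submodule[OF V.module_axioms module_axioms combine_hom]) auto
  then show "carrier M \<subseteq> combine ` carrier V" by (simp add: span_gens)
qed

lemma relations_submodule: "submodule relations R V"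
  unfolding relations_def by (rule kernel_submodule[OF V.module_axioms module_axioms combine_hom])

lemma relations_carrier: "r \<in> relations \<Longrightarrow> r \<in> carrier V"
  and relations_combine: "r \<in> relations \<Longrightarrow> combine r = \<zero>\<^bsub>M\<^esub>"
  by (auto simp: relations_def)

lemma diff_in_relations:
  assumes "c \<in> carrier V" "d \<in> carrier V" "combine c = combine d"
  shows "c \<ominus>\<^bsub>V\<^esub> d \<in> relations"
  using assms lin_hom_minus[OF V.module_axioms module_axioms combine_hom assms(1,2)]
  by (simp add: relations_def M.minus_eq_zero_iff combine_simps)

text \<open>An arbitrary choice, in general not additive. Two choices for the same element differ by
  a relation, so a map defined through \<open>coords\<close> becomes bilinear once it ignores
  relations.\<close>

definition coords where "coords x = (SOME d. d \<in> carrier V \<and> combine d = x)"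

lemma coords:
  assumes "x \<in> carrier M" shows "coords x \<in> carrier V \<and> combine (coords x) = x"
proof -
  have "x \<in> combine ` carrier V" using assms by (simp add: combine_surj)
  then have "\<exists>d. d \<in> carrier V \<and> combine d = x" by auto
  then show ?thesis unfolding coords_def by (rule someI_ex)
qed

text \<open>The map \<open>x \<otimes> y \<mapsto> coords x \<cdot> y\<close> is well defined as soon as all multiples of relations
  are divided out of \<open>N\<^sup>A\<close>. The finite \<open>F\<close> comes from writing that submodule as a directed union.\<close>

lemma tensor_zeroE:
  fixes N :: "('a, 'c, 'n) module_scheme"
  assumes N: "module R N" and n: "n \<in> carrier (pow_module N A)"
    and zero: "(\<Oplus>\<^bsub>tensor R M N\<^esub>a\<in>A. tensor_elem R M N a (n a)) = \<zero>\<^bsub>tensor R M N\<^esub>"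
  obtains F where "finite F" "F \<subseteq> relations"
    "n \<in> module_span R (pow_module N A) {\<lambda>b. l b \<odot>\<^bsub>N\<^esub> y | l y. l \<in> F \<and> y \<in> carrier N}"
proof -
  interpret N: module R N by fact
  let ?P = "pow_module N A"
  interpret P: module R ?P by (rule pow_module_module[OF N])
  define G :: "('b \<Rightarrow> 'a) set \<Rightarrow> ('b \<Rightarrow> 'c) set" where "G F = {\<lambda>b. l b \<odot>\<^bsub>N\<^esub> y | l y. l \<in> F \<and> y \<in> carrier N}" for F
  define X where "X = {F. finite F \<and> F \<subseteq> relations}"
  let ?S = "\<lambda>F. module_span R ?P (G F)"
  \<comment> \<open>The union is directed, since two finite sets of relations lie in their union;
    this makes \<open>U\<close> a submodule while each of its elements still involves only finitely
    many relations.\<close>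
  define U where "U = (\<Union>F\<in>X. ?S F)"
  have mulP: "(\<lambda>b. d b \<odot>\<^bsub>N\<^esub> y) \<in> carrier ?P" if "d \<in> carrier V" "y \<in> carrier N" for d y
    using that free_module_coeff[of d] free_module_supp[of d R A] by (auto simp: pow_module_simps) force
  have GP: "G F \<subseteq> carrier ?P" if "F \<in> X" for F
    using that mulP relations_carrier by (auto simp: G_def X_def)
  have S: "submodule (?S F) R ?P" "G F \<subseteq> ?S F" if "F \<in> X" for F
    using module_span_submodule[OF P.module_axioms GP[OF that]] by auto
  note SE = P.submoduleE[OF S(1)]
  have UI: "u \<in> U" if "F \<in> X" "u \<in> ?S F" for u F using that by (auto simp: U_def)
  have U: "submodule U R ?P"
  proof (rule P.submoduleI)
    show "U \<subseteq> carrier ?P" using SE(1) by (auto simp: U_def)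
    have "{} \<in> X" by (simp add: X_def)
    moreover have "\<zero>\<^bsub>?P\<^esub> \<in> ?S {}" using submodule_finsum[OF P.module_axioms S(1)[OF \<open>{} \<in> X\<close>], of undefined "{}"] by simp
    ultimately show "\<zero>\<^bsub>?P\<^esub> \<in> U" by (rule UI)
    fix u assume "u \<in> U"
    then obtain F where F: "F \<in> X" "u \<in> ?S F" by (auto simp: U_def)
    show "\<ominus>\<^bsub>?P\<^esub> u \<in> U" by (rule UI[OF F(1) SE(3)[OF F]])
    show "r \<odot>\<^bsub>?P\<^esub> u \<in> U" if "r \<in> carrier R" for r by (rule UI[OF F(1) SE(4)[OF F(1) that F(2)]])
    fix v assume "v \<in> U"
    then obtain F' where F': "F' \<in> X" "v \<in> ?S F'" by (auto simp: U_def)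
    have FF: "F \<union> F' \<in> X" using F F' by (auto simp: X_def)
    have "u \<in> ?S (F \<union> F')" "v \<in> ?S (F \<union> F')"
      using module_span_mono[of "G F" "G (F \<union> F')" R ?P] module_span_mono[of "G F'" "G (F \<union> F')" R ?P] F F'
      by (auto simp: G_def)
    then show "u \<oplus>\<^bsub>?P\<^esub> v \<in> U" by (rule UI[OF FF SE(5)[OF FF]])
  qed
  interpret Q: module_quot R ?P U
    using P.module_axioms U by (simp add: module_quot_def module_quot_axioms_def)
  let ?Q = "quot_module R ?P U"
  interpret Q': module R ?Q by (rule Q.quot_module_module)
  define \<beta> where "\<beta> d y = U +>\<^bsub>?P\<^esub> (\<lambda>b. d b \<odot>\<^bsub>N\<^esub> y)" for d y
  have eq: "\<beta> c y = \<beta> d y" if cd: "c \<in> carrier V" "d \<in> carrier V" "combine c = combine d" and y: "y \<in> carrier N" for c d y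
  proof -
    let ?l = "c \<ominus>\<^bsub>V\<^esub> d"
    have l: "?l \<in> relations" by (rule diff_in_relations[OF cd])
    \<comment> \<open>The two vectors differ by \<open>y\<close> times the single relation
      \<open>c - d\<close>, so a one-element set of relations suffices.\<close>
    have "(\<lambda>b. c b \<odot>\<^bsub>N\<^esub> y) \<ominus>\<^bsub>?P\<^esub> (\<lambda>b. d b \<odot>\<^bsub>N\<^esub> y) = (\<lambda>b. ?l b \<odot>\<^bsub>N\<^esub> y)"
      using mulP cd y free_module_coeff[OF cd(1)] free_module_coeff[OF cd(2)]
      by (intro ext) (simp add: pow_module_minus[OF N] free_module_minus[OF R.is_cring]
          R.minus_eq N.M.minus_eq N.smult_l_distr N.smult_l_minus)
    also have "\<dots> \<in> ?S {?l}" using S(2)[of "{?l}"] l y by (auto simp: X_def G_def)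
    finally have "(\<lambda>b. c b \<odot>\<^bsub>N\<^esub> y) \<ominus>\<^bsub>?P\<^esub> (\<lambda>b. d b \<odot>\<^bsub>N\<^esub> y) \<in> U"
      using l by (intro UI[of "{?l}"]) (auto simp: X_def)
    then show ?thesis unfolding \<beta>_def using Q.coset_eq_iff mulP cd y by blast
  qed
  have \<beta>c: "\<beta> d y \<in> carrier ?Q" if "d \<in> carrier V" "y \<in> carrier N" for d y
    using mulP[OF that] by (simp add: \<beta>_def Q.quot_carrier)
  have \<beta>add1: "\<beta> (c \<oplus>\<^bsub>V\<^esub> d) y = \<beta> c y \<oplus>\<^bsub>?Q\<^esub> \<beta> d y"
    if cd: "c \<in> carrier V" "d \<in> carrier V" and y: "y \<in> carrier N" for c d y
    unfolding \<beta>_def Q.quot_add[OF mulP[OF cd(1) y] mulP[OF cd(2) y]]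
    by (rule arg_cong[where f = "\<lambda>z. U +>\<^bsub>?P\<^esub> z"])
      (use free_module_coeff[OF cd(1)] free_module_coeff[OF cd(2)] y
        in \<open>auto simp: pow_module_simps free_module_simps N.smult_l_distr\<close>)
  have \<beta>add2: "\<beta> d (y \<oplus>\<^bsub>N\<^esub> y') = \<beta> d y \<oplus>\<^bsub>?Q\<^esub> \<beta> d y'"
    if d: "d \<in> carrier V" and y: "y \<in> carrier N" "y' \<in> carrier N" for d y y'
    unfolding \<beta>_def Q.quot_add[OF mulP[OF d y(1)] mulP[OF d y(2)]]
    by (rule arg_cong[where f = "\<lambda>z. U +>\<^bsub>?P\<^esub> z"])
      (use free_module_coeff[OF d] y in \<open>auto simp: pow_module_simps N.smult_r_distr\<close>)
  have \<beta>smult: "\<beta> (r \<odot>\<^bsub>V\<^esub> d) y = r \<odot>\<^bsub>?Q\<^esub> \<beta> d y" "\<beta> d (r \<odot>\<^bsub>N\<^esub> y) = r \<odot>\<^bsub>?Q\<^esub> \<beta> d y"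
    if r: "r \<in> carrier R" and d: "d \<in> carrier V" and y: "y \<in> carrier N" for r d y
  proof -
    have "(\<lambda>b. (r \<odot>\<^bsub>V\<^esub> d) b \<odot>\<^bsub>N\<^esub> y) = r \<odot>\<^bsub>?P\<^esub> (\<lambda>b. d b \<odot>\<^bsub>N\<^esub> y)"
      "(\<lambda>b. d b \<odot>\<^bsub>N\<^esub> (r \<odot>\<^bsub>N\<^esub> y)) = r \<odot>\<^bsub>?P\<^esub> (\<lambda>b. d b \<odot>\<^bsub>N\<^esub> y)"
      using free_module_coeff[OF d] r y
      by (auto simp: fun_eq_iff pow_module_simps free_module_simps N.smult_assoc1[symmetric] R.m_comm)
    then show "\<beta> (r \<odot>\<^bsub>V\<^esub> d) y = r \<odot>\<^bsub>?Q\<^esub> \<beta> d y" "\<beta> d (r \<odot>\<^bsub>N\<^esub> y) = r \<odot>\<^bsub>?Q\<^esub> \<beta> d y"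
      unfolding \<beta>_def Q.quot_smult[OF r mulP[OF d y]] by simp_all
  qed
  have "\<exists>h\<in>lin_hom R (tensor R M N) ?Q. \<forall>x\<in>carrier M. \<forall>y\<in>carrier N.
      h (tensor_elem R M N x y) = \<beta> (coords x) y"
  proof (rule tensor_universal[OF module_axioms N Q'.module_axioms])
    fix x x' y assume x: "x \<in> carrier M" "x' \<in> carrier M" "y \<in> carrier N"
    have "\<beta> (coords (x \<oplus>\<^bsub>M\<^esub> x')) y = \<beta> (coords x \<oplus>\<^bsub>V\<^esub> coords x') y"
      using x coords[of x] coords[of x'] coords[of "x \<oplus>\<^bsub>M\<^esub> x'"] by (intro eq) (auto simp: combine_simps)
    then show "\<beta> (coords (x \<oplus>\<^bsub>M\<^esub> x')) y = \<beta> (coords x) y \<oplus>\<^bsub>?Q\<^esub> \<beta> (coords x') y"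
      using \<beta>add1 x coords by simp
  next
    fix r x y assume x: "r \<in> carrier R" "x \<in> carrier M" "y \<in> carrier N"
    have "\<beta> (coords (r \<odot>\<^bsub>M\<^esub> x)) y = \<beta> (r \<odot>\<^bsub>V\<^esub> coords x) y"
      using x coords[of x] coords[of "r \<odot>\<^bsub>M\<^esub> x"] by (intro eq) (auto simp: combine_simps)
    then show "\<beta> (coords (r \<odot>\<^bsub>M\<^esub> x)) y = r \<odot>\<^bsub>?Q\<^esub> \<beta> (coords x) y"
      using \<beta>smult(1) x coords by simp
  qed (use \<beta>c \<beta>add2 \<beta>smult(2) coords in auto)
  then obtain h where h: "h \<in> lin_hom R (tensor R M N) ?Q"
    "\<And>x y. x \<in> carrier M \<Longrightarrow> y \<in> carrier N \<Longrightarrow> h (tensor_elem R M N x y) = \<beta> (coords x) y" by blast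
  have T: "module R (tensor R M N)" by (rule tensor_module[OF module_axioms N])
  have nN: "n b \<in> carrier N" for b using n by (simp add: pow_module_simps)
  have gV: "free_gen R a \<in> carrier V" if "a \<in> A" for a by (rule free_gen_in[OF R.is_cring that])
  have tA: "tensor_elem R M N a (n a) \<in> carrier (tensor R M N)" if "a \<in> A" for a
    using tensor_elem_bilinear(1)[OF module_axioms N] gens_carrier that nN by blast
  let ?e = "\<lambda>a b. free_gen R a b \<odot>\<^bsub>N\<^esub> n a"
  have eP: "?e \<in> A \<rightarrow> carrier ?P" using mulP gV nN by blast
  have "\<zero>\<^bsub>?Q\<^esub> = h (\<Oplus>\<^bsub>tensor R M N\<^esub>a\<in>A. tensor_elem R M N a (n a))"
    using lin_hom_zero[OF T Q'.module_axioms h(1)] zero by simp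
  also have "\<dots> = (\<Oplus>\<^bsub>?Q\<^esub>a\<in>A. h (tensor_elem R M N a (n a)))"
    using tA by (intro lin_hom_finsum[OF T Q'.module_axioms h(1) finite_gens]) auto
  also have "\<dots> = (\<Oplus>\<^bsub>?Q\<^esub>a\<in>A. U +>\<^bsub>?P\<^esub> ?e a)"
  proof (rule Q'.M.finsum_cong')
    show "(\<lambda>a. U +>\<^bsub>?P\<^esub> ?e a) \<in> A \<rightarrow> carrier ?Q" using eP by (auto simp: Q.quot_carrier)
    fix a assume a: "a \<in> A"
    have "h (tensor_elem R M N a (n a)) = \<beta> (coords a) (n a)" using a gens_carrier nN by (intro h(2)) auto
    \<comment> \<open>\<open>coords a\<close> need not be the basis vector at \<open>a\<close>, but
      both combine to \<open>a\<close>. With basis vectors the sum over \<open>A\<close> becomes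
      \<open>n\<close> itself, so \<open>h\<close> sends the given tensor to the class of
      \<open>n\<close>.\<close>
    also have "\<dots> = \<beta> (free_gen R a) (n a)"
      using a coords[of a] gens_carrier nN gV by (intro eq) (auto simp: combine_gen)
    finally show "h (tensor_elem R M N a (n a)) = U +>\<^bsub>?P\<^esub> ?e a" by (simp add: \<beta>_def)
  qed simp
  also have "\<dots> = U +>\<^bsub>?P\<^esub> (\<Oplus>\<^bsub>?P\<^esub>a\<in>A. ?e a)"
  proof (rule lin_hom_finsum[OF P.module_axioms Q'.module_axioms _ finite_gens eP, symmetric])
    show "(\<lambda>u. U +>\<^bsub>?P\<^esub> u) \<in> lin_hom R ?P ?Q"
      by (rule lin_homI) (auto simp: Q.quot_carrier Q.quot_add Q.quot_smult)
  qed
  also have "(\<Oplus>\<^bsub>?P\<^esub>a\<in>A. ?e a) = n"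
  proof
    fix b
    have "(\<lambda>u. u b) \<in> lin_hom R ?P N" by (rule lin_homI) (auto simp: pow_module_simps)
    from lin_hom_finsum[OF P.module_axioms N this finite_gens eP]
    have "(\<Oplus>\<^bsub>?P\<^esub>a\<in>A. ?e a) b = (\<Oplus>\<^bsub>N\<^esub>a\<in>A. ?e a b)" .
    also have "\<dots> = (\<Oplus>\<^bsub>N\<^esub>a\<in>A. if b = a then n a else \<zero>\<^bsub>N\<^esub>)"
      using nN by (intro N.M.finsum_cong') (auto simp: free_gen_def)
    also have "\<dots> = n b"
    proof (cases "b \<in> A")
      case True
      then show ?thesis using nN finite_gens by (intro N.M.finsum_singleton) auto
    next
      case False
      then have "(\<Oplus>\<^bsub>N\<^esub>a\<in>A. if b = a then n a else \<zero>\<^bsub>N\<^esub>) = (\<Oplus>\<^bsub>N\<^esub>a\<in>A. \<zero>\<^bsub>N\<^esub>)"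
        by (intro N.M.finsum_cong') auto
      then show ?thesis using False n by (simp add: pow_module_simps)
    qed
    finally show "(\<Oplus>\<^bsub>?P\<^esub>a\<in>A. ?e a) b = n b" .
  qed
  finally have "n \<in> U"
    using Q.coset_eq_iff[of n "\<zero>\<^bsub>?P\<^esub>"] n by (simp add: Q.quot_zero P.M.minus_zero_right)
  then show ?thesis using that by (auto simp: U_def X_def G_def)
qed

lemma sum_tensor_gens:
  assumes N: "module R N" and d: "d \<in> carrier V" and y: "y \<in> carrier N"
  shows "(\<Oplus>\<^bsub>tensor R M N\<^esub>a\<in>A. tensor_elem R M N a (d a \<odot>\<^bsub>N\<^esub> y)) = tensor_elem R M N (combine d) y"
proof -
  let ?T = "tensor R M N"
  note bil = tensor_elem_bilinear[OF module_axioms N]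
  have T: "module R ?T" by (rule tensor_module[OF module_axioms N])
  interpret T: module R ?T by fact
  have dR: "d a \<in> carrier R" for a by (rule free_module_coeff[OF d])
  have "(\<lambda>x. tensor_elem R M N x y) \<in> lin_hom R M ?T"
    by (rule lin_homI) (use y in \<open>auto simp: bil\<close>)
  from lin_hom_free_finite[OF T lin_hom_comp[OF combine_hom this] finite_gens d]
  have "tensor_elem R M N (combine d) y
      = (\<Oplus>\<^bsub>?T\<^esub>a\<in>A. d a \<odot>\<^bsub>?T\<^esub> tensor_elem R M N (combine (free_gen R a)) y)" .
  also have "\<dots> = (\<Oplus>\<^bsub>?T\<^esub>a\<in>A. tensor_elem R M N a (d a \<odot>\<^bsub>N\<^esub> y))"
    using gens_carrier dR y by (intro T.M.finsum_cong') (auto simp: combine_gen bil subset_iff)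
  finally show ?thesis ..
qed

section \<open>The equational criterion for flatness\<close>

text \<open>Maps into the kernel are kept as endomorphisms of \<open>V\<close>, so that they
  compose, have square matrices and can be carried to \<open>S\<close> entry by entry.\<close>

definition relation_maps where
  "relation_maps = {E \<in> lin_hom R V V. \<forall>v\<in>carrier V. E v \<in> relations}"

lemma zero_relation_map: "(\<lambda>v. \<zero>\<^bsub>V\<^esub>) \<in> relation_maps"
  using submodule_finsum[OF V.module_axioms relations_submodule, of undefined "{}"]
  by (auto simp: relation_maps_def intro!: lin_homI)

text \<open>This is the equational criterion for the relation \<open>r\<close>: the tensor \<open>\<Sum>\<^sub>a a \<otimes> r\<^sub>a\<close> vanishes already
  over the ideal generated by the entries of \<open>r\<close>.\<close>

lemma flat_relation_map:
  assumes flat: "flat R M" and r: "r \<in> relations"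
  shows "\<exists>E\<in>relation_maps. E r = r"
proof -
  let ?R = "algebra_module R (\<lambda>x. x)"
  have Rm: "module R ?R" by (rule algebra_module_module) (auto simp: R.is_cring ring_hom_def)
  interpret Rm: module R ?R by fact
  have rV: "r \<in> carrier V" by (rule relations_carrier[OF r])
  have rR: "r a \<in> carrier R" for a by (rule free_module_coeff[OF rV])
  have Rs: "carrier ?R = carrier R" "\<And>x y. x \<oplus>\<^bsub>?R\<^esub> y = x \<oplus> y" "\<And>x y. x \<odot>\<^bsub>?R\<^esub> y = x \<otimes> y"
    "\<zero>\<^bsub>?R\<^esub> = \<zero>" by (auto simp: algebra_module_def)
  have rPi: "r \<in> A \<rightarrow> carrier ?R" using rR by (auto simp: Rs)
  let ?\<psi> = "free_extend R ?R r"
  have \<psi>: "?\<psi> \<in> lin_hom R V ?R" by (rule free_extend_linear[OF Rm rPi])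
  \<comment> \<open>The ideal generated by the entries of \<open>r\<close>. As a submodule of
    \<open>R\<close> it is one of the test modules of \<open>flat\<close>.\<close>
  define J where "J = ?\<psi> ` carrier V"
  have Jsub: "submodule J R ?R" unfolding J_def by (rule image_submodule[OF V.module_axioms Rm \<psi>])
  have Jc: "J \<subseteq> carrier R" using Rm.submoduleE(1)[OF Jsub] by (simp add: Rs)
  let ?J = "?R\<lparr>carrier := J\<rparr>"
  have Jm: "module R ?J" by (rule submodule.submodule_is_module[OF Jsub Rm])
  interpret Jm: module R ?J by fact
  have rJ: "r a \<in> J" for a
  proof (cases "a \<in> A")
    case True
    then show ?thesis
      using free_extend_gen[OF Rm rPi True] free_gen_in[OF R.is_cring True] by (auto simp: J_def intro: rev_image_eqI)
  next
    case False
    then have "r a = \<zero>" using free_module_supp[OF rV] by blast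
    then show ?thesis using Jm.M.zero_closed by (simp add: Rs)
  qed
  have rP: "r \<in> carrier (pow_module ?J A)"
    using rJ free_module_supp[OF rV] by (auto simp: pow_module_simps Rs)
  let ?TJ = "tensor R M ?J" and ?TR = "tensor R M ?R"
  have TJ: "module R ?TJ" by (rule tensor_module[OF module_axioms Jm])
  have TR: "module R ?TR" by (rule tensor_module[OF module_axioms Rm])
  interpret TJ: module R ?TJ by fact
  interpret TR: module R ?TR by fact
  have id: "(\<lambda>x. x) \<in> lin_hom R M M" by (auto simp: lin_hom_def)
  have inc: "(\<lambda>x. x) \<in> lin_hom R ?J ?R" using Jc by (auto simp: lin_hom_def Rs)
  let ?m = "tensor_map R M ?R (\<lambda>x. x) (\<lambda>x. x)"
  have inj: "inj_on ?m (carrier ?TJ)"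
    using flat[unfolded flat_def, THEN conjunct2, rule_format, OF Jm Rm inc] by simp
  have m: "?m \<in> lin_hom R ?TJ ?TR" by (rule tensor_map_linear(1)[OF module_axioms Jm module_axioms Rm id inc])
  let ?X = "\<Oplus>\<^bsub>?TJ\<^esub>a\<in>A. tensor_elem R M ?J a (r a)"
  have tJ: "tensor_elem R M ?J a (r a) \<in> carrier ?TJ" if "a \<in> A" for a
    using that gens_carrier rJ by (intro tensor_elem_bilinear(1)[OF module_axioms Jm]) auto
  have "?m ?X = (\<Oplus>\<^bsub>?TR\<^esub>a\<in>A. ?m (tensor_elem R M ?J a (r a)))"
    using tJ by (intro lin_hom_finsum[OF TJ TR m finite_gens]) auto
  \<comment> \<open>The factor \<open>\<one>\<close> gives the summands the form required by
    \<open>sum_tensor_gens\<close>. Over \<open>R\<close> the sum collapses to the tensor of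
    \<open>combine r = 0\<close> with \<open>\<one>\<close>; injectivity then carries the vanishing
    back to \<open>J\<close>.\<close>
  also have "\<dots> = (\<Oplus>\<^bsub>?TR\<^esub>a\<in>A. tensor_elem R M ?R a (r a \<odot>\<^bsub>?R\<^esub> \<one>))"
  proof (rule TR.M.finsum_cong')
    show "(\<lambda>a. tensor_elem R M ?R a (r a \<odot>\<^bsub>?R\<^esub> \<one>)) \<in> A \<rightarrow> carrier ?TR"
      using gens_carrier rR by (auto intro!: tensor_elem_bilinear(1)[OF module_axioms Rm] simp: Rs)
    fix a assume "a \<in> A"
    then show "?m (tensor_elem R M ?J a (r a)) = tensor_elem R M ?R a (r a \<odot>\<^bsub>?R\<^esub> \<one>)"
      using tensor_map_linear(2)[OF module_axioms Jm module_axioms Rm id inc, of a "r a"] gens_carrier rJ rR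
      by (auto simp: Rs)
  qed simp
  also have "\<dots> = tensor_elem R M ?R (combine r) \<one>" by (rule sum_tensor_gens[OF Rm rV]) (simp add: Rs)
  also have "\<dots> = tensor_elem R M ?R (\<zero> \<odot>\<^bsub>M\<^esub> \<zero>\<^bsub>M\<^esub>) \<one>" using relations_combine[OF r] by simp
  also have "\<dots> = \<zero>\<^bsub>?TR\<^esub>"
    using tensor_elem_bilinear(4)[OF module_axioms Rm, of \<zero> "\<zero>\<^bsub>M\<^esub>" \<one>]
      tensor_elem_bilinear(1)[OF module_axioms Rm, of "\<zero>\<^bsub>M\<^esub>" \<one>] by (simp add: Rs)
  also have "\<dots> = ?m \<zero>\<^bsub>?TJ\<^esub>" using lin_hom_zero[OF TJ TR m] by simp
  finally have "?m ?X = ?m \<zero>\<^bsub>?TJ\<^esub>" .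
  then have X0: "?X = \<zero>\<^bsub>?TJ\<^esub>"
    by (rule inj_onD[OF inj]) (use tJ in \<open>auto intro!: TJ.M.finsum_closed\<close>)
  obtain F where F: "F \<subseteq> relations"
    "r \<in> module_span R (pow_module ?J A) {\<lambda>b. l b \<odot>\<^bsub>?J\<^esub> y | l y. l \<in> F \<and> y \<in> carrier ?J}"
    by (rule tensor_zeroE[OF Jm rP X0])
  let ?P = "pow_module ?J A"
  interpret P: module R ?P by (rule pow_module_module[OF Jm])
  \<comment> \<open>The vectors reachable from \<open>r\<close> by a relation map. They form a
    submodule, so \<open>r\<close> is one of them as soon as all \<open>l * y\<close> are, with
    \<open>l\<close> a relation and \<open>y\<close> in \<open>J\<close>.\<close>
  define H where "H = {u \<in> carrier ?P. \<exists>E\<in>relation_maps. E r = u}"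
  note KE = V.submoduleE[OF relations_submodule]
  have HD: "\<exists>E\<in>relation_maps. E r = u" "u \<in> carrier ?P" if "u \<in> H" for u using that by (auto simp: H_def)
  have Hsm: "s \<odot>\<^bsub>?P\<^esub> u \<in> H" if s: "s \<in> carrier R" and u: "u \<in> H" for s u
  proof -
    obtain E where E: "E \<in> relation_maps" "E r = u" using HD u by blast
    have E': "E \<in> lin_hom R V V" using E by (simp add: relation_maps_def)
    have "(\<lambda>v. s \<odot>\<^bsub>V\<^esub> E v) \<in> relation_maps"
      using E KE(4)[OF s] s lin_homD[OF E'] unfolding relation_maps_def
      by (auto intro!: lin_homI simp: V.smult_r_distr V.smult_assoc1[symmetric] R.m_comm)
    moreover have "s \<odot>\<^bsub>V\<^esub> E r = s \<odot>\<^bsub>?P\<^esub> u"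
      using E(2) by (auto simp: fun_eq_iff free_module_simps pow_module_simps Rs)
    ultimately show ?thesis using s HD(2)[OF u] by (auto simp: H_def)
  qed
  have Hsub: "submodule H R ?P"
  proof (rule P.submoduleI)
    have "\<zero>\<^bsub>V\<^esub> = \<zero>\<^bsub>?P\<^esub>" by (auto simp: fun_eq_iff free_module_simps pow_module_simps Rs)
    then show "\<zero>\<^bsub>?P\<^esub> \<in> H" unfolding H_def using zero_relation_map by force
    show "s \<odot>\<^bsub>?P\<^esub> u \<in> H" if "s \<in> carrier R" "u \<in> H" for s u by (rule Hsm[OF that])
    fix u assume u: "u \<in> H"
    have "\<ominus>\<^bsub>?P\<^esub> u = (\<ominus> \<one>) \<odot>\<^bsub>?P\<^esub> u" using HD(2)[OF u] by (simp add: P.smult_l_minus)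
    then show "\<ominus>\<^bsub>?P\<^esub> u \<in> H" using Hsm[OF _ u] by simp
    fix v assume v: "v \<in> H"
    obtain E where E: "E \<in> relation_maps" "E r = u" using HD u by blast
    obtain E' where E': "E' \<in> relation_maps" "E' r = v" using HD v by blast
    have "(\<lambda>v. E v \<oplus>\<^bsub>V\<^esub> E' v) \<in> relation_maps"
      using E(1) E'(1) KE(5) unfolding relation_maps_def by (auto intro: lin_hom_add[OF V.module_axioms])
    moreover have "E r \<oplus>\<^bsub>V\<^esub> E' r = u \<oplus>\<^bsub>?P\<^esub> v"
      using E(2) E'(2) by (auto simp: fun_eq_iff free_module_simps pow_module_simps Rs)
    ultimately show "u \<oplus>\<^bsub>?P\<^esub> v \<in> H" using HD(2) u v by (auto simp: H_def)
  qed (auto simp: H_def)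
  have "(\<lambda>b. l b \<odot>\<^bsub>?J\<^esub> y) \<in> H" if l: "l \<in> relations" and y: "y \<in> J" for l y
  proof -
    obtain c where c: "c \<in> carrier V" "y = ?\<psi> c" using y by (auto simp: J_def)
    have lV: "l \<in> carrier V" by (rule relations_carrier[OF l])
    have cR: "c a \<in> carrier R" for a by (rule free_module_coeff[OF c(1)])
    have lR: "l a \<in> carrier R" for a by (rule free_module_coeff[OF lV])
    have yR: "y \<in> carrier R" using y Jc by auto
    \<comment> \<open>Since \<open>y\<close> is the sum of the \<open>c a * r a\<close>, sending the
      basis vector at \<open>a\<close> to \<open>c a\<close> times \<open>l\<close> takes
      \<open>r\<close> to \<open>y * l\<close>.\<close>
    let ?u = "\<lambda>a. c a \<odot>\<^bsub>V\<^esub> l"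
    have u: "?u \<in> A \<rightarrow> carrier V" using cR lV by auto
    let ?E = "free_extend R V ?u"
    have E: "?E \<in> lin_hom R V V" by (rule free_extend_linear[OF V.module_axioms u])
    have "?E v \<in> relations" if "v \<in> carrier V" for v
      unfolding free_extend_finite[OF V.module_axioms finite_gens u that]
      using KE(4) l cR free_module_coeff[OF that] by (intro submodule_finsum[OF V.module_axioms relations_submodule]) auto
    then have "?E \<in> relation_maps" using E by (simp add: relation_maps_def)
    moreover have "?E r = (\<lambda>b. l b \<odot>\<^bsub>?J\<^esub> y)"
    proof
      fix b
      have "?E r b = (\<Oplus>a\<in>A. r a \<otimes> ?E (free_gen R a) b)"
        by (rule lin_hom_free_matrix[OF R.is_cring E finite_gens rV])
      also have "\<dots> = (\<Oplus>a\<in>A. c a \<otimes> r a \<otimes> l b)"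
        using cR rR lR free_extend_gen[OF V.module_axioms u]
        by (intro R.finsum_cong') (auto simp: free_module_simps R.m_ac)
      also have "\<dots> = (\<Oplus>a\<in>A. c a \<otimes> r a) \<otimes> l b"
        using cR rR lR finite_gens by (intro R.finsum_ldistr[symmetric]) auto
      also have "(\<Oplus>a\<in>A. c a \<otimes> r a) = y"
        unfolding c(2) free_extend_finite[OF Rm finite_gens rPi c(1)]
        by (simp add: finsum_def finprod_def algebra_module_def)
      finally show "?E r b = l b \<odot>\<^bsub>?J\<^esub> y" using yR lR by (simp add: Rs R.m_comm)
    qed
    moreover have "(\<lambda>b. l b \<odot>\<^bsub>?J\<^esub> y) \<in> carrier ?P"
      using lR y free_module_supp[OF lV] Jm.smult_closed[of _ y] yR
      by (auto simp: pow_module_simps Rs) force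
    ultimately show ?thesis by (auto simp: H_def)
  qed
  then have "module_span R ?P {\<lambda>b. l b \<odot>\<^bsub>?J\<^esub> y | l y. l \<in> F \<and> y \<in> carrier ?J} \<subseteq> H"
    using F(1) by (intro module_span_minimal[OF Hsub]) auto
  then show ?thesis using F(2) by (auto simp: H_def)
qed

text \<open>The error \<open>r - E r\<close> is again a relation, so some map fixes it. Applying
  that map to the error repairs \<open>r\<close> and does not disturb \<open>F\<close>, where the
  error is already zero.\<close>

lemma flat_relation_map_finite:
  assumes flat: "flat R M" and F: "finite F" "F \<subseteq> relations"
  shows "\<exists>E\<in>relation_maps. \<forall>f\<in>F. E f = f"
  using F
proof (induction F)
  case empty
  show ?case using zero_relation_map by blast
next
  case (insert r F)
  note KE = V.submoduleE[OF relations_submodule]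
  obtain E where E: "E \<in> relation_maps" "\<And>f. f \<in> F \<Longrightarrow> E f = f" using insert by auto
  have Eh: "E \<in> lin_hom R V V" using E(1) by (simp add: relation_maps_def)
  have r: "r \<in> relations" "r \<in> carrier V" using insert relations_carrier by auto
  have Er: "E r \<in> relations" using E(1) r by (auto simp: relation_maps_def)
  have "r \<ominus>\<^bsub>V\<^esub> E r \<in> relations" unfolding V.M.minus_eq using KE(5)[OF r(1) KE(3)[OF Er]] .
  from flat_relation_map[OF flat this] obtain E'
    where E': "E' \<in> relation_maps" "E' (r \<ominus>\<^bsub>V\<^esub> E r) = r \<ominus>\<^bsub>V\<^esub> E r" by blast
  have E'h: "E' \<in> lin_hom R V V" using E'(1) by (simp add: relation_maps_def)
  \<comment> \<open>In matrix form, \<open>1 - ?E = (1 - E)(1 - E')\<close>.\<close>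
  let ?E = "\<lambda>v. E v \<oplus>\<^bsub>V\<^esub> E' (v \<ominus>\<^bsub>V\<^esub> E v)"
  have idV: "(\<lambda>v. v) \<in> lin_hom R V V" by (auto simp: lin_hom_def)
  have "?E \<in> lin_hom R V V"
    by (intro lin_hom_add lin_hom_comp[OF lin_hom_diff E'h] Eh idV V.module_axioms)
  moreover have "?E v \<in> relations" if "v \<in> carrier V" for v
    using E(1) E'(1) that lin_homD(1)[OF Eh] by (intro KE(5)) (auto simp: relation_maps_def)
  moreover have "?E r = r"
    unfolding E'(2) using r lin_homD(1)[OF Eh r(2)] by (simp add: V.M.minus_eq V.M.a_ac V.M.r_neg)
  moreover have "?E f = f" if "f \<in> F" for f
  proof -
    have f: "f \<in> carrier V" using insert.prems that relations_carrier by auto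
    then have "f \<ominus>\<^bsub>V\<^esub> E f = \<zero>\<^bsub>V\<^esub>" using E(2)[OF that] by (simp add: V.M.minus_eq V.M.r_neg)
    then show ?thesis using f E(2)[OF that] lin_hom_zero[OF V.module_axioms V.module_axioms E'h] by simp
  qed
  ultimately show ?case by (intro bexI[of _ ?E]) (auto simp: relation_maps_def)
qed

end

section \<open>Projectivity after base change\<close>

locale generated_base_change = generated_module R M A
  for R :: "('a, 'r) ring_scheme" (structure) and M :: "('a, 'b, 'm) module_scheme" (structure)
    and A :: "'b set" +
  fixes S :: "('s, 'q) ring_scheme" and \<phi> :: "'a \<Rightarrow> 's"
  assumes S_cring: "cring S" and \<phi>_hom: "\<phi> \<in> ring_hom R S"
begin

sublocale S: cring S by (rule S_cring)

sublocale \<phi>: ring_hom_cring R S \<phi>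
  by (simp add: ring_hom_cring_def ring_hom_cring_axioms_def R.is_cring S_cring \<phi>_hom)

abbreviation N where "N \<equiv> algebra_module S \<phi>"

abbreviation T where "T \<equiv> tensor R M N"

abbreviation P where "P \<equiv> base_change R S \<phi> M"

abbreviation W where "W \<equiv> free_module S A"

abbreviation present where "present \<equiv> free_extend S P (\<lambda>a. tensor_elem R M N a \<one>\<^bsub>S\<^esub>)"

lemma N_module: "module R N"
  by (rule algebra_module_module[OF R.is_cring S_cring \<phi>_hom])

lemma N_simps: "carrier N = carrier S" "x \<oplus>\<^bsub>N\<^esub> y = x \<oplus>\<^bsub>S\<^esub> y" "r \<odot>\<^bsub>N\<^esub> x = \<phi> r \<otimes>\<^bsub>S\<^esub> x" "\<zero>\<^bsub>N\<^esub> = \<zero>\<^bsub>S\<^esub>"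
  by (auto simp: algebra_module_def)

sublocale N: module R N by (rule N_module)

sublocale T: module R T by (rule tensor_module[OF module_axioms N_module])

sublocale P: module S P by (rule base_change_module[OF R.is_cring S_cring \<phi>_hom module_axioms])

sublocale W: module S W by (rule free_module_module[OF S_cring])

lemmas elem = tensor_elem_bilinear[OF module_axioms N_module, unfolded N_simps]

lemma P_simps: "carrier P = carrier T" "x \<oplus>\<^bsub>P\<^esub> y = x \<oplus>\<^bsub>T\<^esub> y" "\<zero>\<^bsub>P\<^esub> = \<zero>\<^bsub>T\<^esub>"
  by (simp_all add: base_change_def Let_def)

lemma finsum_P: "(\<Oplus>\<^bsub>P\<^esub>i\<in>I. f i) = (\<Oplus>\<^bsub>T\<^esub>i\<in>I. f i)"
  by (simp add: finsum_def finprod_def base_change_def Let_def)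

lemma P_smult:
  assumes s: "s \<in> carrier S"
  shows "(\<lambda>C. s \<odot>\<^bsub>P\<^esub> C) \<in> lin_hom R T T"
    and "x \<in> carrier M \<Longrightarrow> t \<in> carrier S \<Longrightarrow>
      s \<odot>\<^bsub>P\<^esub> tensor_elem R M N x t = tensor_elem R M N x (s \<otimes>\<^bsub>S\<^esub> t)"
proof -
  have id: "(\<lambda>x. x) \<in> lin_hom R M M" by (auto simp: lin_hom_def)
  have mu: "(\<lambda>t. s \<otimes>\<^bsub>S\<^esub> t) \<in> lin_hom R N N"
    using s by (auto simp: lin_hom_def N_simps S.r_distr S.m_lcomm)
  note tm = tensor_map_linear[OF module_axioms N_module module_axioms N_module id mu]
  have eq: "s \<odot>\<^bsub>P\<^esub> C = tensor_map R M N (\<lambda>x. x) (\<lambda>t. s \<otimes>\<^bsub>S\<^esub> t) C" for C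
    by (simp add: base_change_def Let_def)
  show "(\<lambda>C. s \<odot>\<^bsub>P\<^esub> C) \<in> lin_hom R T T" using tm(1) by (simp add: eq)
  assume "x \<in> carrier M" "t \<in> carrier S"
  then show "s \<odot>\<^bsub>P\<^esub> tensor_elem R M N x t = tensor_elem R M N x (s \<otimes>\<^bsub>S\<^esub> t)"
    using tm(2)[of x t] by (simp add: eq N_simps)
qed

text \<open>Links the two scalar actions on the same tensors, so that \<open>S\<close>-submodules
  and \<open>S\<close>-linear maps can be handled by the results on
  \<open>R\<close>-modules.\<close>

lemma T_smult:
  assumes r: "r \<in> carrier R" and C: "C \<in> carrier T"
  shows "r \<odot>\<^bsub>T\<^esub> C = \<phi> r \<odot>\<^bsub>P\<^esub> C"
proof (rule tensor_hom_eqI[OF module_axioms N_module T.module_axioms _ P_smult(1) _ C])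
  show "(\<lambda>C. r \<odot>\<^bsub>T\<^esub> C) \<in> lin_hom R T T"
    by (rule lin_homI) (use r in \<open>auto simp: T.smult_r_distr T.smult_assoc1[symmetric] R.m_comm\<close>)
  show "\<phi> r \<in> carrier S" using r by simp
  fix x y assume "x \<in> carrier M" "y \<in> carrier N"
  then show "r \<odot>\<^bsub>T\<^esub> tensor_elem R M N x y = \<phi> r \<odot>\<^bsub>P\<^esub> tensor_elem R M N x y"
    using r by (simp add: N_simps P_smult(2) elem(5))
qed

lemma elem_Pi: "(\<lambda>a. tensor_elem R M N a \<one>\<^bsub>S\<^esub>) \<in> A \<rightarrow> carrier P"
  using gens_carrier by (auto simp: P_simps intro!: elem(1))

lemma present_hom: "present \<in> lin_hom S W P"
  by (rule free_extend_linear[OF P.module_axioms elem_Pi])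

lemma present_gen: "a \<in> A \<Longrightarrow> present (free_gen S a) = tensor_elem R M N a \<one>\<^bsub>S\<^esub>"
  by (rule free_extend_gen[OF P.module_axioms elem_Pi])

lemma present_eq:
  assumes v: "v \<in> carrier W"
  shows "present v = (\<Oplus>\<^bsub>T\<^esub>a\<in>A. tensor_elem R M N a (v a))"
proof -
  have vS: "v a \<in> carrier S" for a by (rule free_module_coeff[OF v])
  have "present v = (\<Oplus>\<^bsub>P\<^esub>a\<in>A. v a \<odot>\<^bsub>P\<^esub> tensor_elem R M N a \<one>\<^bsub>S\<^esub>)"
    by (rule free_extend_finite[OF P.module_axioms finite_gens elem_Pi v])
  also have "\<dots> = (\<Oplus>\<^bsub>P\<^esub>a\<in>A. tensor_elem R M N a (v a))"
    using gens_carrier vS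
    by (intro P.M.finsum_cong') (auto simp: P_smult(2) P_simps subset_iff intro!: elem(1))
  finally show ?thesis by (simp add: finsum_P)
qed

text \<open>Vectors over \<open>S\<close> carry two structures, \<open>W\<close> over
  \<open>S\<close> and \<open>pow_module N A\<close> over \<open>R\<close>. Identifying them makes
  \<open>tensor_zeroE\<close> and the universal property available for \<open>W\<close>.\<close>

lemma W_carrier: "carrier W = carrier (pow_module N A)"
  by (auto simp: free_module_finite_iff[OF finite_gens] pow_module_simps N_simps)

lemma pow_W:
  "x \<oplus>\<^bsub>pow_module N A\<^esub> y = x \<oplus>\<^bsub>W\<^esub> y"
  "r \<odot>\<^bsub>pow_module N A\<^esub> x = \<phi> r \<odot>\<^bsub>W\<^esub> x"
  by (auto simp: fun_eq_iff pow_module_simps free_module_simps N_simps)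

lemma scaled_image_W:
  assumes "d \<in> carrier V" "y \<in> carrier S"
  shows "(\<lambda>a. \<phi> (d a) \<otimes>\<^bsub>S\<^esub> y) \<in> carrier W"
  using assms(2) free_module_coeff[OF assms(1)] free_module_supp[OF assms(1)]
  by (auto simp: free_module_finite_iff[OF finite_gens]) force

lemma image_W: "d \<in> carrier V \<Longrightarrow> (\<lambda>a. \<phi> (d a)) \<in> carrier W"
  using scaled_image_W[of d "\<one>\<^bsub>S\<^esub>"] free_module_coeff[of d R A] by simp

lemma present_scaled_image:
  assumes "d \<in> carrier V" "y \<in> carrier S"
  shows "present (\<lambda>a. \<phi> (d a) \<otimes>\<^bsub>S\<^esub> y) = tensor_elem R M N (combine d) y"
  unfolding present_eq[OF scaled_image_W[OF assms]]
  using sum_tensor_gens[OF N_module assms(1)] assms(2) by (simp add: N_simps)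

text \<open>The tensor of \<open>x\<close> and \<open>y\<close> comes from the vector
  \<open>\<phi> (d a) * y\<close>, where \<open>d\<close> are coordinates of
  \<open>x\<close>.\<close>

lemma present_surj: "present ` carrier W = carrier P"
proof
  show "present ` carrier W \<subseteq> carrier P" using lin_homD(1)[OF present_hom] by blast
  note HE = P.submoduleE[OF image_submodule[OF W.module_axioms P.module_axioms present_hom]]
  let ?H = "present ` carrier W"
  have "carrier T \<subseteq> ?H"
  proof (rule tensor_subset_submodule[OF module_axioms N_module])
    have smult: "r \<odot>\<^bsub>T\<^esub> C \<in> ?H" if r: "r \<in> carrier R" and C: "C \<in> ?H" for r C
    proof -
      have "C \<in> carrier T" using HE(1) C by (auto simp: P_simps)
      then show ?thesis using T_smult[OF r] HE(4)[OF _ C] r by simp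
    qed
    show "submodule ?H R T"
    proof (rule T.submoduleI)
      show sub: "?H \<subseteq> carrier T" using HE(1) by (simp add: P_simps)
      have "present \<zero>\<^bsub>W\<^esub> = \<zero>\<^bsub>T\<^esub>"
        using lin_hom_zero[OF W.module_axioms P.module_axioms present_hom] by (simp add: P_simps)
      then show "\<zero>\<^bsub>T\<^esub> \<in> ?H" by (metis W.M.zero_closed imageI)
      fix C assume C: "C \<in> ?H"
      have "\<ominus>\<^bsub>T\<^esub> C = (\<ominus> \<one>) \<odot>\<^bsub>T\<^esub> C" using C sub by (auto simp: T.smult_l_minus)
      then show "\<ominus>\<^bsub>T\<^esub> C \<in> ?H" using smult[OF _ C] by simp
      fix D assume "D \<in> ?H"
      with C show "C \<oplus>\<^bsub>T\<^esub> D \<in> ?H" using HE(5) by (simp add: P_simps)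
    qed (rule smult)
    fix x y assume x: "x \<in> carrier M" and y: "y \<in> carrier N"
    have c: "coords x \<in> carrier V" "combine (coords x) = x" and y': "y \<in> carrier S"
      using coords[OF x] y by (auto simp: N_simps)
    show "tensor_elem R M N x y \<in> ?H"
      by (rule image_eqI[OF _ scaled_image_W[OF c(1) y']]) (simp add: present_scaled_image c y')
  qed
  then show "carrier P \<subseteq> ?H" by (simp add: P_simps)
qed

text \<open>The left-hand map is the base change of \<open>E\<close>: a ring homomorphism commutes
  with the sums of products that compute \<open>E v\<close>.\<close>

lemma image_relation_map:
  assumes E: "E \<in> lin_hom R V V" and v: "v \<in> carrier V"
  shows "free_extend S W (\<lambda>a b. \<phi> (E (free_gen R a) b)) (\<lambda>a. \<phi> (v a)) = (\<lambda>b. \<phi> (E v b))"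
proof
  fix b
  let ?u = "\<lambda>a b. \<phi> (E (free_gen R a) b)"
  have g: "E (free_gen R a) \<in> carrier V" if "a \<in> A" for a
    by (intro lin_homD(1)[OF E] free_gen_in[OF R.is_cring that])
  then have u: "?u \<in> A \<rightarrow> carrier W" using image_W by auto
  have vR: "v a \<in> carrier R" for a by (rule free_module_coeff[OF v])
  have ER: "E (free_gen R a) b \<in> carrier R" if "a \<in> A" for a by (rule free_module_coeff[OF g[OF that]])
  have "free_extend S W ?u (\<lambda>a. \<phi> (v a)) b
      = (\<Oplus>\<^bsub>S\<^esub>a\<in>A. \<phi> (v a) \<otimes>\<^bsub>S\<^esub> free_extend S W ?u (free_gen S a) b)"
    by (rule lin_hom_free_matrix[OF S_cring free_extend_linear[OF W.module_axioms u] finite_gens image_W[OF v]])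
  also have "\<dots> = (\<Oplus>\<^bsub>S\<^esub>a\<in>A. (\<phi> \<circ> (\<lambda>a. v a \<otimes> E (free_gen R a) b)) a)"
    using vR ER by (intro S.finsum_cong') (auto simp: free_extend_gen[OF W.module_axioms u])
  also have "\<dots> = \<phi> (\<Oplus>a\<in>A. v a \<otimes> E (free_gen R a) b)"
    using vR ER by (intro \<phi>.hom_finsum[symmetric]) auto
  also have "(\<Oplus>a\<in>A. v a \<otimes> E (free_gen R a) b) = E v b"
    by (rule lin_hom_free_matrix[OF R.is_cring E finite_gens v, symmetric])
  finally show "free_extend S W ?u (\<lambda>a. \<phi> (v a)) b = \<phi> (E v b)" .
qed

text \<open>A section \<open>h\<close> of the presentation makes the kernel of \<open>S\<^sup>A \<rightarrow> M \<otimes> S\<close> finitely generated by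
  the \<open>k e\<^sub>a\<close>, hence contained in the \<open>S\<close>-span of finitely many relations; take \<open>E\<close> fixing those.\<close>

lemma projective_imp_relation_map:
  assumes flat: "flat R M" and proj: "projective S P"
  shows "\<exists>E\<in>relation_maps. \<forall>r\<in>relations. \<forall>b. \<phi> (E r b) = \<phi> (r b)"
proof -
  have "(\<lambda>x. x) \<in> lin_hom S P P" by (auto simp: lin_hom_def)
  from projective_lift[OF proj W.module_axioms P.module_axioms present_hom present_surj this]
  obtain h where h: "h \<in> lin_hom S P W" "\<And>C. C \<in> carrier P \<Longrightarrow> present (h C) = C" by blast
  \<comment> \<open>The projection of \<open>W\<close> onto the kernel of \<open>present\<close>
    along the image of \<open>h\<close>. Its values on the basis generate that kernel.\<close>
  define k where "k v = v \<ominus>\<^bsub>W\<^esub> h (present v)" for v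
  have k: "k \<in> lin_hom S W W" unfolding k_def
    by (intro lin_hom_diff[OF W.module_axioms _ lin_hom_comp[OF present_hom h(1)]]) (auto simp: lin_hom_def)
  have gW: "free_gen S a \<in> carrier W" if "a \<in> A" for a by (rule free_gen_in[OF S_cring that])
  have "present (k v) = \<zero>\<^bsub>P\<^esub>" if v: "v \<in> carrier W" for v
  proof -
    have pv: "present v \<in> carrier P" using lin_homD(1)[OF present_hom v] .
    have hv: "h (present v) \<in> carrier W" using lin_homD(1)[OF h(1) pv] .
    show ?thesis
      unfolding k_def lin_hom_minus[OF W.module_axioms P.module_axioms present_hom v hv] h(2)[OF pv]
      using pv by (simp add: P.M.minus_eq P.M.r_neg)
  qed
  then have zero: "(\<Oplus>\<^bsub>T\<^esub>b\<in>A. tensor_elem R M N b (k (free_gen S a) b)) = \<zero>\<^bsub>T\<^esub>" if "a \<in> A" for a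
    using present_eq[OF lin_homD(1)[OF k gW[OF that]]] gW[OF that] by (simp add: P_simps)
  let ?G = "\<lambda>F. {\<lambda>b. l b \<odot>\<^bsub>N\<^esub> y | l y. l \<in> F \<and> y \<in> carrier N}"
  have "\<exists>F. finite F \<and> F \<subseteq> relations \<and> k (free_gen S a) \<in> module_span R (pow_module N A) (?G F)"
    if a: "a \<in> A" for a
  proof -
    have "k (free_gen S a) \<in> carrier (pow_module N A)"
      using lin_homD(1)[OF k gW[OF a]] by (simp add: W_carrier)
    then show ?thesis by (rule tensor_zeroE[OF N_module _ zero[OF a]]) blast
  qed
  then have "\<exists>F. \<forall>a\<in>A. finite (F a) \<and> F a \<subseteq> relations \<and>
      k (free_gen S a) \<in> module_span R (pow_module N A) (?G (F a))" by (intro bchoice ballI)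
  then obtain F where F: "\<And>a. a \<in> A \<Longrightarrow> finite (F a)" "\<And>a. a \<in> A \<Longrightarrow> F a \<subseteq> relations"
    "\<And>a. a \<in> A \<Longrightarrow> k (free_gen S a) \<in> module_span R (pow_module N A) (?G (F a))" by blast
  have "finite (\<Union>a\<in>A. F a)" "(\<Union>a\<in>A. F a) \<subseteq> relations" using F finite_gens by auto
  from flat_relation_map_finite[OF flat this] obtain E
    where E: "E \<in> relation_maps" "\<And>a l. a \<in> A \<Longrightarrow> l \<in> F a \<Longrightarrow> E l = l" by blast
  have Eh: "E \<in> lin_hom R V V" using E(1) by (simp add: relation_maps_def)
  let ?u = "\<lambda>a b. \<phi> (E (free_gen R a) b)"
  let ?E = "free_extend S W ?u"
  have u: "?u \<in> A \<rightarrow> carrier W"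
    by (intro Pi_I image_W lin_homD(1)[OF Eh] free_gen_in[OF R.is_cring])
  have ES: "?E \<in> lin_hom S W W" by (rule free_extend_linear[OF W.module_axioms u])
  let ?N = "pow_module N A"
  have Nm: "module R ?N" by (rule pow_module_module[OF N_module])
  \<comment> \<open>The \<open>k e_a\<close> are known to lie in an \<open>R\<close>-span, so
    \<open>?E\<close> is read as an \<open>R\<close>-linear map and its fixed points as an
    \<open>R\<close>-submodule.\<close>
  have "?E \<in> lin_hom R ?N ?N"
    by (rule lin_homI) (auto simp: W_carrier[symmetric] pow_W lin_homD[OF ES])
  moreover have "(\<lambda>v. v) \<in> lin_hom R ?N ?N" by (auto simp: lin_hom_def)
  ultimately have fix_sub: "submodule {v \<in> carrier ?N. ?E v = v} R ?N"
    by (rule equalizer_submodule[OF Nm Nm])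
  have fixk: "?E (k (free_gen S a)) = k (free_gen S a)" if a: "a \<in> A" for a
  proof -
    have "(\<lambda>b. l b \<odot>\<^bsub>N\<^esub> y) \<in> {v \<in> carrier ?N. ?E v = v}" if l: "l \<in> F a" and y: "y \<in> carrier N" for l y
    proof -
      have lV: "l \<in> carrier V" using l F(2)[OF a] relations_carrier by blast
      have lR: "l b \<in> carrier R" for b by (rule free_module_coeff[OF lV])
      have yS: "y \<in> carrier S" using y by (simp add: N_simps)
      have eq: "(\<lambda>b. l b \<odot>\<^bsub>N\<^esub> y) = y \<odot>\<^bsub>W\<^esub> (\<lambda>b. \<phi> (l b))"
        using yS lR by (auto simp: fun_eq_iff free_module_simps N_simps S.m_comm)
      have "?E (y \<odot>\<^bsub>W\<^esub> (\<lambda>b. \<phi> (l b))) = y \<odot>\<^bsub>W\<^esub> (\<lambda>b. \<phi> (l b))"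
        unfolding lin_homD(3)[OF ES yS image_W[OF lV]] image_relation_map[OF Eh lV] E(2)[OF a l] ..
      then show ?thesis unfolding eq using image_W[OF lV] yS by (simp add: W_carrier[symmetric])
    qed
    then have "module_span R ?N (?G (F a)) \<subseteq> {v \<in> carrier ?N. ?E v = v}"
      by (intro module_span_minimal[OF fix_sub]) blast
    then show ?thesis using F(3)[OF a] by blast
  qed
  have "\<phi> (E r b) = \<phi> (r b)" if r: "r \<in> relations" for r b
  proof -
    let ?r = "\<lambda>a. \<phi> (r a)"
    have rV: "r \<in> carrier V" by (rule relations_carrier[OF r])
    have rW: "?r \<in> carrier W" by (rule image_W[OF rV])
    have rR: "r a \<in> carrier R" for a by (rule free_module_coeff[OF rV])
    \<comment> \<open>The image of a relation is in the kernel of \<open>present\<close>, so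
      \<open>k\<close> leaves it unchanged, while \<open>?E\<close> fixes every value of
      \<open>k\<close> because it fixes those on the basis.\<close>
    have "present ?r = tensor_elem R M N (combine r) \<one>\<^bsub>S\<^esub>"
      using present_scaled_image[OF rV S.one_closed] rR by simp
    also have "\<dots> = tensor_elem R M N (\<zero> \<odot>\<^bsub>M\<^esub> \<zero>\<^bsub>M\<^esub>) \<one>\<^bsub>S\<^esub>" by (simp add: relations_combine[OF r])
    also have "\<dots> = \<zero>\<^bsub>P\<^esub>"
      using elem(4)[of \<zero> "\<zero>\<^bsub>M\<^esub>" "\<one>\<^bsub>S\<^esub>"] elem(1)[of "\<zero>\<^bsub>M\<^esub>" "\<one>\<^bsub>S\<^esub>"] by (simp add: P_simps)
    finally have "k ?r = ?r"
      unfolding k_def using rW lin_hom_zero[OF P.module_axioms W.module_axioms h(1)]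
      by (simp add: W.M.minus_zero_right)
    moreover have "?E (k ?r) = k ?r"
      by (rule lin_hom_free_eqI[OF W.module_axioms lin_hom_comp[OF k ES] k finite_gens rW]) (rule fixk)
    ultimately have "?E ?r = ?r" by simp
    then show ?thesis unfolding image_relation_map[OF Eh rV] by (rule fun_cong)
  qed
  then show ?thesis using E(1) by blast
qed

text \<open>The section makes \<open>P\<close> a retract of a free module: \<open>f\<close> after
  \<open>present\<close> lifts by choosing preimages for the basis, and precomposing with
  \<open>h\<close> gives a lift of \<open>f\<close>.\<close>

lemma projective_if_section:
  assumes h: "h \<in> lin_hom S P W" and sec: "\<And>C. C \<in> carrier P \<Longrightarrow> present (h C) = C"
  shows "projective S P"
  unfolding projective_def
proof (intro conjI P.module_axioms allI impI)
  fix L :: "('s, ('b \<times> 's \<Rightarrow> 'a) set \<Rightarrow> 's) module" and L' :: "('s, ('b \<times> 's \<Rightarrow> 'a) set) module" and g f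
  assume L: "module S L" and L': "module S L'" and g: "g \<in> lin_hom S L L'"
    and surj: "g ` carrier L = carrier L'" and f: "f \<in> lin_hom S P L'"
  have "\<exists>y\<in>carrier L. g y = f (tensor_elem R M N a \<one>\<^bsub>S\<^esub>)" if "a \<in> A" for a
  proof -
    have "f (tensor_elem R M N a \<one>\<^bsub>S\<^esub>) \<in> g ` carrier L"
      unfolding surj using lin_homD(1)[OF f] elem_Pi that by blast
    then show ?thesis by auto
  qed
  then obtain u where u: "\<And>a. a \<in> A \<Longrightarrow> u a \<in> carrier L \<and> g (u a) = f (tensor_elem R M N a \<one>\<^bsub>S\<^esub>)" by metis
  then have uPi: "u \<in> A \<rightarrow> carrier L" by auto
  let ?l = "free_extend S L u"
  have l: "?l \<in> lin_hom S W L" by (rule free_extend_linear[OF L uPi])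
  have "g (?l v) = f (present v)" if v: "v \<in> carrier W" for v
    by (rule lin_hom_free_eqI[OF L' lin_hom_comp[OF l g] lin_hom_comp[OF present_hom f] finite_gens v])
      (simp add: free_extend_gen[OF L uPi] present_gen u)
  then show "\<exists>h\<in>lin_hom S P L. \<forall>x\<in>carrier P. g (h x) = f x"
    using lin_hom_comp[OF h l] lin_homD(1)[OF h] sec by (intro bexI[of _ "\<lambda>x. ?l (h x)"]) auto
qed

text \<open>The section is \<open>x \<otimes> y \<mapsto> \<phi>(d - E d) \<cdot> y\<close> for any coordinates \<open>d\<close> of \<open>x\<close>.\<close>

lemma relation_map_imp_projective:
  assumes E: "E \<in> relation_maps" and fix_rel: "\<And>r b. r \<in> relations \<Longrightarrow> \<phi> (E r b) = \<phi> (r b)"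
  shows "projective S P"
proof -
  have Eh: "E \<in> lin_hom R V V" using E by (simp add: relation_maps_def)
  have EK: "E v \<in> relations" if "v \<in> carrier V" for v using E that by (simp add: relation_maps_def)
  \<comment> \<open>Two properties of \<open>1 - E\<close> give the section: it preserves
    \<open>combine\<close>, as \<open>E\<close> takes values in the relations, and it dies on
    relations after \<open>\<phi>\<close>, so the choice of coordinates is immaterial.\<close>
  define D where "D v = v \<ominus>\<^bsub>V\<^esub> E v" for v
  have D: "D \<in> lin_hom R V V" unfolding D_def
    by (intro lin_hom_diff[OF V.module_axioms _ Eh]) (auto simp: lin_hom_def)
  note DD = lin_homD[OF D]
  have DR: "D v b \<in> carrier R" if "v \<in> carrier V" for v b by (rule free_module_coeff[OF DD(1)[OF that]])
  have Dcomb: "combine (D v) = combine v" if v: "v \<in> carrier V" for v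
    unfolding D_def lin_hom_minus[OF V.module_axioms module_axioms combine_hom v lin_homD(1)[OF Eh v]]
    using relations_combine[OF EK[OF v]] combine_simps(1)[OF v] by (simp add: M.minus_zero_right)
  have D0: "\<phi> (D r b) = \<zero>\<^bsub>S\<^esub>" if r: "r \<in> relations" for r b
  proof -
    have rV: "r \<in> carrier V" by (rule relations_carrier[OF r])
    have rR: "r b \<in> carrier R" "E r b \<in> carrier R"
      using free_module_coeff[OF rV] free_module_coeff[OF lin_homD(1)[OF Eh rV]] by auto
    have "\<phi> (D r b) = \<phi> (r b \<ominus> E r b)"
      unfolding D_def by (simp add: free_module_minus[OF R.is_cring rV lin_homD(1)[OF Eh rV]])
    also have "\<dots> = \<phi> (r b) \<ominus>\<^bsub>S\<^esub> \<phi> (E r b)" using rR by (simp add: R.minus_eq S.minus_eq)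
    finally show ?thesis using fix_rel[OF r] rR by (simp add: S.minus_eq S.r_neg)
  qed
  define \<beta> where "\<beta> v y = (\<lambda>b. \<phi> (D v b) \<otimes>\<^bsub>S\<^esub> y)" for v y
  have \<beta>W: "\<beta> v y \<in> carrier W" if "v \<in> carrier V" "y \<in> carrier S" for v y
    unfolding \<beta>_def by (rule scaled_image_W[OF DD(1)[OF that(1)] that(2)])
  have eq: "\<beta> c y = \<beta> d y" if cd: "c \<in> carrier V" "d \<in> carrier V" "combine c = combine d" and y: "y \<in> carrier S" for c d y
  proof -
    have "\<phi> (D c b) = \<phi> (D d b)" for b
    proof -
      have "D (c \<ominus>\<^bsub>V\<^esub> d) b = D c b \<ominus> D d b"
        unfolding lin_hom_minus[OF V.module_axioms V.module_axioms D cd(1,2)]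
        by (rule free_module_minus[OF R.is_cring DD(1)[OF cd(1)] DD(1)[OF cd(2)]])
      then have "\<phi> (D c b \<ominus> D d b) = \<zero>\<^bsub>S\<^esub>" using D0[OF diff_in_relations[OF cd], of b] by simp
      then have "\<phi> (D c b) \<ominus>\<^bsub>S\<^esub> \<phi> (D d b) = \<zero>\<^bsub>S\<^esub>"
        using DR[OF cd(1)] DR[OF cd(2)] by (simp add: R.minus_eq S.minus_eq)
      then show ?thesis using DR[OF cd(1)] DR[OF cd(2)] by (simp add: S.minus_eq_zero_iff)
    qed
    then show ?thesis by (simp add: \<beta>_def)
  qed
  let ?N = "pow_module N A"
  have Nm: "module R ?N" by (rule pow_module_module[OF N_module])
  have \<beta>add1: "\<beta> (c \<oplus>\<^bsub>V\<^esub> d) y = \<beta> c y \<oplus>\<^bsub>?N\<^esub> \<beta> d y"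
    if "c \<in> carrier V" "d \<in> carrier V" "y \<in> carrier S" for c d y
    unfolding \<beta>_def DD(2)[OF that(1,2)] using DR that
    by (auto simp: fun_eq_iff pow_module_simps free_module_simps N_simps S.l_distr)
  have \<beta>add2: "\<beta> d (y \<oplus>\<^bsub>S\<^esub> y') = \<beta> d y \<oplus>\<^bsub>?N\<^esub> \<beta> d y'"
    if "d \<in> carrier V" "y \<in> carrier S" "y' \<in> carrier S" for d y y'
    unfolding \<beta>_def using DR that
    by (auto simp: fun_eq_iff pow_module_simps free_module_simps N_simps S.r_distr)
  have \<beta>smult1: "\<beta> (r \<odot>\<^bsub>V\<^esub> d) y = r \<odot>\<^bsub>?N\<^esub> \<beta> d y"
    if "r \<in> carrier R" "d \<in> carrier V" "y \<in> carrier S" for r d y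
    unfolding \<beta>_def DD(3)[OF that(1,2)] using DR that
    by (auto simp: fun_eq_iff pow_module_simps free_module_simps N_simps S.m_assoc)
  have \<beta>smult2: "\<beta> d (\<phi> r \<otimes>\<^bsub>S\<^esub> y) = r \<odot>\<^bsub>?N\<^esub> \<beta> d y"
    if "r \<in> carrier R" "d \<in> carrier V" "y \<in> carrier S" for r d y
    unfolding \<beta>_def using DR that
    by (auto simp: fun_eq_iff pow_module_simps free_module_simps N_simps S.m_lcomm)
  have "\<exists>h\<in>lin_hom R T ?N. \<forall>x\<in>carrier M. \<forall>y\<in>carrier N. h (tensor_elem R M N x y) = \<beta> (coords x) y"
  proof (rule tensor_universal[OF module_axioms N_module Nm])
    fix x y assume "x \<in> carrier M" "y \<in> carrier N"
    then show "\<beta> (coords x) y \<in> carrier ?N"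
      using \<beta>W coords by (simp add: N_simps W_carrier[symmetric])
  next
    fix x x' y assume x: "x \<in> carrier M" "x' \<in> carrier M" "y \<in> carrier N"
    have "\<beta> (coords (x \<oplus>\<^bsub>M\<^esub> x')) y = \<beta> (coords x \<oplus>\<^bsub>V\<^esub> coords x') y"
      using x coords[of x] coords[of x'] coords[of "x \<oplus>\<^bsub>M\<^esub> x'"]
      by (intro eq) (auto simp: combine_simps N_simps)
    then show "\<beta> (coords (x \<oplus>\<^bsub>M\<^esub> x')) y = \<beta> (coords x) y \<oplus>\<^bsub>?N\<^esub> \<beta> (coords x') y"
      using \<beta>add1 x coords by (simp add: N_simps)
  next
    fix x y y' assume "x \<in> carrier M" "y \<in> carrier N" "y' \<in> carrier N"
    then show "\<beta> (coords x) (y \<oplus>\<^bsub>N\<^esub> y') = \<beta> (coords x) y \<oplus>\<^bsub>?N\<^esub> \<beta> (coords x) y'"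
      using \<beta>add2 coords by (simp add: N_simps)
  next
    fix r x y assume x: "r \<in> carrier R" "x \<in> carrier M" "y \<in> carrier N"
    have "\<beta> (coords (r \<odot>\<^bsub>M\<^esub> x)) y = \<beta> (r \<odot>\<^bsub>V\<^esub> coords x) y"
      using x coords[of x] coords[of "r \<odot>\<^bsub>M\<^esub> x"] by (intro eq) (auto simp: combine_simps N_simps)
    then show "\<beta> (coords (r \<odot>\<^bsub>M\<^esub> x)) y = r \<odot>\<^bsub>?N\<^esub> \<beta> (coords x) y"
      using \<beta>smult1 x coords by (simp add: N_simps)
    show "\<beta> (coords x) (r \<odot>\<^bsub>N\<^esub> y) = r \<odot>\<^bsub>?N\<^esub> \<beta> (coords x) y"
      using \<beta>smult2 x coords by (simp add: N_simps)
  qed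
  then obtain h where h: "h \<in> lin_hom R T ?N"
    "\<And>x y. x \<in> carrier M \<Longrightarrow> y \<in> carrier S \<Longrightarrow> h (tensor_elem R M N x y) = \<beta> (coords x) y"
    by (auto simp: N_simps)
  note hD = lin_homD[OF h(1)]
  \<comment> \<open>The universal property gives \<open>R\<close>-linearity only. Both sides are
    \<open>R\<close>-linear in \<open>C\<close>, so compatibility with scalars from \<open>S\<close>
    may be tested on pure tensors.\<close>
  have hS: "h (s \<odot>\<^bsub>P\<^esub> C) = s \<odot>\<^bsub>W\<^esub> h C" if s: "s \<in> carrier S" and C: "C \<in> carrier T" for s C
  proof (rule tensor_hom_eqI[OF module_axioms N_module Nm lin_hom_comp[OF P_smult(1)[OF s] h(1)] _ _ C])
    have comm: "s \<odot>\<^bsub>W\<^esub> (\<phi> r \<odot>\<^bsub>W\<^esub> v) = \<phi> r \<odot>\<^bsub>W\<^esub> (s \<odot>\<^bsub>W\<^esub> v)" if "r \<in> carrier R" "v \<in> carrier W" for r v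
      using s that by (simp add: W.smult_assoc1[symmetric] S.m_comm)
    show "(\<lambda>C. s \<odot>\<^bsub>W\<^esub> h C) \<in> lin_hom R T ?N"
      using s hD by (intro lin_homI) (simp_all add: W_carrier[symmetric] pow_W W.smult_r_distr comm)
    fix x y assume xy: "x \<in> carrier M" "y \<in> carrier N"
    have "\<beta> (coords x) (s \<otimes>\<^bsub>S\<^esub> y) = s \<odot>\<^bsub>W\<^esub> \<beta> (coords x) y"
      using s xy DR coords by (auto simp: \<beta>_def fun_eq_iff free_module_simps N_simps S.m_lcomm)
    then show "h (s \<odot>\<^bsub>P\<^esub> tensor_elem R M N x y) = s \<odot>\<^bsub>W\<^esub> h (tensor_elem R M N x y)"
      using s xy by (simp add: P_smult(2) h(2) N_simps)
  qed
  show ?thesis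
  proof (rule projective_if_section)
    show hP: "h \<in> lin_hom S P W"
      by (rule lin_homI) (simp_all add: P_simps hS hD W_carrier pow_W(1)[symmetric])
    fix C assume C: "C \<in> carrier P"
    note pD = lin_homD[OF lin_hom_comp[OF hP present_hom]]
    have ph: "(\<lambda>C. present (h C)) \<in> lin_hom R T T"
      using pD by (intro lin_homI) (simp_all add: P_simps T_smult)
    show "present (h C) = C"
    proof (rule tensor_hom_eqI[OF module_axioms N_module T.module_axioms ph])
      show "(\<lambda>C. C) \<in> lin_hom R T T" by (auto simp: lin_hom_def)
      show "C \<in> carrier T" using C by (simp add: P_simps)
      fix x y assume "x \<in> carrier M" "y \<in> carrier N"
      then have x: "x \<in> carrier M" and y: "y \<in> carrier S" by (simp_all add: N_simps)
      have c: "coords x \<in> carrier V" "combine (coords x) = x" using coords[OF x] by auto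
      have "present (h (tensor_elem R M N x y)) = present (\<lambda>b. \<phi> (D (coords x) b) \<otimes>\<^bsub>S\<^esub> y)"
        by (simp add: h(2)[OF x y] \<beta>_def)
      also have "\<dots> = tensor_elem R M N (combine (D (coords x))) y"
        by (rule present_scaled_image[OF DD(1)[OF c(1)] y])
      finally show "present (h (tensor_elem R M N x y)) = tensor_elem R M N x y"
        by (simp add: Dcomb[OF c(1)] c(2))
    qed
  qed
qed

lemma projective_base_change_iff:
  assumes "flat R M"
  shows "projective S P \<longleftrightarrow> (\<exists>E\<in>relation_maps. \<forall>r\<in>relations. \<forall>b. \<phi> (E r b) = \<phi> (r b))"
  using projective_imp_relation_map[OF assms] relation_map_imp_projective by blast

end

section \<open>Products of residue fields\<close>

text \<open>An \<open>x\<close> outside \<open>p\<close> is inverted by the fraction of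
  \<open>\<one>\<close> by \<open>x\<close> in the local ring, so a zero residue would make one
  equal to zero in the residue field.\<close>

lemma residue_map_eq_zero_iff:
  assumes p: "primeideal p R" and x: "x \<in> carrier R"
  shows "residue_map R p x = \<zero>\<^bsub>residue_field R p\<^esub> \<longleftrightarrow> x \<in> p"
proof -
  interpret p: primeideal p R by fact
  interpret mult_subset R "carrier R - p" by (rule prime_mult_subset[OF p])
  let ?L = "local_ring_at R p" and ?I = "local_ideal R p"
  have L: "cring ?L" using localization_cring by (simp add: local_ring_at_def)
  interpret L: cring ?L by fact
  interpret k: field "residue_field R p" by (rule residue_field_field[OF p])
  have lc: "local_map R p y \<in> carrier ?L" if "y \<in> carrier R" for y
    using that T(2) by (simp add: local_map_def local_ring_at_def loc_carrierI)
  have sub: "local_map R p ` p \<subseteq> carrier ?L" using lc p.a_subset by blast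
  have I: "ideal ?I ?L" unfolding local_ideal_def by (rule L.genideal_ideal[OF sub])
  interpret I: ideal ?I ?L by fact
  have zero: "\<zero>\<^bsub>residue_field R p\<^esub> = ?I" by (simp add: residue_field_def FactRing_def)
  have q: "(+>\<^bsub>?L\<^esub>) ?I \<in> ring_hom ?L (residue_field R p)"
    unfolding residue_field_def by (rule I.rcos_ring_hom)
  show ?thesis
  proof
    assume "x \<in> p"
    then have "local_map R p x \<in> ?I" unfolding local_ideal_def using L.genideal_self[OF sub] by blast
    then show "residue_map R p x = \<zero>\<^bsub>residue_field R p\<^esub>"
      unfolding residue_map_def zero by (rule I.a_rcos_const)
  next
    assume z: "residue_map R p x = \<zero>\<^bsub>residue_field R p\<^esub>"
    show "x \<in> p"
    proof (rule ccontr)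
      assume "x \<notin> p"
      then have xT: "x \<in> carrier R - p" using x by simp
      have o: "\<one>\<^bsub>R\<^esub> \<in> carrier R - p" by (rule T(2))
      let ?y = "frac R (carrier R - p) \<one>\<^bsub>R\<^esub> x"
      have y: "?y \<in> carrier ?L" using xT by (simp add: local_ring_at_def loc_carrierI)
      have "local_map R p x \<otimes>\<^bsub>?L\<^esub> ?y = frac R (carrier R - p) x x"
        using xT o by (simp add: local_map_def local_ring_at_def mult_frac)
      also have "\<dots> = \<one>\<^bsub>?L\<^esub>"
        unfolding local_ring_at_def loc_one by (rule frac_eqI') (use xT o in simp_all)
      finally have "\<one>\<^bsub>residue_field R p\<^esub> = residue_map R p x \<otimes>\<^bsub>residue_field R p\<^esub> (?I +>\<^bsub>?L\<^esub> ?y)"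
        using ring_hom_mult[OF q lc[OF x] y] ring_hom_one[OF q] by (simp add: residue_map_def)
      also have "\<dots> = \<zero>\<^bsub>residue_field R p\<^esub>" unfolding z using ring_hom_closed[OF q y] by simp
      finally show False using k.zero_not_one by simp
    qed
  qed
qed

lemma residue_product_map_eq_iff:
  assumes R: "cring R" and Y: "Y \<subseteq> Spec R" and x: "x \<in> carrier R" and y: "y \<in> carrier R"
  shows "residue_product_map R Y x = residue_product_map R Y y \<longleftrightarrow> (\<forall>p\<in>Y. x \<ominus>\<^bsub>R\<^esub> y \<in> p)"
proof -
  let ?S = "residue_product R Y" and ?\<phi> = "residue_product_map R Y"
  have S: "cring ?S" by (rule residue_product_cring[OF Y])
  interpret ring_hom_cring R ?S ?\<phi>
    using R S residue_product_map_hom[OF Y] by (simp add: ring_hom_cring_def ring_hom_cring_axioms_def)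
  have "?\<phi> x = ?\<phi> y \<longleftrightarrow> ?\<phi> x \<ominus>\<^bsub>?S\<^esub> ?\<phi> y = \<zero>\<^bsub>?S\<^esub>" using x y by (simp add: S.minus_eq_zero_iff)
  also have "?\<phi> x \<ominus>\<^bsub>?S\<^esub> ?\<phi> y = ?\<phi> (x \<ominus>\<^bsub>R\<^esub> y)" using x y by (simp add: R.minus_eq S.minus_eq)
  also have "?\<phi> (x \<ominus>\<^bsub>R\<^esub> y) = \<zero>\<^bsub>?S\<^esub> \<longleftrightarrow>
      (\<forall>p\<in>Y. residue_map R p (x \<ominus>\<^bsub>R\<^esub> y) = \<zero>\<^bsub>residue_field R p\<^esub>)"
    by (auto simp: residue_product_map_def residue_product_def product_ring_def fun_eq_iff restrict_def)
  also have "\<dots> \<longleftrightarrow> (\<forall>p\<in>Y. x \<ominus>\<^bsub>R\<^esub> y \<in> p)"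
    using x y Y residue_map_eq_zero_iff[of _ R] by (auto simp: Spec_def subset_iff)
  finally show ?thesis .
qed

section \<open>Passing to the generalization cone\<close>

lemma (in generated_module) relation_map_generalizes:
  assumes flat: "flat R M" and Y: "Y \<subseteq> Spec R" and E: "E \<in> relation_maps"
    and EY: "\<And>r b p. r \<in> relations \<Longrightarrow> p \<in> Y \<Longrightarrow> E r b \<ominus> r b \<in> p"
  shows "\<exists>E'\<in>relation_maps. \<forall>r\<in>relations. \<forall>b. \<forall>q\<in>generalization_cone R Y. E' r b \<ominus> r b \<in> q"
proof -
  have Eh: "E \<in> lin_hom R V V" using E by (simp add: relation_maps_def)
  have gV: "free_gen R a \<in> carrier V" if "a \<in> A" for a by (rule free_gen_in[OF R.is_cring that])
  have "finite (E ` free_gen R ` A)" "E ` free_gen R ` A \<subseteq> relations"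
    using finite_gens E gV by (auto simp: relation_maps_def)
  from flat_relation_map_finite[OF flat this] obtain E'
    where E': "E' \<in> relation_maps" "\<And>a. a \<in> A \<Longrightarrow> E' (E (free_gen R a)) = E (free_gen R a)" by blast
  have E'h: "E' \<in> lin_hom R V V" using E'(1) by (simp add: relation_maps_def)
  have E'E: "E' (E v) = E v" if "v \<in> carrier V" for v
    by (rule lin_hom_free_eqI[OF V.module_axioms lin_hom_comp[OF Eh E'h] Eh finite_gens that E'(2)])
  have closed: "comb_closed R H" if "submodule H R V" for H
    unfolding comb_closed_def
  proof (intro ballI)
    fix k l c d assume kl: "k \<in> H" "l \<in> H" "c \<in> carrier R" "d \<in> carrier R"
    note HE = V.submoduleE[OF that]
    have "c \<odot>\<^bsub>V\<^esub> k \<ominus>\<^bsub>V\<^esub> d \<odot>\<^bsub>V\<^esub> l \<in> H"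
      unfolding V.M.minus_eq using kl by (intro HE(5) HE(3) HE(4))
    moreover have "c \<odot>\<^bsub>V\<^esub> k \<ominus>\<^bsub>V\<^esub> d \<odot>\<^bsub>V\<^esub> l = (\<lambda>b. c \<otimes> k b \<ominus> d \<otimes> l b)"
      using kl HE(1) by (auto simp: fun_eq_iff free_module_minus[OF R.is_cring] free_module_simps subset_iff)
    ultimately show "(\<lambda>b. c \<otimes> k b \<ominus> d \<otimes> l b) \<in> H" by simp
  qed
  have "E' r b \<ominus> r b \<in> q" if r: "r \<in> relations" and q: "q \<in> generalization_cone R Y" for r b q
  proof -
    obtain p where p: "p \<in> Y" "q \<subseteq> p" and "primeideal q R"
      using q by (auto simp: generalization_cone_def Spec_def)
    interpret q: primeideal q R by fact
    interpret p: primeideal p R using p(1) Y by (auto simp: Spec_def)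
    have rV: "r \<in> carrier V" by (rule relations_carrier[OF r])
    have one: "\<one> \<in> carrier R - p" using p.I_notcarr p.one_imp_carrier by auto
    have "\<exists>s\<in>carrier R - p. (\<lambda>b. s \<otimes> r b) \<in> E ` carrier V"
    proof (rule p.local_generation[OF finite_gens _ _ closed closed, where K = relations])
      show "r \<in> relations" by (rule r)
      show "submodule relations R V" by (rule relations_submodule)
      show "submodule (E ` carrier V) R V" by (rule image_submodule[OF V.module_axioms V.module_axioms Eh])
      show "E ` carrier V \<subseteq> relations" using E by (auto simp: relation_maps_def)
      show "E ` carrier V \<noteq> {}" using V.M.zero_closed by blast
      fix k assume k: "k \<in> relations"
      then have kV: "k \<in> carrier V" by (rule relations_carrier)
      have kR: "k b \<in> carrier R" "E k b \<in> carrier R" for b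
        using free_module_coeff[OF kV] free_module_coeff[OF lin_homD(1)[OF Eh kV]] by auto
      show "k b \<in> carrier R" for b by (rule kR)
      show "k b = \<zero>" if "b \<notin> A" for b using free_module_supp[OF kV] that by blast
      have "\<one> \<otimes> k b \<ominus> E k b \<in> p" for b
      proof -
        have "\<ominus> (E k b \<ominus> k b) \<in> p"
          using EY[OF k p(1)] additive_subgroup.a_inv_closed[OF p.is_additive_subgroup] R.abelian_group_axioms by blast
        moreover have "\<ominus> (E k b \<ominus> k b) = \<one> \<otimes> k b \<ominus> E k b"
          using kR by (simp add: R.minus_eq R.minus_add R.a_comm)
        ultimately show ?thesis by simp
      qed
      then show "\<exists>s\<in>carrier R - p. \<exists>l\<in>E ` carrier V. \<forall>b. s \<otimes> k b \<ominus> l b \<in> p"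
        using one kV by blast
      \<comment> \<open>Purity holds with factor one: fixing \<open>k\<close> by \<open>G\<close>
        writes it as a combination of the relations \<open>G (free_gen R j)\<close> with its own
        entries as coefficients. Other factors arise only in the eliminations.\<close>
      obtain G where G: "G \<in> relation_maps" "G k = k" using flat_relation_map[OF flat k] by blast
      have "\<one> \<otimes> k b = (\<Oplus>j\<in>A. k j \<otimes> G (free_gen R j) b)" for b
      proof -
        have "G \<in> lin_hom R V V" using G(1) by (simp add: relation_maps_def)
        from lin_hom_free_matrix[OF R.is_cring this finite_gens kV, of b] show ?thesis
          unfolding G(2) R.l_one[OF kR(1)] .
      qed
      moreover have "\<forall>j\<in>A. G (free_gen R j) \<in> relations" using G gV by (auto simp: relation_maps_def)
      ultimately show "\<exists>s\<in>carrier R - p. \<exists>E. (\<forall>j\<in>A. E j \<in> relations) \<and>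
          (\<forall>b. s \<otimes> k b = (\<Oplus>j\<in>A. k j \<otimes> E j b))"
        using one by (intro bexI[of _ \<one>] exI[of _ "\<lambda>j. G (free_gen R j)"]) auto
    qed
    then obtain s v where s: "s \<in> carrier R" "s \<notin> p" and v: "v \<in> carrier V" "(\<lambda>b. s \<otimes> r b) = E v" by blast
    have sr: "s \<odot>\<^bsub>V\<^esub> r = E v" unfolding v(2)[symmetric] by (simp add: fun_eq_iff free_module_simps)
    \<comment> \<open>\<open>s * r\<close> lies in the image of \<open>E\<close>, which
      \<open>E'\<close> fixes pointwise, so \<open>E' r\<close> and \<open>r\<close> agree up to the
      factor \<open>s\<close>; it is outside \<open>q\<close> because \<open>q\<close> is contained
      in \<open>p\<close>.\<close>
    have "s \<odot>\<^bsub>V\<^esub> E' r = s \<odot>\<^bsub>V\<^esub> r"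
      using lin_homD(3)[OF E'h s(1) rV] E'E[OF v(1)] by (simp add: sr)
    then have "s \<otimes> E' r b = s \<otimes> r b" by (metis free_module_simps(2))
    moreover have rR: "r b \<in> carrier R" "E' r b \<in> carrier R"
      using free_module_coeff[OF rV] free_module_coeff[OF lin_homD(1)[OF E'h rV]] by auto
    ultimately have "s \<otimes> (E' r b \<ominus> r b) = \<zero>"
      using s(1) by (simp add: R.minus_eq R.r_distr R.r_minus R.r_neg)
    then have "s \<otimes> (E' r b \<ominus> r b) \<in> q"
      using additive_subgroup.zero_closed[OF q.is_additive_subgroup] by simp
    then show ?thesis using q.I_prime[OF s(1)] rR s(2) p(2) by blast
  qed
  then show ?thesis using E'(1) by blast
qed

lemma (in generated_module) projective_residue_product_iff:
  assumes flat: "flat R M" and Y: "Y \<subseteq> Spec R"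
  shows "projective (residue_product R Y) (base_change R (residue_product R Y) (residue_product_map R Y) M)
    \<longleftrightarrow> (\<exists>E\<in>relation_maps. \<forall>r\<in>relations. \<forall>b. \<forall>p\<in>Y. E r b \<ominus> r b \<in> p)"
proof -
  interpret B: generated_base_change R M A "residue_product R Y" "residue_product_map R Y"
    by (intro generated_base_change.intro generated_base_change_axioms.intro generated_module_axioms
        residue_product_cring[OF Y] residue_product_map_hom[OF Y])
  have eq: "residue_product_map R Y (E r b) = residue_product_map R Y (r b) \<longleftrightarrow> (\<forall>p\<in>Y. E r b \<ominus> r b \<in> p)"
    if "E \<in> relation_maps" "r \<in> relations" for E r b
  proof (rule residue_product_map_eq_iff[OF R.is_cring Y])
    have "E \<in> lin_hom R V V" using that(1) by (simp add: relation_maps_def)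
    then show "E r b \<in> carrier R" "r b \<in> carrier R"
      using relations_carrier[OF that(2)] by (auto intro: free_module_coeff dest: lin_homD(1))
  qed
  show ?thesis unfolding B.projective_base_change_iff[OF flat] by (simp add: eq cong: bex_cong ball_cong)
qed

theorem theorem3p16:
  fixes R :: "('a, 'r) ring_scheme" and M :: "('a, 'b, 'm) module_scheme" and Y :: "'a set set"
  assumes "cring R"
    and "module R M"
    and "finitely_generated R M"
    and "flat R M"
    and "Y \<subseteq> Spec R"
  shows "projective (residue_product R Y)
           (base_change R (residue_product R Y) (residue_product_map R Y) M)
     \<longleftrightarrow> projective (residue_product R (generalization_cone R Y))
           (base_change R (residue_product R (generalization_cone R Y))
              (residue_product_map R (generalization_cone R Y)) M)"
proof -
  have Yg: "generalization_cone R Y \<subseteq> Spec R" by (auto simp: generalization_cone_def)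
  \<comment> \<open>Every prime lies below itself, so a map that serves the cone serves
    \<open>Y\<close> unchanged.\<close>
  have sub: "Y \<subseteq> generalization_cone R Y" using assms(5) by (auto simp: generalization_cone_def)
  obtain A where A: "finite A" "A \<subseteq> carrier M" "module_span R M A = carrier M"
    using assms(3) by (auto simp: finitely_generated_def)
  interpret generated_module R M A
    using assms(2) A by (simp add: generated_module_def generated_module_axioms_def)
  show ?thesis
    unfolding projective_residue_product_iff[OF assms(4,5)] projective_residue_product_iff[OF assms(4) Yg]
  proof
    assume "\<exists>E\<in>relation_maps. \<forall>r\<in>relations. \<forall>b. \<forall>p\<in>Y. E r b \<ominus>\<^bsub>R\<^esub> r b \<in> p"
    then obtain E where "E \<in> relation_maps"
      "\<And>r b p. r \<in> relations \<Longrightarrow> p \<in> Y \<Longrightarrow> E r b \<ominus>\<^bsub>R\<^esub> r b \<in> p" by blast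
    then show "\<exists>E\<in>relation_maps. \<forall>r\<in>relations. \<forall>b. \<forall>p\<in>generalization_cone R Y. E r b \<ominus>\<^bsub>R\<^esub> r b \<in> p"
      by (rule relation_map_generalizes[OF assms(4,5)])
  qed (use sub in blast)
qed

end
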